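(* Assume $\lim_{n\to\infty}p_n/n=\tau\in[0,1)$ and Conditions A1--A3 for the linear model $\boldsymbol Y=X\boldsymbol\beta_0+\boldsymbol\epsilon$. Then $$\frac{\hat\sigma_\epsilon^2}{\sigma_\epsilon^2}\xrightarrow{\ \mathrm P\ }1\qquad\text{and}\qquad\frac{\hat\sigma_\epsilon^2-\sigma_\epsilon^2}{\zeta_\epsilon}\xrightarrow{\ \mathcal D\ }N(0,1),$$ where $\zeta_\epsilon^2=n^{-1}\{\nu_4+\sigma_\epsilon^4(3\tau-1)/(1-\tau)\}$ and $\nu_4=\mathrm E(\epsilon_i^4)$.
   Context: Model: $Y_i=\boldsymbol X_i^T\boldsymbol\beta_0+\epsilon_i$, $i=1,\dots,n$, with deterministic $\boldsymbol\beta_0\in\mathbb R^{p_n}$, $\boldsymbol Y=(Y_1,\dots,Y_n)^T$, $X=(\boldsymbol X_1,\dots,\boldsymbol X_n)^T\in\mathbb R^{n\times p_n}$, $\boldsymbol\epsilon=(\epsilon_1,\dots,\epsilon_n)^T$, $\mathrm E(\boldsymbol X_i)=\mathbf 0$, $\mathrm{Cov}(\boldsymbol X_i)=\Sigma$. The quantities $p_n,\boldsymbol\beta_0,\sigma_\epsilon^2,\Sigma$ may vary with $n$, except that $\boldsymbol\beta_0$ and $\sigma_\epsilon^2$ do not vary with $n$ when $p_n$ is fixed. Limits are as $n\to\infty$. Conditions (constants $c,C,c^*$ do not depend on $n$). A1: $\{\boldsymbol X_i\}_{i=1}^n$ are i.i.d., $\boldsymbol X_i=\Sigma^{1/2}\boldsymbol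 Z_i$ with $\boldsymbol Z_i=(z_{i1},\dots,z_{ip_n})^T$, $\{z_{ij}\}_{j=1}^{p_n}$ independent for each $i$, $\mathrm E(z_{ij})=0$, $\mathrm E(z_{ij}^2)=1$, and there is $c^*>0$ with $\mathrm P(|z_{ij}|\ge t)\le 2\exp(-c^*t^2)$ for all $n\ge1$, $i\le n$, $j\le p_n$, $t>0$. A2: $\{\epsilon_i\}_{i=1}^n$ are i.i.d. and independent of $\{\boldsymbol X_i\}_{i=1}^n$, $\mathrm E(\epsilon_i)=0$, $\mathrm E(\epsilon_i^2)=\sigma_\epsilon^2\ge c>0$, $\mathrm E(\epsilon_i^8)=O(\sigma_\epsilon^8)$. A3: $0<c<\lambda_{\min}(\Sigma)\le\lambda_{\max}(\Sigma)<C<\infty$. Estimators: $\hat{\boldsymbol\beta}=(X^TX)^{-1}X^T\boldsymbol Y$ (well defined with probability tending to 1), $\hat\sigma_\epsilon^2=\|\boldsymbol Y-X\hat{\boldsymbol\beta}\|_2^2/(n-p_n)$.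
   Formalization: For τ = 0 the asymptotic normality is stated under the added condition ν₄ ≥ (1+δ)σ_ε⁴ for some δ > 0 and all large n; without it ζ_ε can vanish (e.g. ε_i = ±σ_ε with equal probability). Consistency and the case τ > 0 are as stated. *)

theory Defs
  imports
    "HOL-Probability.Probability"
    "HOL-Library.Landau_Symbols"
    "Jordan_Normal_Form.Gauss_Jordan_Elimination"
    "Jordan_Normal_Form.Spectral_Radius"
begin

text \<open>
  The data form a triangular array: for every sample size \<open>n \<ge> 1\<close> there is a probability space
  \<open>M n\<close> (a single space is the special case of a constant \<open>M\<close>), a dimension \<open>p n\<close> and a design
  whose \<open>i\<close>-th covariate is \<open>X n i\<close>.  Observations are indexed by \<open>i < n\<close>, coordinates by
  \<open>j < p n\<close>.  A random vector in dimension \<open>d\<close> is a random element of the product space below;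
  \<^term>\<open>vec d x\<close> is the corresponding algebraic vector.
\<close>

abbreviation Rvec :: "nat \<Rightarrow> (nat \<Rightarrow> real) measure" where
  "Rvec d \<equiv> PiM {..<d} (\<lambda>_. borel)"

definition iid_vars :: "'a measure \<Rightarrow> 'b measure \<Rightarrow> nat \<Rightarrow> (nat \<Rightarrow> 'a \<Rightarrow> 'b) \<Rightarrow> bool" where
  "iid_vars M N n V \<longleftrightarrow>
     prob_space.indep_vars M (\<lambda>_. N) V {..<n} \<and>
     (\<forall>i<n. \<forall>k<n. distr M N (V i) = distr M N (V k))"

text \<open>
  Independence of two random elements with values in spaces over different types
  (\<^const>\<open>prob_space.indep_var\<close> needs a common type).
\<close>

definition indep_elems ::
  "'a measure \<Rightarrow> 'b measure \<Rightarrow> ('a \<Rightarrow> 'b) \<Rightarrow> 'c measure \<Rightarrow> ('a \<Rightarrow> 'c) \<Rightarrow> bool" where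
  "indep_elems M N1 U N2 V \<longleftrightarrow>
     U \<in> measurable M N1 \<and> V \<in> measurable M N2 \<and>
     prob_space.indep_set M
       {U -` A \<inter> space M | A. A \<in> sets N1} {V -` B \<inter> space M | B. B \<in> sets N2}"

definition cov_mat :: "'a measure \<Rightarrow> nat \<Rightarrow> ('a \<Rightarrow> nat \<Rightarrow> real) \<Rightarrow> real mat" where
  "cov_mat M d V = mat d d (\<lambda>(j, k).
     \<integral>\<omega>. (V \<omega> j - (\<integral>\<xi>. V \<xi> j \<partial>M)) * (V \<omega> k - (\<integral>\<xi>. V \<xi> k \<partial>M)) \<partial>M)"

definition psd_mat :: "nat \<Rightarrow> real mat \<Rightarrow> bool" where
  "psd_mat d A \<longleftrightarrow> A \<in> carrier_mat d d \<and> transpose_mat A = A \<and>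
     (\<forall>v \<in> carrier_vec d. 0 \<le> scalar_prod v (A *\<^sub>v v))"

text \<open>\<open>R\<close> is the (unique) symmetric positive semidefinite square root of \<open>A\<close>.\<close>

definition is_sqrt_mat :: "nat \<Rightarrow> real mat \<Rightarrow> real mat \<Rightarrow> bool" where
  "is_sqrt_mat d A R \<longleftrightarrow> psd_mat d R \<and> R * R = A"

text \<open>
  The real eigenvalues are all the eigenvalues for the symmetric matrices to which these are applied.
\<close>

definition lambda_min :: "real mat \<Rightarrow> real" where
  "lambda_min A = Min (spectrum A)"

definition lambda_max :: "real mat \<Rightarrow> real" where
  "lambda_max A = Max (spectrum A)"

definition linear_model ::
  "(nat \<Rightarrow> 'a measure) \<Rightarrow> (nat \<Rightarrow> nat) \<Rightarrow> (nat \<Rightarrow> real mat) \<Rightarrow> (nat \<Rightarrow> real vec) \<Rightarrow>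
   (nat \<Rightarrow> nat \<Rightarrow> 'a \<Rightarrow> nat \<Rightarrow> real) \<Rightarrow> (nat \<Rightarrow> nat \<Rightarrow> 'a \<Rightarrow> real) \<Rightarrow> (nat \<Rightarrow> nat \<Rightarrow> 'a \<Rightarrow> real) \<Rightarrow> bool"
where
  "linear_model M p \<Sigma> \<beta>0 X \<epsilon> Y \<longleftrightarrow>
     (\<forall>n\<ge>1. prob_space (M n) \<and> p n \<ge> 1 \<and> \<beta>0 n \<in> carrier_vec (p n) \<and>
        (\<forall>i<n. X n i \<in> measurable (M n) (Rvec (p n)) \<and> \<epsilon> n i \<in> borel_measurable (M n) \<and>
           (\<forall>j<p n. integrable (M n) (\<lambda>\<omega>. (X n i \<omega> j)\<^sup>2) \<and> (\<integral>\<omega>. X n i \<omega> j \<partial>M n) = 0) \<and>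
           cov_mat (M n) (p n) (X n i) = \<Sigma> n \<and>
           (\<forall>\<omega>\<in>space (M n). Y n i \<omega> = scalar_prod (vec (p n) (X n i \<omega>)) (\<beta>0 n) + \<epsilon> n i \<omega>)))"

definition condition_A1 ::
  "(nat \<Rightarrow> 'a measure) \<Rightarrow> (nat \<Rightarrow> nat) \<Rightarrow> (nat \<Rightarrow> real mat) \<Rightarrow>
   (nat \<Rightarrow> nat \<Rightarrow> 'a \<Rightarrow> nat \<Rightarrow> real) \<Rightarrow> bool"
where
  "condition_A1 M p \<Sigma> X \<longleftrightarrow>
     (\<exists>cstar>0. \<forall>n\<ge>1.
        iid_vars (M n) (Rvec (p n)) n (X n) \<and>
        (\<exists>R Z. is_sqrt_mat (p n) (\<Sigma> n) R \<and>
           (\<forall>i<n. 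
              (\<forall>\<omega>\<in>space (M n). vec (p n) (X n i \<omega>) = R *\<^sub>v vec (p n) (\<lambda>j. Z i j \<omega>)) \<and>
              prob_space.indep_vars (M n) (\<lambda>_. borel) (Z i) {..<p n} \<and>
              (\<forall>j<p n.
                 integrable (M n) (\<lambda>\<omega>. (Z i j \<omega>)\<^sup>2) \<and>
                 (\<integral>\<omega>. Z i j \<omega> \<partial>M n) = 0 \<and>
                 (\<integral>\<omega>. (Z i j \<omega>)\<^sup>2 \<partial>M n) = 1 \<and>
                 (\<forall>t>0. measure (M n) {\<omega> \<in> space (M n). \<bar>Z i j \<omega>\<bar> \<ge> t}
                          \<le> 2 * exp (- cstar * t\<^sup>2))))))"

text \<open>
  \<open>\<sigma> n\<close> stands for \<open>\<sigma>\<^sub>\<epsilon>\<close> at sample size \<open>n\<close>.  The errors at size \<open>n\<close> are identically distributed,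
  so \<open>\<epsilon> n 0\<close> represents their common law.  Independence of the whole error vector from the
  whole design is independence of the two tuples as elements of the product spaces.
\<close>

definition condition_A2 ::
  "(nat \<Rightarrow> 'a measure) \<Rightarrow> (nat \<Rightarrow> nat) \<Rightarrow> (nat \<Rightarrow> real) \<Rightarrow>
   (nat \<Rightarrow> nat \<Rightarrow> 'a \<Rightarrow> nat \<Rightarrow> real) \<Rightarrow> (nat \<Rightarrow> nat \<Rightarrow> 'a \<Rightarrow> real) \<Rightarrow> bool"
where
  "condition_A2 M p \<sigma> X \<epsilon> \<longleftrightarrow>
     (\<exists>c>0. \<forall>n\<ge>1.
        iid_vars (M n) borel n (\<epsilon> n) \<and>
        indep_elems (M n)
          (PiM {..<n} (\<lambda>_. borel)) (\<lambda>\<omega>. \<lambda>i\<in>{..<n}. \<epsilon> n i \<omega>)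
          (PiM {..<n} (\<lambda>_. Rvec (p n))) (\<lambda>\<omega>. \<lambda>i\<in>{..<n}. X n i \<omega>) \<and>
        integrable (M n) (\<lambda>\<omega>. \<epsilon> n 0 \<omega> ^ 8) \<and>
        (\<integral>\<omega>. \<epsilon> n 0 \<omega> \<partial>M n) = 0 \<and>
        (\<integral>\<omega>. (\<epsilon> n 0 \<omega>)\<^sup>2 \<partial>M n) = (\<sigma> n)\<^sup>2 \<and>
        c \<le> (\<sigma> n)\<^sup>2) \<and>
     (\<lambda>n. \<integral>\<omega>. \<epsilon> n 0 \<omega> ^ 8 \<partial>M n) \<in> O(\<lambda>n. \<sigma> n ^ 8)"

definition condition_A3 :: "(nat \<Rightarrow> real mat) \<Rightarrow> bool" where
  "condition_A3 \<Sigma> \<longleftrightarrow>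
     (\<exists>c C. 0 < c \<and> (\<forall>n\<ge>1. c < lambda_min (\<Sigma> n) \<and> lambda_max (\<Sigma> n) < C))"

text \<open>
  Total version of the matrix inverse: a non-invertible matrix is sent to the zero matrix.
  So the least squares estimator gets a conventional value on the event that \<open>X\<^sup>T X\<close> is singular.
\<close>

definition mat_inv :: "real mat \<Rightarrow> real mat" where
  "mat_inv A = (case mat_inverse A of Some B \<Rightarrow> B | None \<Rightarrow> 0\<^sub>m (dim_row A) (dim_col A))"

definition ols :: "real mat \<Rightarrow> real vec \<Rightarrow> real vec" where
  "ols A y = (mat_inv (transpose_mat A * A) * transpose_mat A) *\<^sub>v y"

definition sigma_hat_sq :: "nat \<Rightarrow> nat \<Rightarrow> (nat \<Rightarrow> 'a \<Rightarrow> nat \<Rightarrow> real) \<Rightarrow> (nat \<Rightarrow> 'a \<Rightarrow> real) \<Rightarrow> 'a \<Rightarrow> real" where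
  "sigma_hat_sq n d X Y \<omega> =
     (let A = mat n d (\<lambda>(i, j). X i \<omega> j);
          y = vec n (\<lambda>i. Y i \<omega>);
          r = y - A *\<^sub>v ols A y
      in scalar_prod r r / (real n - real d))"

definition converges_in_prob :: "(nat \<Rightarrow> 'a measure) \<Rightarrow> (nat \<Rightarrow> 'a \<Rightarrow> real) \<Rightarrow> real \<Rightarrow> bool" where
  "converges_in_prob M V a \<longleftrightarrow>
     (\<forall>\<^sub>F n in sequentially. V n \<in> borel_measurable (M n)) \<and>
     (\<forall>e>0. (\<lambda>n. measure (M n) {\<omega> \<in> space (M n). \<bar>V n \<omega> - a\<bar> > e}) \<longlonglongrightarrow> 0)"

end

(*
  Standardise the design as X = Z R with R invertible and Z having independent entries, so that on
  the event that Z has full column rank the residual vector is Q epsilon, where Q projects onto the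
  orthogonal complement of the columns of Z.

  Q is obtained from the identity by deflating one column at a time.  Every step fails with
  exponentially small probability, which gives full rank, and it multiplies the expectation of
  S = sum_i Q_ii^2 by about 1 - 2/m, m being the current rank of Q.  Hence S is close to (n - p)^2/n;
  since this is its minimal value for the trace n - p, S concentrates there.

  Given the design, the residual sum of squares is a quadratic form in the errors whose variance
  depends on Q only through S and the trace.  Its characteristic function satisfies the differential
  equation of a Gaussian one up to an error of order n^(-1/2), by Tikhomirov's leave-one-out
  expansion.  Integrating over the design and applying Levy's continuity theorem finishes the proof.
*)
theory Submission
  imports Defs "HOL-Real_Asymp.Real_Asymp"
begin

section \<open>Moments of linear and quadratic forms\<close>

text \<open>Let \<open>m = n - p\<close> and let \<open>\<kappa>\<close> be the fourth moment of the
  standardised errors. Given a design of full rank, the residual form has variance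
  \<open>(\<kappa> - 3) * S + 2 * m\<close>. At \<open>S = m\<^sup>2 / n\<close>, multiplied by
  \<open>n / m\<^sup>2\<close>, this is \<open>\<kappa> - 3 + 2 * n / m\<close>, whose limit
  \<open>\<kappa> + (3 * \<tau> - 1) / (1 - \<tau>)\<close> is the bracket in the variance formula
  divided by the fourth power of \<sigma>. The projection is random and nothing is known about its
  individual entries. The normal approximation is therefore proved for every projection, with
  constants that depend on moments only. What remains to be learned about the design is the
  probability of rank deficiency and the mean of \<open>S\<close>. The entries of Z may be discrete,
  so singular designs can have positive probability. Each bound carries this probability as an
  additive term. The tail condition on Z enters as a uniform fourth moment bound.\<close>

lemma abs_power_le_one_plus:
  fixes u :: real assumes "k \<le> n" shows "\<bar>u\<bar> ^ k \<le> 1 + \<bar>u\<bar> ^ n"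
proof (cases "\<bar>u\<bar> \<le> 1")
  case True
  then have "\<bar>u\<bar> ^ k \<le> 1" by (simp add: power_le_one)
  then show ?thesis by (smt (verit) zero_le_power abs_ge_zero)
next
  case False
  then have "\<bar>u\<bar> ^ k \<le> \<bar>u\<bar> ^ n" using assms by (intro power_increasing) auto
  then show ?thesis by simp
qed

text \<open>The Bochner integral of a non-integrable function is 0, so only the majorant has to be
  integrable. This spares measurability proofs for inner integrals and for deflated
  diagonals.\<close>

lemma norm_integral_le:
  fixes f :: "'a \<Rightarrow> 'b::{banach, second_countable_topology}" and g :: "'a \<Rightarrow> real"
  assumes "integrable M g" "\<And>\<omega>. \<omega> \<in> space M \<Longrightarrow> norm (f \<omega>) \<le> g \<omega>"
  shows "norm (\<integral>\<omega>. f \<omega> \<partial>M) \<le> (\<integral>\<omega>. g \<omega> \<partial>M)"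
proof (cases "integrable M f")
  case True
  then show ?thesis
    using assms by (intro order_trans[OF integral_norm_bound integral_mono]) auto
next
  case False
  then have "(\<integral>\<omega>. f \<omega> \<partial>M) = 0" by (rule not_integrable_integral_eq)
  moreover have "0 \<le> (\<integral>\<omega>. g \<omega> \<partial>M)"
    using assms(2) by (intro Bochner_Integration.integral_nonneg) (meson norm_ge_zero order_trans)
  ultimately show ?thesis by simp
qed

lemma power4_sum_le:
  fixes u v :: real
  shows "(u + v) ^ 4 \<le> 8 * (u ^ 4 + v ^ 4)"
proof -
  have sq: "(a + b)\<^sup>2 \<le> 2 * (a\<^sup>2 + b\<^sup>2)" for a b :: real
    using zero_le_power2[of "a - b"] by (simp add: power2_sum power2_diff)
  have "(u + v) ^ 4 = ((u + v)\<^sup>2)\<^sup>2" by simp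
  also have "\<dots> \<le> (2 * (u\<^sup>2 + v\<^sup>2))\<^sup>2" by (intro power_mono sq) auto
  also have "\<dots> = 4 * (u\<^sup>2 + v\<^sup>2)\<^sup>2" by (simp only: power_mult_distrib) simp
  also have "\<dots> \<le> 4 * (2 * ((u\<^sup>2)\<^sup>2 + (v\<^sup>2)\<^sup>2))" by (intro mult_left_mono sq) auto
  finally show ?thesis by simp
qed

context prob_space
begin

lemma integrable_power_le:
  fixes U :: "'a \<Rightarrow> real"
  assumes "integrable M (\<lambda>\<omega>. U \<omega> ^ n)" "U \<in> borel_measurable M" "k \<le> n"
  shows "integrable M (\<lambda>\<omega>. U \<omega> ^ k)"
proof (rule Bochner_Integration.integrable_bound)
  show "integrable M (\<lambda>\<omega>. 1 + \<bar>U \<omega> ^ n\<bar>)" using assms by auto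
  show "AE \<omega> in M. norm (U \<omega> ^ k) \<le> norm (1 + \<bar>U \<omega> ^ n\<bar>)"
    using abs_power_le_one_plus[OF assms(3)] by (auto simp: power_abs)
qed (use assms in measurable)

lemma integrable_mult_square:
  fixes U V :: "'a \<Rightarrow> real"
  assumes "integrable M (\<lambda>\<omega>. U \<omega> ^ 2)" "integrable M (\<lambda>\<omega>. V \<omega> ^ 2)"
    and [measurable]: "U \<in> borel_measurable M" "V \<in> borel_measurable M"
  shows "integrable M (\<lambda>\<omega>. U \<omega> * V \<omega>)"
proof (rule Bochner_Integration.integrable_bound)
  show "integrable M (\<lambda>\<omega>. U \<omega> ^ 2 + V \<omega> ^ 2)" using assms by auto
  have "\<bar>u * v\<bar> \<le> u\<^sup>2 + v\<^sup>2" for u v :: real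
  proof -
    have "2 * (\<bar>u\<bar> * \<bar>v\<bar>) \<le> u\<^sup>2 + v\<^sup>2"
      using sum_squares_bound[of "\<bar>u\<bar>" "\<bar>v\<bar>"] by simp
    moreover have "0 \<le> \<bar>u\<bar> * \<bar>v\<bar>" by simp
    ultimately show ?thesis unfolding abs_mult by linarith
  qed
  then show "AE \<omega> in M. norm (U \<omega> * V \<omega>) \<le> norm (U \<omega> ^ 2 + V \<omega> ^ 2)"
    by auto
qed measurable

lemma expectation_abs_le_sqrt:
  fixes U :: "'a \<Rightarrow> real"
  assumes "integrable M (\<lambda>\<omega>. U \<omega> ^ 2)" "U \<in> borel_measurable M" "expectation (\<lambda>\<omega>. U \<omega> ^ 2) \<le> c"
  shows "expectation (\<lambda>\<omega>. \<bar>U \<omega>\<bar>) \<le> sqrt c"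
proof -
  have "integrable M (\<lambda>\<omega>. \<bar>U \<omega>\<bar>)" using integrable_power_le[OF assms(1,2), of 1] by simp
  then have "variance (\<lambda>\<omega>. \<bar>U \<omega>\<bar>) = expectation (\<lambda>\<omega>. \<bar>U \<omega>\<bar> ^ 2) - (expectation (\<lambda>\<omega>. \<bar>U \<omega>\<bar>))\<^sup>2"
    using assms by (subst variance_eq) auto
  moreover have "0 \<le> variance (\<lambda>\<omega>. \<bar>U \<omega>\<bar>)" by (intro integral_nonneg_AE) auto
  ultimately have "(expectation (\<lambda>\<omega>. \<bar>U \<omega>\<bar>))\<^sup>2 \<le> c" using assms by simp
  then show ?thesis by (simp add: real_le_rsqrt)
qed

end

text \<open>The laws of the variables may differ. The same locale serves for the entries of one
  design column and for the standardised errors; the uniform datum is the fourth moment bound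
  \<open>K\<close>.\<close>

locale standard_indep = prob_space M for M :: "'a measure" +
  fixes I :: "'i set" and x :: "'i \<Rightarrow> 'a \<Rightarrow> real" and K :: real
  assumes finite_I: "finite I"
    and indep: "indep_vars (\<lambda>_. borel) x I"
    and integrable_4: "\<And>i. i \<in> I \<Longrightarrow> integrable M (\<lambda>\<omega>. x i \<omega> ^ 4)"
    and mean: "\<And>i. i \<in> I \<Longrightarrow> expectation (x i) = 0"
    and var: "\<And>i. i \<in> I \<Longrightarrow> expectation (\<lambda>\<omega>. x i \<omega> ^ 2) = 1"
    and fourth: "\<And>i. i \<in> I \<Longrightarrow> expectation (\<lambda>\<omega>. x i \<omega> ^ 4) \<le> K"
    and K_ge_1: "1 \<le> K"
begin

lemma x_measurable: "i \<in> I \<Longrightarrow> x i \<in> borel_measurable M"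
  using indep by (auto simp: indep_vars_def)

text \<open>
  The \<open>\<sigma>\<close>-algebra generated by the coordinates \<open>x j\<close> with \<open>j \<in> J\<close>, on the space of \<open>M\<close>: measurability
  with respect to it expresses that a random variable is a function of these coordinates only.
\<close>

definition coords :: "'i set \<Rightarrow> 'a measure" where
  "coords J = vimage_algebra (space M) (\<lambda>\<omega>. \<lambda>j\<in>J. x j \<omega>) (PiM J (\<lambda>_. borel))"

lemma coord_measurable:
  assumes "j \<in> J" shows "x j \<in> borel_measurable (coords J)"
proof -
  have "(\<lambda>\<omega>. (\<lambda>y. y j) (\<lambda>j\<in>J. x j \<omega>)) \<in> borel_measurable (coords J)"
    unfolding coords_def
    by (rule measurable_compose[OF measurable_vimage_algebra1 measurable_component_singleton])
       (use assms in \<open>auto simp: space_PiM\<close>)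
  then show ?thesis using assms by simp
qed

text \<open>Both variables generate sub-sigma-algebras of those generated by the blocks
  \<open>{i}\<close> and \<open>J\<close>, and independence passes to smaller families. Working with
  sigma-algebras avoids writing \<open>U\<close> as an explicit function of the tuple.\<close>

lemma indep_coord:
  fixes f :: "real \<Rightarrow> 'b::topological_space" and U :: "'a \<Rightarrow> 'b"
  assumes J: "J \<subseteq> I" "i \<in> I" "i \<notin> J" and [measurable]: "f \<in> borel_measurable borel"
    and U: "U \<in> borel_measurable (coords J)"
  shows "indep_var borel (\<lambda>\<omega>. f (x i \<omega>)) borel U"
proof -
  let ?T = "\<lambda>\<omega>. \<lambda>j\<in>J. x j \<omega>" and ?S = "\<lambda>\<omega>. \<lambda>j\<in>{i}. x j \<omega>"
  have ind: "indep_var (PiM {i} (\<lambda>_. borel)) ?S (PiM J (\<lambda>_. borel)) ?T"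
    by (rule indep_var_restrict[OF indep]) (use J in auto)
  have T: "?T \<in> space M \<rightarrow> space (PiM J (\<lambda>_. borel))" by (auto simp: space_PiM)
  have ST: "?S \<in> measurable M (PiM {i} (\<lambda>_. borel))" "?T \<in> measurable M (PiM J (\<lambda>_. borel))"
    using ind by (auto dest: indep_var_rv1 indep_var_rv2)
  have sub: "sets (coords J) \<subseteq> sets M"
    unfolding coords_def by (subst sets_vimage_algebra2[OF T]) (use ST(2) in \<open>auto intro: measurable_sets\<close>)
  have spc: "space (coords J) = space M" by (simp add: coords_def)
  have UM: "random_variable borel U"
    using U sub spc by (auto simp: measurable_def)
  have fM: "random_variable borel (\<lambda>\<omega>. f (x i \<omega>))" using x_measurable[OF J(2)] by measurable
  have A: "{(\<lambda>\<omega>. f (x i \<omega>)) -` A \<inter> space M |A. A \<in> sets borel} \<subseteq>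
      {?S -` A \<inter> space M |A. A \<in> sets (PiM {i} (\<lambda>_. borel))}"
  proof safe
    fix A :: "'b set" assume A: "A \<in> sets borel"
    have "(\<lambda>y. f (y i)) -` A \<inter> space (PiM {i} (\<lambda>_. borel)) \<in> sets (PiM {i} (\<lambda>_. borel :: real measure))"
      using A by measurable
    moreover have "(\<lambda>\<omega>. f (x i \<omega>)) -` A \<inter> space M =
        ?S -` ((\<lambda>y. f (y i)) -` A \<inter> space (PiM {i} (\<lambda>_. borel))) \<inter> space M"
      by (auto simp: space_PiM)
    ultimately show "\<exists>B. (\<lambda>\<omega>. f (x i \<omega>)) -` A \<inter> space M = ?S -` B \<inter> space M \<and>
        B \<in> sets (PiM {i} (\<lambda>_. borel))" by blast
  qed
  have B: "{U -` A \<inter> space M |A. A \<in> sets borel} \<subseteq> {?T -` A \<inter> space M |A. A \<in> sets (PiM J (\<lambda>_. borel))}"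
  proof safe
    fix A :: "'b set" assume "A \<in> sets borel"
    then have "U -` A \<inter> space M \<in> sets (coords J)"
      using measurable_sets[OF U] spc by auto
    then show "\<exists>B. U -` A \<inter> space M = ?T -` B \<inter> space M \<and> B \<in> sets (PiM J (\<lambda>_. borel))"
      unfolding coords_def sets_vimage_algebra2[OF T] by auto
  qed
  have "indep_set (sigma_sets (space M) {?S -` A \<inter> space M |A. A \<in> sets (PiM {i} (\<lambda>_. borel))})
     (sigma_sets (space M) {?T -` A \<inter> space M |A. A \<in> sets (PiM J (\<lambda>_. borel))})"
    using ind unfolding indep_var_eq by blast
  then have "indep_set (sigma_sets (space M) {(\<lambda>\<omega>. f (x i \<omega>)) -` A \<inter> space M |A. A \<in> sets borel})
     (sigma_sets (space M) {U -` A \<inter> space M |A. A \<in> sets borel})"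
    unfolding indep_set_def
    by (rule indep_sets_mono_sets) (use sigma_sets_subseteq[OF A] sigma_sets_subseteq[OF B] in \<open>auto split: bool.split\<close>)
  then show ?thesis unfolding indep_var_eq using UM fM by blast
qed

lemma coords_measurable_M:
  assumes "J \<subseteq> I" "U \<in> measurable (coords J) N" shows "U \<in> measurable M N"
proof -
  have T: "(\<lambda>\<omega>. \<lambda>j\<in>J. x j \<omega>) \<in> measurable M (PiM J (\<lambda>_. borel))"
    using assms(1) x_measurable by (intro measurable_restrict) auto
  have "id \<in> measurable M (coords J)"
    unfolding coords_def by (rule measurable_vimage_algebra2) (use T in auto)
  from measurable_comp[OF this assms(2)] show ?thesis by simp
qed

lemma coord_mult:
  fixes f :: "real \<Rightarrow> 'b::{real_normed_field, banach, second_countable_topology}" and U :: "'a \<Rightarrow> 'b"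
  assumes J: "J \<subseteq> I" "i \<in> I" "i \<notin> J" and f: "f \<in> borel_measurable borel"
    and U: "U \<in> borel_measurable (coords J)"
    and int: "integrable M (\<lambda>\<omega>. f (x i \<omega>))" "integrable M U"
  shows "integrable M (\<lambda>\<omega>. f (x i \<omega>) * U \<omega>)"
    and "expectation (\<lambda>\<omega>. f (x i \<omega>) * U \<omega>) = expectation (\<lambda>\<omega>. f (x i \<omega>)) * expectation U"
  using indep_var_integrable[OF indep_coord[OF J f U] int]
    indep_var_lebesgue_integral[OF indep_coord[OF J f U] int] by auto

lemma integrable_pow: "i \<in> I \<Longrightarrow> k \<le> 4 \<Longrightarrow> integrable M (\<lambda>\<omega>. x i \<omega> ^ k)"
  by (rule integrable_power_le[OF integrable_4 x_measurable]) auto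

text \<open>A new coordinate is independent of the partial sum, and cross terms of odd degree vanish
  because both factors are centred. What the fourth moment gains is \<open>6 * a k ^ 2 * ?s\<close>
  and at most \<open>K * a k ^ 4\<close>. A factor \<open>C\<close> is preserved if
  \<open>6 \<le> 2 * C\<close> and \<open>K \<le> C\<close>; \<open>K + 3\<close> satisfies
  both.\<close>

lemma linear_form:
  fixes a :: "'i \<Rightarrow> real"
  assumes "J \<subseteq> I"
  defines "L \<equiv> \<lambda>\<omega>. \<Sum>j\<in>J. a j * x j \<omega>"
  shows "integrable M (\<lambda>\<omega>. L \<omega> ^ 4) \<and> expectation L = 0 \<and> expectation (\<lambda>\<omega>. L \<omega> ^ 2) = (\<Sum>j\<in>J. a j ^ 2)
    \<and> expectation (\<lambda>\<omega>. L \<omega> ^ 4) \<le> (K + 3) * (\<Sum>j\<in>J. a j ^ 2) ^ 2"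
  unfolding L_def using finite_subset[OF assms(1) finite_I] assms(1)
proof (induction J rule: finite_induct)
  case empty
  then show ?case by simp
next
  case (insert k J)
  let ?L = "\<lambda>\<omega>. \<Sum>j\<in>J. a j * x j \<omega>" and ?s = "\<Sum>j\<in>J. a j ^ 2"
  have J: "J \<subseteq> I" "k \<in> I" "k \<notin> J" using insert by auto
  have IH: "integrable M (\<lambda>\<omega>. ?L \<omega> ^ 4)" "expectation ?L = 0" "expectation (\<lambda>\<omega>. ?L \<omega> ^ 2) = ?s"
    "expectation (\<lambda>\<omega>. ?L \<omega> ^ 4) \<le> (K + 3) * ?s ^ 2" using insert by auto
  have Lc: "?L \<in> borel_measurable (coords J)"
    using coord_measurable by (intro borel_measurable_sum borel_measurable_times) auto
  have LM: "?L \<in> borel_measurable M" by (rule coords_measurable_M[OF J(1) Lc])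
  have Li: "integrable M (\<lambda>\<omega>. ?L \<omega> ^ m)" if "m \<le> 4" for m
    by (rule integrable_power_le[OF IH(1) LM that])
  have prod: "integrable M (\<lambda>\<omega>. x k \<omega> ^ l * ?L \<omega> ^ m)"
    "expectation (\<lambda>\<omega>. x k \<omega> ^ l * ?L \<omega> ^ m) = expectation (\<lambda>\<omega>. x k \<omega> ^ l) * expectation (\<lambda>\<omega>. ?L \<omega> ^ m)"
    if "l \<le> 4" "m \<le> 4" for l m
    using coord_mult[OF J, of "\<lambda>y. y ^ l" "\<lambda>\<omega>. ?L \<omega> ^ m"] Lc integrable_pow[OF J(2) that(1)] Li[OF that(2)]
    by (auto)
  have e: "(\<Sum>j\<in>insert k J. a j * x j \<omega>) = a k * x k \<omega> + ?L \<omega>" for \<omega>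
    using insert by simp
  \<comment> \<open>The exponents 0 and 1 are kept so that every mixed term has the shape covered by
    \<open>prod\<close>.\<close>
  have pw4: "(a k * u + l) ^ 4 = l ^ 4 + 4 * a k * (u ^ 1 * l ^ 3) + 6 * a k ^ 2 * (u ^ 2 * l ^ 2)
     + 4 * a k ^ 3 * (u ^ 3 * l ^ 1) + a k ^ 4 * (u ^ 4 * l ^ 0)" for u l
    by (simp add: power4_eq_xxxx power3_eq_cube power2_eq_square algebra_simps)
  have pw2: "(a k * u + l) ^ 2 = l ^ 2 + 2 * a k * (u ^ 1 * l ^ 1) + a k ^ 2 * (u ^ 2 * l ^ 0)" for u l
    by (simp add: power2_eq_square algebra_simps)
  have m1: "expectation (\<lambda>\<omega>. x k \<omega> ^ 1) = 0" using mean[OF J(2)] by simp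
  have l1: "expectation (\<lambda>\<omega>. ?L \<omega> ^ 1) = 0" using IH(2) by simp
  have int4: "integrable M (\<lambda>\<omega>. (a k * x k \<omega> + ?L \<omega>) ^ 4)"
    unfolding pw4 by (intro Bochner_Integration.integrable_add integrable_mult_right prod Li) auto
  have "expectation (\<lambda>\<omega>. (a k * x k \<omega> + ?L \<omega>) ^ 2) = ?s + a k ^ 2"
  proof -
    have "integrable M (\<lambda>\<omega>. ?L \<omega> ^ 2)" "integrable M (\<lambda>\<omega>. x k \<omega> ^ 1 * ?L \<omega> ^ 1)"
      "integrable M (\<lambda>\<omega>. x k \<omega> ^ 2 * ?L \<omega> ^ 0)"
      using prod(1)[of 1 1] prod(1)[of 2 0] Li[of 2] by auto
    moreover have "expectation (\<lambda>\<omega>. x k \<omega> ^ 1 * ?L \<omega> ^ 1) = 0"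
      "expectation (\<lambda>\<omega>. x k \<omega> ^ 2 * ?L \<omega> ^ 0) = 1"
      using prod(2)[of 1 1] prod(2)[of 2 0] m1 var[OF J(2)] by (auto simp: prob_space)
    ultimately show ?thesis
      unfolding pw2 by (simp only: Bochner_Integration.integral_add Bochner_Integration.integrable_add
        integrable_mult_right Bochner_Integration.integral_mult_right_zero IH(3))
  qed
  moreover have "expectation (\<lambda>\<omega>. a k * x k \<omega> + ?L \<omega>) = 0"
    using integrable_pow[OF J(2), of 1] Li[of 1] by (simp add: mean J IH)
  moreover have "expectation (\<lambda>\<omega>. (a k * x k \<omega> + ?L \<omega>) ^ 4) =
     expectation (\<lambda>\<omega>. ?L \<omega> ^ 4) + 6 * a k ^ 2 * ?s + a k ^ 4 * expectation (\<lambda>\<omega>. x k \<omega> ^ 4)"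
  proof -
    have "expectation (\<lambda>\<omega>. x k \<omega> ^ 1 * ?L \<omega> ^ 3) = 0"
      "expectation (\<lambda>\<omega>. x k \<omega> ^ 2 * ?L \<omega> ^ 2) = ?s"
      "expectation (\<lambda>\<omega>. x k \<omega> ^ 3 * ?L \<omega> ^ 1) = 0"
      "expectation (\<lambda>\<omega>. x k \<omega> ^ 4 * ?L \<omega> ^ 0) = expectation (\<lambda>\<omega>. x k \<omega> ^ 4)"
      using prod(2)[of 1 3] prod(2)[of 2 2] prod(2)[of 3 1] prod(2)[of 4 0] m1 l1 var[OF J(2)] IH(3)
      by (auto simp: prob_space)
    moreover have "integrable M (\<lambda>\<omega>. x k \<omega> ^ 1 * ?L \<omega> ^ 3)"
      "integrable M (\<lambda>\<omega>. x k \<omega> ^ 2 * ?L \<omega> ^ 2)"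
      "integrable M (\<lambda>\<omega>. x k \<omega> ^ 3 * ?L \<omega> ^ 1)"
      "integrable M (\<lambda>\<omega>. x k \<omega> ^ 4 * ?L \<omega> ^ 0)"
      using prod(1)[of 1 3] prod(1)[of 2 2] prod(1)[of 3 1] prod(1)[of 4 0] by auto
    ultimately show ?thesis
      unfolding pw4 by (simp only: Bochner_Integration.integral_add Bochner_Integration.integrable_add
        integrable_mult_right Bochner_Integration.integral_mult_right_zero IH(1))
  qed
  moreover have "expectation (\<lambda>\<omega>. ?L \<omega> ^ 4) + 6 * a k ^ 2 * ?s + a k ^ 4 * expectation (\<lambda>\<omega>. x k \<omega> ^ 4)
     \<le> (K + 3) * (a k ^ 2 + ?s) ^ 2"
  proof -
    have s0: "0 \<le> ?s" by (simp add: sum_nonneg)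
    have "a k ^ 4 * expectation (\<lambda>\<omega>. x k \<omega> ^ 4) \<le> a k ^ 4 * K"
      by (intro mult_left_mono fourth J) auto
    moreover have "(K + 3) * (a k ^ 2 + ?s) ^ 2 = (K+3) * ?s^2 + 2 * (K+3) * (a k ^ 2 * ?s) + (K + 3) * a k ^ 4"
      by (simp add: power2_eq_square power4_eq_xxxx algebra_simps)
    moreover have "6 * (a k ^ 2 * ?s) \<le> 2 * (K+3) * (a k ^ 2 * ?s)"
      using K_ge_1 s0 by (intro mult_right_mono) auto
    moreover have "a k ^ 4 * K \<le> (K+3) * a k ^ 4" by (simp add: algebra_simps)
    moreover have "6 * a k ^ 2 * ?s = 6 * (a k ^ 2 * ?s)" by simp
    ultimately show ?thesis using IH(4) by linarith
  qed
  ultimately show ?case unfolding e using int4 insert by (auto simp: add.commute)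
qed

text \<open>Adding the index \<open>k\<close> adds
  \<open>A k k * (x k ^ 2 - 1) + 2 * x k * ?L\<close>. The three parts of the new form are
  uncorrelated, whatever the third moment of \<open>x k\<close>, since \<open>?L\<close> is centred.
  The second moment grows by at most \<open>K * A k k ^ 2 + 4 * ?s\<close> and the sum of squared
  entries by \<open>A k k ^ 2 + 2 * ?s\<close>, hence the factor \<open>K + 2\<close>.\<close>

lemma quadratic_form:
  fixes A :: "'i \<Rightarrow> 'i \<Rightarrow> real"
  assumes "J \<subseteq> I" and sym: "\<And>i j. A i j = A j i"
  defines "q \<equiv> \<lambda>\<omega>. (\<Sum>i\<in>J. \<Sum>j\<in>J. A i j * x i \<omega> * x j \<omega>) - (\<Sum>i\<in>J. A i i)"
  shows "integrable M (\<lambda>\<omega>. q \<omega> ^ 2) \<and> expectation q = 0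
    \<and> expectation (\<lambda>\<omega>. q \<omega> ^ 2) \<le> (K + 2) * (\<Sum>i\<in>J. \<Sum>j\<in>J. A i j ^ 2)"
  unfolding q_def using finite_subset[OF assms(1) finite_I] assms(1)
proof (induction J rule: finite_induct)
  case empty
  then show ?case by simp
next
  case (insert k J)
  let ?q = "\<lambda>\<omega>. (\<Sum>i\<in>J. \<Sum>j\<in>J. A i j * x i \<omega> * x j \<omega>) - (\<Sum>i\<in>J. A i i)"
  let ?L = "\<lambda>\<omega>. \<Sum>j\<in>J. A k j * x j \<omega>" and ?s = "\<Sum>j\<in>J. A k j ^ 2"
  have J: "J \<subseteq> I" "k \<in> I" "k \<notin> J" using insert by auto
  have IH: "integrable M (\<lambda>\<omega>. ?q \<omega> ^ 2)" "expectation ?q = 0"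
    "expectation (\<lambda>\<omega>. ?q \<omega> ^ 2) \<le> (K + 2) * (\<Sum>i\<in>J. \<Sum>j\<in>J. A i j ^ 2)" using insert by auto
  note lin = linear_form[OF J(1), of "A k"]
  have Lc: "?L \<in> borel_measurable (coords J)"
    using coord_measurable by (intro borel_measurable_sum borel_measurable_times) auto
  have qc: "?q \<in> borel_measurable (coords J)"
    using coord_measurable by (intro borel_measurable_sum borel_measurable_times borel_measurable_diff) auto
  have LM: "?L \<in> borel_measurable M" by (rule coords_measurable_M[OF J(1) Lc])
  have qM: "?q \<in> borel_measurable M" by (rule coords_measurable_M[OF J(1) qc])
  have iL: "integrable M ?L" "integrable M (\<lambda>\<omega>. ?L \<omega> ^ 2)"
    using integrable_power_le[OF _ LM, of 4 1] integrable_power_le[OF _ LM, of 4 2] lin by auto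
  have iq: "integrable M ?q" using integrable_power_le[OF IH(1) qM, of 1] by simp
  have iqL: "integrable M (\<lambda>\<omega>. ?q \<omega> * ?L \<omega>)" by (rule integrable_mult_square[OF IH(1) iL(2) qM LM])
  have i1: "integrable M (\<lambda>\<omega>. x k \<omega>)" using integrable_pow[OF J(2), of 1] by simp
  have i2: "integrable M (\<lambda>\<omega>. x k \<omega> ^ 2 - 1)" using integrable_pow[OF J(2), of 2] by simp
  have sq: "(u ^ 2 - 1) ^ 2 = u ^ 4 - 2 * u ^ 2 + 1" "(u ^ 2 - 1) * u = u ^ 3 - u" for u :: real
    by (simp_all add: power4_eq_xxxx power3_eq_cube power2_eq_square algebra_simps)
  have i22: "integrable M (\<lambda>\<omega>. (x k \<omega> ^ 2 - 1) ^ 2)" "integrable M (\<lambda>\<omega>. (x k \<omega> ^ 2 - 1) * x k \<omega>)"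
    unfolding sq using integrable_pow[OF J(2), of 2] integrable_pow[OF J(2), of 3]
      integrable_pow[OF J(2), of 4] i1 by auto
  have e: "(\<Sum>i\<in>insert k J. \<Sum>j\<in>insert k J. A i j * x i \<omega> * x j \<omega>) - (\<Sum>i\<in>insert k J. A i i)
      = ?q \<omega> + A k k * (x k \<omega> ^ 2 - 1) + 2 * (x k \<omega> * ?L \<omega>)" for \<omega>
  proof -
    have "(\<Sum>i\<in>J. A i k * x i \<omega> * x k \<omega>) = x k \<omega> * ?L \<omega>"
      by (simp add: sum_distrib_left sym[of _ k] ac_simps)
    moreover have "(\<Sum>j\<in>J. A k j * x k \<omega> * x j \<omega>) = x k \<omega> * ?L \<omega>"
      by (simp add: sum_distrib_left ac_simps)
    ultimately show ?thesis using insert(1,2)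
      by (simp add: sum.distrib power2_eq_square algebra_simps)
  qed
  have sq3: "(q + a * b + 2 * (u * l)) ^ 2 = q ^ 2 + a ^ 2 * b ^ 2 + 4 * (u ^ 2 * l ^ 2)
     + 2 * a * (b * q) + 4 * (u * (q * l)) + 4 * a * ((b * u) * l)" for q a b u l :: real
    by (simp add: power2_eq_square algebra_simps)
  note c1 = coord_mult[OF J, of "\<lambda>y. y ^ 2" "\<lambda>\<omega>. ?L \<omega> ^ 2"]
   and c2 = coord_mult[OF J, of "\<lambda>y. y ^ 2 - 1" ?q]
   and c3 = coord_mult[OF J, of "\<lambda>y. y" "\<lambda>\<omega>. ?q \<omega> * ?L \<omega>"]
   and c4 = coord_mult[OF J, of "\<lambda>y. (y ^ 2 - 1) * y" ?L]
   and c5 = coord_mult[OF J, of "\<lambda>y. y" ?L]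
  have ii: "integrable M (\<lambda>\<omega>. x k \<omega> ^ 2 * ?L \<omega> ^ 2)" "integrable M (\<lambda>\<omega>. (x k \<omega> ^ 2 - 1) * ?q \<omega>)"
    "integrable M (\<lambda>\<omega>. x k \<omega> * (?q \<omega> * ?L \<omega>))" "integrable M (\<lambda>\<omega>. ((x k \<omega> ^ 2 - 1) * x k \<omega>) * ?L \<omega>)"
    "integrable M (\<lambda>\<omega>. x k \<omega> * ?L \<omega>)"
    using c1(1) c2(1) c3(1) c4(1) c5(1) Lc qc iL iq iqL i1 i2 i22 integrable_pow[OF J(2), of 2] by auto
  have ee: "expectation (\<lambda>\<omega>. x k \<omega> ^ 2 * ?L \<omega> ^ 2) = ?s" "expectation (\<lambda>\<omega>. (x k \<omega> ^ 2 - 1) * ?q \<omega>) = 0"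
    "expectation (\<lambda>\<omega>. x k \<omega> * (?q \<omega> * ?L \<omega>)) = 0" "expectation (\<lambda>\<omega>. ((x k \<omega> ^ 2 - 1) * x k \<omega>) * ?L \<omega>) = 0"
    "expectation (\<lambda>\<omega>. x k \<omega> * ?L \<omega>) = 0"
    using c1(2) c2(2) c3(2) c4(2) c5(2) Lc qc iL iq iqL i1 i2 i22 integrable_pow[OF J(2), of 2]
      lin IH(2) var[OF J(2)] mean[OF J(2)] by (auto)
  have "integrable M (\<lambda>\<omega>. (?q \<omega> + A k k * (x k \<omega> ^ 2 - 1) + 2 * (x k \<omega> * ?L \<omega>)) ^ 2)"
    unfolding sq3 by (intro Bochner_Integration.integrable_add integrable_mult_right IH i22 ii)
  moreover have "expectation (\<lambda>\<omega>. ?q \<omega> + A k k * (x k \<omega> ^ 2 - 1) + 2 * (x k \<omega> * ?L \<omega>)) = 0"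
    using iq i2 ii(5) IH(2) ee(5) integrable_pow[OF J(2), of 2] var[OF J(2)] prob_space
    by (simp add: Bochner_Integration.integral_add)
  moreover have "expectation (\<lambda>\<omega>. (?q \<omega> + A k k * (x k \<omega> ^ 2 - 1) + 2 * (x k \<omega> * ?L \<omega>)) ^ 2)
     = expectation (\<lambda>\<omega>. ?q \<omega> ^ 2) + A k k ^ 2 * expectation (\<lambda>\<omega>. (x k \<omega> ^ 2 - 1) ^ 2) + 4 * ?s"
    unfolding sq3
    by (simp only: Bochner_Integration.integral_add Bochner_Integration.integrable_add integrable_mult_right
      IH(1) i22 ii ee Bochner_Integration.integral_mult_right_zero)
  moreover have "expectation (\<lambda>\<omega>. (x k \<omega> ^ 2 - 1) ^ 2) \<le> K"
    unfolding sq using integrable_pow[OF J(2), of 2] integrable_pow[OF J(2), of 4] fourth[OF J(2)]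
      var[OF J(2)] prob_space by simp
  then have "A k k ^ 2 * expectation (\<lambda>\<omega>. (x k \<omega> ^ 2 - 1) ^ 2) \<le> K * A k k ^ 2"
    by (subst mult.commute) (intro mult_right_mono, auto)
  moreover have "(\<Sum>i\<in>insert k J. \<Sum>j\<in>insert k J. A i j ^ 2) = (\<Sum>i\<in>J. \<Sum>j\<in>J. A i j ^ 2) + A k k ^ 2 + 2 * ?s"
  proof -
    have "(\<Sum>i\<in>J. A i k ^ 2) = ?s" by (rule sum.cong) (simp_all add: sym[of k])
    then show ?thesis using insert(1,2) by (simp add: sum.distrib)
  qed
  moreover have "4 * ?s \<le> (K + 2) * (2 * ?s)"
    using K_ge_1 sum_nonneg[of J "\<lambda>j. A k j ^ 2"] by (simp add: distrib_right)
  moreover have "K * A k k ^ 2 \<le> (K + 2) * A k k ^ 2" by (intro mult_right_mono) auto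
  ultimately show ?case unfolding e using IH(3) by (simp only: distrib_left simp_thms)
qed

end

section \<open>Projections and rank-one deflation\<close>

definition app :: "'i set \<Rightarrow> ('i \<Rightarrow> 'i \<Rightarrow> real) \<Rightarrow> ('i \<Rightarrow> real) \<Rightarrow> 'i \<Rightarrow> real" where
  "app I Q y i = (\<Sum>k\<in>I. Q i k * y k)"

text \<open>Symmetry is demanded for all indices, also outside \<open>I\<close>, so that it is
  available without membership conditions. Idempotence concerns sums over \<open>I\<close> and is
  stated only there.\<close>

definition is_proj :: "'i set \<Rightarrow> ('i \<Rightarrow> 'i \<Rightarrow> real) \<Rightarrow> bool" where
  "is_proj I Q \<longleftrightarrow> finite I \<and> (\<forall>i j. Q i j = Q j i) \<and>
     (\<forall>i\<in>I. \<forall>j\<in>I. (\<Sum>k\<in>I. Q i k * Q k j) = Q i j)"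

definition trc :: "'i set \<Rightarrow> ('i \<Rightarrow> 'i \<Rightarrow> real) \<Rightarrow> real" where
  "trc I Q = (\<Sum>i\<in>I. Q i i)"

definition ssq :: "'i set \<Rightarrow> ('i \<Rightarrow> real) \<Rightarrow> real" where
  "ssq I y = (\<Sum>i\<in>I. (y i)\<^sup>2)"

text \<open>
  Kernels \<open>Q\<close> on a finite index set \<open>I\<close> play the role of matrices.  Deflation removes the direction \<open>Q z\<close>
  from the range of the projection \<open>Q\<close>; when \<open>Q z = 0\<close> the convention \<open>0 / 0 = 0\<close> leaves \<open>Q\<close> unchanged.
\<close>

definition deflate :: "'i set \<Rightarrow> ('i \<Rightarrow> 'i \<Rightarrow> real) \<Rightarrow> ('i \<Rightarrow> real) \<Rightarrow> 'i \<Rightarrow> 'i \<Rightarrow> real" where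
  "deflate I Q z i j = Q i j - app I Q z i * app I Q z j / ssq I (app I Q z)"

lemma ssq_nonneg: "0 \<le> ssq I y"
  by (simp add: ssq_def sum_nonneg)

lemma ssq_eq_0_iff: "finite I \<Longrightarrow> ssq I y = 0 \<longleftrightarrow> (\<forall>i\<in>I. y i = 0)"
  by (simp add: ssq_def sum_nonneg_eq_0_iff)

lemma is_proj_sym: "is_proj I Q \<Longrightarrow> Q i j = Q j i"
  unfolding is_proj_def by blast

lemma is_proj_finite: "is_proj I Q \<Longrightarrow> finite I"
  unfolding is_proj_def by blast

lemma is_proj_idem: "is_proj I Q \<Longrightarrow> i \<in> I \<Longrightarrow> j \<in> I \<Longrightarrow> (\<Sum>k\<in>I. Q i k * Q k j) = Q i j"
  unfolding is_proj_def by blast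

lemma is_proj_id: "finite I \<Longrightarrow> is_proj I (\<lambda>i j. if i = j then 1 else 0)"
  by (auto simp: is_proj_def if_distrib cong: if_cong)

lemma app_adjoint:
  assumes "is_proj I Q"
  shows "(\<Sum>k\<in>I. app I Q z k * y k) = (\<Sum>k\<in>I. z k * app I Q y k)"
proof -
  have "(\<Sum>k\<in>I. app I Q z k * y k) = (\<Sum>k\<in>I. \<Sum>l\<in>I. Q k l * z l * y k)"
    by (simp add: app_def sum_distrib_right)
  also have "\<dots> = (\<Sum>l\<in>I. \<Sum>k\<in>I. Q k l * z l * y k)" by (rule sum.swap)
  also have "\<dots> = (\<Sum>l\<in>I. \<Sum>k\<in>I. z l * (Q l k * y k))"
    by (intro sum.cong refl) (subst is_proj_sym[OF assms], simp)
  finally show ?thesis by (simp add: app_def sum_distrib_left)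
qed

lemma app_app:
  assumes "is_proj I Q" "i \<in> I"
  shows "app I Q (app I Q y) i = app I Q y i"
proof -
  have "app I Q (app I Q y) i = (\<Sum>k\<in>I. \<Sum>l\<in>I. Q i k * Q k l * y l)"
    by (simp add: app_def sum_distrib_left mult.assoc)
  also have "\<dots> = (\<Sum>l\<in>I. (\<Sum>k\<in>I. Q i k * Q k l) * y l)"
    by (subst sum.swap) (simp add: sum_distrib_right)
  also have "\<dots> = (\<Sum>l\<in>I. Q i l * y l)"
    by (intro sum.cong refl) (simp only: is_proj_idem[OF assms])
  finally show ?thesis by (simp add: app_def)
qed

lemma ssq_app:
  assumes "is_proj I Q"
  shows "ssq I (app I Q y) = (\<Sum>k\<in>I. y k * app I Q y k)"
proof -
  have "ssq I (app I Q y) = (\<Sum>k\<in>I. app I Q y k * app I Q y k)"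
    by (simp add: ssq_def power2_eq_square)
  also have "\<dots> = (\<Sum>k\<in>I. y k * app I Q (app I Q y) k)"
    by (rule app_adjoint[OF assms])
  finally show ?thesis by (simp add: app_app[OF assms])
qed

lemma ssq_app_le:
  assumes "is_proj I Q"
  shows "ssq I (app I Q y) \<le> ssq I y"
proof -
  have "0 \<le> ssq I (\<lambda>k. y k - app I Q y k)" by (rule ssq_nonneg)
  also have "\<dots> = ssq I y - 2 * (\<Sum>k\<in>I. y k * app I Q y k) + ssq I (app I Q y)"
    by (simp add: ssq_def power2_diff sum.distrib sum_subtractf sum_distrib_left mult.assoc)
  finally show ?thesis using ssq_app[OF assms] by simp
qed

lemma is_proj_diag:
  assumes "is_proj I Q" "i \<in> I"
  shows "Q i i = (\<Sum>j\<in>I. (Q i j)\<^sup>2)"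
proof -
  have "Q i i = (\<Sum>k\<in>I. Q i k * Q k i)" by (simp only: is_proj_idem[OF assms(1,2,2)])
  also have "\<dots> = (\<Sum>j\<in>I. (Q i j)\<^sup>2)"
    by (intro sum.cong refl) (simp add: power2_eq_square is_proj_sym[OF assms(1), of _ i])
  finally show ?thesis .
qed

text \<open>Idempotence and symmetry give \<open>Q i i\<close> as a sum of squares that contains
  \<open>(Q i i)\<^sup>2\<close>.\<close>

lemma is_proj_diag_bounds:
  assumes "is_proj I Q" "i \<in> I"
  shows "0 \<le> Q i i" "Q i i \<le> 1"
proof -
  have d: "Q i i = (\<Sum>j\<in>I. (Q i j)\<^sup>2)" by (rule is_proj_diag[OF assms])
  show 0: "0 \<le> Q i i" by (subst d) (simp add: sum_nonneg)
  have "(Q i i)\<^sup>2 \<le> (\<Sum>j\<in>I. (Q i j)\<^sup>2)"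
    using assms is_proj_finite by (intro member_le_sum) auto
  then have "Q i i * Q i i \<le> Q i i * 1" using d by (simp add: power2_eq_square)
  then show "Q i i \<le> 1" using 0 by (cases "Q i i = 0") (auto simp: mult_le_cancel_left)
qed

lemma trc_eq_sum_squares:
  assumes "is_proj I Q" shows "trc I Q = (\<Sum>i\<in>I. \<Sum>j\<in>I. (Q i j)\<^sup>2)"
  unfolding trc_def using is_proj_diag[OF assms] by (rule sum.cong[OF refl])

lemma sum_diag_squares_le:
  assumes "is_proj I Q" shows "(\<Sum>i\<in>I. (Q i i)\<^sup>2) \<le> trc I Q"
  unfolding trc_def
  using is_proj_diag_bounds[OF assms] by (intro sum_mono) (auto simp: power2_eq_square mult_left_le)

lemma trc_le_card:
  assumes "is_proj I Q" shows "trc I Q \<le> card I"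
  unfolding trc_def using sum_bounded_above[of I "\<lambda>i. Q i i" 1] is_proj_diag_bounds[OF assms] by simp

text \<open>With w = Q z and b = w \<bullet> w one has Q w = w. Squaring Q - w w^T / b thus
  subtracts w w^T / b twice and adds it back once. For b = 0 all quotients are 0 and the identity
  persists.\<close>

lemma deflate_proj:
  assumes "is_proj I Q" shows "is_proj I (deflate I Q z)"
proof -
  let ?w = "app I Q z" and ?b = "ssq I (app I Q z)"
  have ww: "(\<Sum>k\<in>I. Q i k * ?w k) = ?w i" if "i \<in> I" for i
    using app_app[OF assms that, of z] by (simp add: app_def)
  have b: "(\<Sum>k\<in>I. ?w k * ?w k) = ?b" by (simp add: ssq_def power2_eq_square)
  have "(\<Sum>k\<in>I. deflate I Q z i k * deflate I Q z k j) = deflate I Q z i j" if ij: "i \<in> I" "j \<in> I" for i j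
  proof -
    have "(\<Sum>k\<in>I. deflate I Q z i k * deflate I Q z k j) =
       (\<Sum>k\<in>I. Q i k * Q k j - (?w j / ?b) * (Q i k * ?w k) - (?w i / ?b) * (Q j k * ?w k)
          + (?w i * ?w j / ?b\<^sup>2) * (?w k * ?w k))"
      by (intro sum.cong refl, simp add: deflate_def is_proj_sym[OF assms, of _ j])
         (simp add: algebra_simps power2_eq_square)
    also have "\<dots> = (\<Sum>k\<in>I. Q i k * Q k j) - (?w j / ?b) * ?w i - (?w i / ?b) * ?w j
          + (?w i * ?w j / ?b\<^sup>2) * ?b"
      by (simp only: sum.distrib sum_subtractf sum_distrib_left[symmetric] ww ij b)
    also have "(\<Sum>k\<in>I. Q i k * Q k j) = Q i j" using assms ij unfolding is_proj_def by blast
    finally show ?thesis by (simp add: deflate_def power2_eq_square)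
  qed
  moreover have "deflate I Q z i j = deflate I Q z j i" for i j
    by (simp add: deflate_def is_proj_sym[OF assms, of i j] mult.commute)
  ultimately show ?thesis using assms unfolding is_proj_def by blast
qed

lemma deflate_trc:
  assumes "is_proj I Q" "ssq I (app I Q z) \<noteq> 0"
  shows "trc I (deflate I Q z) = trc I Q - 1"
proof -
  have "(\<Sum>i\<in>I. app I Q z i * app I Q z i / ssq I (app I Q z)) = 1"
    using assms(2) by (simp add: sum_divide_distrib[symmetric] ssq_def power2_eq_square)
  then show ?thesis by (simp add: trc_def deflate_def sum_subtractf)
qed

lemma app_deflate: "app I (deflate I Q z) y i = app I Q y i - app I Q z i * (\<Sum>k\<in>I. app I Q z k * y k) / ssq I (app I Q z)"
  by (simp add: app_def[of I "deflate I Q z"] deflate_def left_diff_distrib sum_subtractf app_def[of I Q y]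
      sum_distrib_left sum_divide_distrib mult.assoc)

text \<open>A zero pivot means that Q z vanishes already, which is why leaving \<open>Q\<close>
  unchanged is the right convention.\<close>

lemma app_deflate_self:
  assumes "is_proj I Q" "i \<in> I" shows "app I (deflate I Q z) z i = 0"
proof (cases "ssq I (app I Q z) = 0")
  case True
  then have "app I Q z i = 0" using ssq_eq_0_iff is_proj_finite[OF assms(1)] assms(2) by blast
  then show ?thesis by (simp add: app_deflate)
next
  case False
  have "(\<Sum>k\<in>I. app I Q z k * z k) = ssq I (app I Q z)"
    by (simp add: ssq_app[OF assms(1)] mult.commute)
  then show ?thesis using False by (simp add: app_deflate)
qed

text \<open>By \<open>app_adjoint\<close> the correction term is a multiple of z \<bullet> Q y, so
  directions removed earlier stay removed.\<close>

lemma app_deflate_0: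
  assumes "is_proj I Q" "\<And>k. k \<in> I \<Longrightarrow> app I Q y k = 0" "i \<in> I"
  shows "app I (deflate I Q z) y i = 0"
  using assms by (simp add: app_deflate app_adjoint)

lemma app_deflate_fixed:
  assumes "is_proj I Q" "\<And>k. k \<in> I \<Longrightarrow> app I Q r k = r k" "(\<Sum>k\<in>I. z k * r k) = 0" "i \<in> I"
  shows "app I (deflate I Q z) r i = r i"
  using assms by (simp add: app_deflate app_adjoint)

text \<open>Without the diagonal, the sum over row \<open>i\<close> does not involve the
  \<open>i\<close>-th coordinate, which is what the leave-one-out argument needs.\<close>

definition off_diag :: "('i \<Rightarrow> 'i \<Rightarrow> real) \<Rightarrow> 'i \<Rightarrow> 'i \<Rightarrow> real" where
  "off_diag Q i j = (if i = j then 0 else Q i j)"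

text \<open>The kernel is a projection minus a diagonal with entries between 0 and 1. Both are
  contractions, so the operator norm is at most 2.\<close>

lemma ssq_app_off_diag_le:
  assumes "is_proj I Q" shows "ssq I (app I (off_diag Q) y) \<le> 4 * ssq I y"
proof -
  have e: "app I (off_diag Q) y i = app I Q y i - Q i i * y i" if "i \<in> I" for i
  proof -
    have "app I (off_diag Q) y i = (\<Sum>k\<in>I. Q i k * y k - (if k = i then Q i i * y i else 0))"
      unfolding app_def off_diag_def by (intro sum.cong refl) auto
    then show ?thesis using that is_proj_finite[OF assms] by (simp add: sum_subtractf app_def)
  qed
  have sq: "(u - v)\<^sup>2 \<le> 2 * u\<^sup>2 + 2 * v\<^sup>2" for u v :: real
    using zero_le_power2[of "u + v"] by (simp add: power2_sum power2_diff)
  have "ssq I (app I (off_diag Q) y) \<le> (\<Sum>i\<in>I. 2 * (app I Q y i)\<^sup>2 + 2 * (y i)\<^sup>2)"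
    unfolding ssq_def
  proof (intro sum_mono)
    fix i assume i: "i \<in> I"
    have "(Q i i * y i)\<^sup>2 \<le> 1 * (y i)\<^sup>2"
      unfolding power_mult_distrib using is_proj_diag_bounds[OF assms i]
      by (intro mult_right_mono) (auto simp: power_le_one)
    then show "(app I (off_diag Q) y i)\<^sup>2 \<le> 2 * (app I Q y i)\<^sup>2 + 2 * (y i)\<^sup>2"
      using sq[of "app I Q y i" "Q i i * y i"] by (simp add: e[OF i])
  qed
  also have "\<dots> = 2 * ssq I (app I Q y) + 2 * ssq I y"
    by (simp add: ssq_def sum.distrib sum_distrib_left)
  finally show ?thesis using ssq_app_le[OF assms, of y] by simp
qed

text \<open>Each column of the squared kernel is the image of a unit vector under two applications
  of \<open>off_diag Q\<close>, so its squared length is at most 16. The linear growth in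
  \<open>card I\<close> keeps the fluctuation of the conditional variance at order
  \<open>sqrt (card I)\<close>.\<close>

lemma sum_square_off_diag_square_le:
  assumes "is_proj I Q"
  shows "(\<Sum>j\<in>I. \<Sum>k\<in>I. (\<Sum>i\<in>I. off_diag Q i j * off_diag Q i k)\<^sup>2) \<le> 16 * card I"
proof -
  have fin: "finite I" using assms by (rule is_proj_finite)
  have s: "off_diag Q i j = off_diag Q j i" for i j
    using is_proj_sym[OF assms, of i j] by (simp add: off_diag_def)
  have "(\<Sum>j\<in>I. (\<Sum>i\<in>I. off_diag Q i j * off_diag Q i k)\<^sup>2) \<le> 16" if k: "k \<in> I" for k
  proof -
    let ?e = "\<lambda>i. if i = k then 1 else 0 :: real"
    have "app I (off_diag Q) ?e i = off_diag Q i k" for i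
      using k fin by (simp add: app_def if_distrib cong: if_cong)
    then have "(\<Sum>j\<in>I. (\<Sum>i\<in>I. off_diag Q i j * off_diag Q i k)\<^sup>2) =
        ssq I (app I (off_diag Q) (app I (off_diag Q) ?e))"
      unfolding ssq_def by (simp add: app_def[of I "off_diag Q" "app I (off_diag Q) ?e"] s)
    also have "\<dots> \<le> 4 * (4 * ssq I ?e)"
      by (intro order_trans[OF ssq_app_off_diag_le[OF assms]] mult_left_mono ssq_app_off_diag_le[OF assms]) simp
    also have "ssq I ?e = (\<Sum>i\<in>I. if i = k then 1 else 0)"
      unfolding ssq_def by (intro sum.cong) auto
    also have "\<dots> = 1" using k fin by simp
    finally show ?thesis by simp
  qed
  then have "(\<Sum>k\<in>I. \<Sum>j\<in>I. (\<Sum>i\<in>I. off_diag Q i j * off_diag Q i k)\<^sup>2) \<le> (\<Sum>k\<in>I. 16)"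
    by (rule sum_mono)
  then show ?thesis by (subst sum.swap) (simp add: mult.commute)
qed

section \<open>Central limit theorem for quadratic forms\<close>

lemma iexp_linear_approx: "norm (iexp u - 1 - \<i> * complex_of_real u) \<le> u\<^sup>2 / 2"
  using iexp_approx1[of u 1] by (simp add: power2_eq_square numeral_2_eq_2 diff_diff_eq algebra_simps)

lemma iexp_const_approx: "norm (1 - iexp u) \<le> \<bar>u\<bar>"
  using iexp_approx1[of u 0] by (simp add: norm_minus_commute)

text \<open>This is \<open>2 + 2 * a + b\<close>, where \<open>a\<close> and \<open>b\<close> are
  the bounds on the means of \<open>majx\<close> and \<open>majg\<close>; the combination arises in
  \<open>swap_step\<close>.\<close>

definition clt_c1 :: "real \<Rightarrow> real" where
  "clt_c1 K = 2 + 16 * (8 * (K + 1) + 16 * K * (K + 3)) + 3 * (K\<^sup>2 + 9 * (1 + K)\<^sup>2 + 4 * (K + 3))"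

text \<open>The summands come from \<open>3 * (1 + K) * sqrt 4\<close> and
  \<open>2 * sqrt (16 * (K + 2))\<close> in \<open>cvar_concentration\<close>.\<close>

definition clt_c2 :: "real \<Rightarrow> real" where
  "clt_c2 K = 6 * (1 + K) + 8 * sqrt (K + 2)"

text \<open>Common third and fourth moments make \<open>cvar i\<close> a formula in \<open>Q\<close>
  and the other coordinates alone. Eighth moments are required because
  \<open>dg i \<omega> ^ 4\<close> has degree 8 in the \<open>i\<close>-th coordinate.\<close>

locale quadratic_clt = standard_indep M I x K for M :: "'a measure" and I :: "'i set" and x K +
  fixes Q :: "'i \<Rightarrow> 'i \<Rightarrow> real" and \<kappa> \<gamma> :: real
  assumes proj: "is_proj I Q"
    and integrable_8: "\<And>i. i \<in> I \<Longrightarrow> integrable M (\<lambda>\<omega>. x i \<omega> ^ 8)"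
    and eighth: "\<And>i. i \<in> I \<Longrightarrow> expectation (\<lambda>\<omega>. x i \<omega> ^ 8) \<le> K"
    and third_eq: "\<And>i. i \<in> I \<Longrightarrow> expectation (\<lambda>\<omega>. x i \<omega> ^ 3) = \<gamma>"
    and fourth_eq: "\<And>i. i \<in> I \<Longrightarrow> expectation (\<lambda>\<omega>. x i \<omega> ^ 4) = \<kappa>"
begin

text \<open>
  The quadratic form \<open>qf\<close> is the sum over \<open>i\<close> of \<open>dg i + cr i\<close>, and \<open>rest i = qf - (dg i + 2 * cr i)\<close> does not
  involve \<open>x i\<close>.  The product of the two increments has conditional expectation \<open>cvar i\<close> given the
  other coordinates; \<open>majx\<close> and \<open>majg\<close> dominate the remainders of the expansions below.
\<close>

definition "lin i \<omega> = app I (off_diag Q) (\<lambda>j. x j \<omega>) i"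
definition "dg i \<omega> = Q i i * ((x i \<omega>)\<^sup>2 - 1)"
definition "cr i \<omega> = x i \<omega> * lin i \<omega>"
definition "qf \<omega> = (\<Sum>i\<in>I. \<Sum>j\<in>I. Q i j * x i \<omega> * x j \<omega>) - trc I Q"
definition "rest i \<omega> = (\<Sum>k\<in>I - {i}. \<Sum>j\<in>I - {i}. Q k j * x k \<omega> * x j \<omega>) - trc (I - {i}) Q"
definition "cvar i \<omega> = (Q i i)\<^sup>2 * (\<kappa> - 1) + 3 * \<gamma> * Q i i * lin i \<omega> + 2 * (lin i \<omega>)\<^sup>2"
definition "majx i \<omega> = 8 * (dg i \<omega> ^ 4 + 16 * cr i \<omega> ^ 4)"
definition "majg i \<omega> = 3 * (K\<^sup>2 + 9 * (1 + K)\<^sup>2 * (lin i \<omega>)\<^sup>2 + 4 * lin i \<omega> ^ 4)"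

lemma lin_eq: "i \<in> I \<Longrightarrow> lin i \<omega> = (\<Sum>j\<in>I - {i}. Q i j * x j \<omega>)"
  unfolding lin_def app_def
  by (subst sum.remove[OF finite_I], assumption) (auto simp: off_diag_def intro!: sum.cong split: if_splits)

lemma qf_eq_sum: "qf \<omega> = (\<Sum>i\<in>I. dg i \<omega> + cr i \<omega>)"
proof -
  have "(\<Sum>j\<in>I. Q i j * x i \<omega> * x j \<omega>) = Q i i * (x i \<omega>)\<^sup>2 + cr i \<omega>" if "i \<in> I" for i
    using that finite_I
    by (simp add: sum.remove[of I i] cr_def lin_eq sum_distrib_left power2_eq_square ac_simps)
  then show ?thesis
    by (simp add: qf_def trc_def dg_def sum.distrib sum_subtractf right_diff_distrib)
qed

text \<open>Deleting the index \<open>i\<close> removes a row and a column, so \<open>cr i\<close>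
  occurs twice here but only once in \<open>qf_eq_sum\<close>, where each row keeps its own
  share.\<close>

lemma qf_split:
  assumes i: "i \<in> I" shows "qf \<omega> = rest i \<omega> + (dg i \<omega> + 2 * cr i \<omega>)"
proof -
  have fin: "finite (I - {i})" using finite_I by simp
  have "(\<Sum>k\<in>I - {i}. Q k i * x k \<omega> * x i \<omega>) = cr i \<omega>"
    by (simp add: cr_def lin_eq[OF i] sum_distrib_left is_proj_sym[OF proj, of _ i] ac_simps)
  moreover have "(\<Sum>k\<in>I - {i}. Q i k * x i \<omega> * x k \<omega>) = cr i \<omega>"
    by (simp add: cr_def lin_eq[OF i] sum_distrib_left ac_simps)
  moreover have "trc I Q = Q i i + trc (I - {i}) Q"
    using i finite_I by (simp add: trc_def sum.remove[of I i])
  moreover have "(\<Sum>k\<in>I. \<Sum>j\<in>I. Q k j * x k \<omega> * x j \<omega>) =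
      Q i i * x i \<omega> * x i \<omega> + (\<Sum>k\<in>I - {i}. Q i k * x i \<omega> * x k \<omega>)
       + ((\<Sum>k\<in>I - {i}. Q k i * x k \<omega> * x i \<omega>) + (\<Sum>k\<in>I - {i}. \<Sum>j\<in>I - {i}. Q k j * x k \<omega> * x j \<omega>))"
    by (simp only: sum.remove[OF finite_I i] sum.distrib)
  ultimately show ?thesis
    by (simp add: qf_def rest_def dg_def power2_eq_square right_diff_distrib)
qed

lemma integrable_pow8: "i \<in> I \<Longrightarrow> k \<le> 8 \<Longrightarrow> integrable M (\<lambda>\<omega>. x i \<omega> ^ k)"
  by (rule integrable_power_le[OF integrable_8 x_measurable]) auto

lemma lin_coords: "i \<in> I \<Longrightarrow> lin i \<in> borel_measurable (coords (I - {i}))"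
  by (subst measurable_cong[where g="\<lambda>\<omega>. \<Sum>j\<in>I - {i}. Q i j * x j \<omega>"])
     (auto simp: lin_eq intro!: borel_measurable_sum borel_measurable_times coord_measurable)

lemma rest_coords: "rest i \<in> borel_measurable (coords (I - {i}))"
  unfolding rest_def[abs_def]
  by (intro borel_measurable_sum borel_measurable_diff borel_measurable_times coord_measurable borel_measurable_const) auto

lemma lin_M: "i \<in> I \<Longrightarrow> lin i \<in> borel_measurable M"
  using coords_measurable_M[OF _ lin_coords] by auto

lemma rest_M: "rest i \<in> borel_measurable M"
  using coords_measurable_M[OF _ rest_coords] by auto

lemma dg_M: "i \<in> I \<Longrightarrow> dg i \<in> borel_measurable M"
  unfolding dg_def[abs_def] using x_measurable by measurable

lemma cr_M: "i \<in> I \<Longrightarrow> cr i \<in> borel_measurable M"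
  unfolding cr_def[abs_def] using x_measurable lin_M by measurable

lemma qf_M: "qf \<in> borel_measurable M"
  unfolding qf_eq_sum[abs_def] using dg_M cr_M by (intro borel_measurable_sum borel_measurable_add) auto

section \<open>Moments of the leave-one-out increments\<close>

lemma off_diag_row: 
  assumes "i \<in> I" shows "(\<Sum>j\<in>I. (off_diag Q i j)\<^sup>2) = Q i i - (Q i i)\<^sup>2"
proof -
  have "(\<Sum>j\<in>I - {i}. (off_diag Q i j)\<^sup>2) = (\<Sum>j\<in>I - {i}. (Q i j)\<^sup>2)"
    by (intro sum.cong) (auto simp: off_diag_def)
  then show ?thesis
    using is_proj_diag[OF proj assms] by (simp add: sum.remove[OF finite_I assms] off_diag_def)
qed

lemma lin_moments:
  assumes "i \<in> I"
  shows "integrable M (\<lambda>\<omega>. lin i \<omega> ^ 4)" "expectation (lin i) = 0"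
    "expectation (\<lambda>\<omega>. (lin i \<omega>)\<^sup>2) = Q i i - (Q i i)\<^sup>2" "expectation (\<lambda>\<omega>. lin i \<omega> ^ 4) \<le> K + 3"
proof -
  note L = linear_form[OF subset_refl, of "off_diag Q i"]
  show "integrable M (\<lambda>\<omega>. lin i \<omega> ^ 4)" "expectation (lin i) = 0"
    "expectation (\<lambda>\<omega>. (lin i \<omega>)\<^sup>2) = Q i i - (Q i i)\<^sup>2"
    using L off_diag_row[OF assms] by (auto simp: lin_def[abs_def] app_def[abs_def])
  have "0 \<le> Q i i - (Q i i)\<^sup>2" "Q i i - (Q i i)\<^sup>2 \<le> 1"
    using is_proj_diag_bounds[OF proj assms] zero_le_power2[of "Q i i"] mult_left_le[of "Q i i" "Q i i"]
    unfolding power2_eq_square by linarith+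
  then have "(Q i i - (Q i i)\<^sup>2)\<^sup>2 \<le> 1" by (simp add: power_le_one)
  then have "(K + 3) * (Q i i - (Q i i)\<^sup>2)\<^sup>2 \<le> (K + 3) * 1" using K_ge_1 by (intro mult_left_mono) auto
  then show "expectation (\<lambda>\<omega>. lin i \<omega> ^ 4) \<le> K + 3"
    using L off_diag_row[OF assms] by (auto simp: lin_def[abs_def] app_def[abs_def])
qed

lemma lin_pow: "i \<in> I \<Longrightarrow> k \<le> 4 \<Longrightarrow> integrable M (\<lambda>\<omega>. lin i \<omega> ^ k)"
  by (rule integrable_power_le[OF lin_moments(1) lin_M])

lemma gamma_bound: "i \<in> I \<Longrightarrow> \<bar>\<gamma>\<bar> \<le> 1 + K"
proof -
  assume i: "i \<in> I"
  have "norm (expectation (\<lambda>\<omega>. x i \<omega> ^ 3)) \<le> expectation (\<lambda>\<omega>. 1 + x i \<omega> ^ 4)"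
    using abs_power_le_one_plus[of 3 4] integrable_pow8[OF i, of 4]
    by (intro norm_integral_le) (auto simp: power_abs)
  also have "\<dots> = 1 + expectation (\<lambda>\<omega>. x i \<omega> ^ 4)"
    using integrable_pow8[OF i, of 4] prob_space by simp
  finally show ?thesis using fourth[OF i] third_eq[OF i] by simp
qed

text \<open>Since the second moment is 1, \<open>\<kappa> - 1\<close> is the variance of the square
  of \<open>x i\<close>.\<close>

lemma kappa_bound: "i \<in> I \<Longrightarrow> 0 \<le> \<kappa> - 1 \<and> \<kappa> - 1 \<le> K"
proof -
  assume i: "i \<in> I"
  have "0 \<le> expectation (\<lambda>\<omega>. (x i \<omega> ^ 2 - 1)\<^sup>2)" by simp
  also have "\<dots> = expectation (\<lambda>\<omega>. x i \<omega> ^ 4 - 2 * x i \<omega> ^ 2 + 1)"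
    by (intro Bochner_Integration.integral_cong refl) (simp add: power2_eq_square power4_eq_xxxx algebra_simps)
  also have "\<dots> = \<kappa> - 1"
    using integrable_pow8[OF i, of 4] integrable_pow8[OF i, of 2] fourth_eq[OF i] var[OF i] prob_space by simp
  finally show ?thesis using fourth[OF i] fourth_eq[OF i] by simp
qed

lemma dg_pow4: 
  assumes i: "i \<in> I" 
  shows "integrable M (\<lambda>\<omega>. dg i \<omega> ^ 4)" "expectation (\<lambda>\<omega>. dg i \<omega> ^ 4) \<le> 8 * (K + 1)"
proof -
  have le: "dg i \<omega> ^ 4 \<le> 8 * (x i \<omega> ^ 8 + 1)" for \<omega>
  proof -
    have "dg i \<omega> ^ 4 \<le> 1 * ((x i \<omega>)\<^sup>2 - 1) ^ 4"
      unfolding dg_def power_mult_distrib using is_proj_diag_bounds[OF proj i]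
      by (intro mult_right_mono) (auto simp: power_le_one)
    also have "\<dots> \<le> 8 * (((x i \<omega>)\<^sup>2) ^ 4 + (-1) ^ 4)"
      using power4_sum_le[of "(x i \<omega>)\<^sup>2" "-1"] by simp
    also have "((x i \<omega>)\<^sup>2) ^ 4 = x i \<omega> ^ 8" by (simp flip: power_mult)
    finally show ?thesis by simp
  qed
  have i8: "integrable M (\<lambda>\<omega>. 8 * (x i \<omega> ^ 8 + 1))" using integrable_8[OF i] by simp
  show int: "integrable M (\<lambda>\<omega>. dg i \<omega> ^ 4)"
    by (rule Bochner_Integration.integrable_bound[OF i8]) (use le dg_M[OF i] in \<open>auto intro!: AE_I2 order_trans[OF _ abs_ge_self]\<close>)
  have "expectation (\<lambda>\<omega>. dg i \<omega> ^ 4) \<le> expectation (\<lambda>\<omega>. 8 * (x i \<omega> ^ 8 + 1))"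
    by (intro integral_mono int i8 le)
  also have "\<dots> \<le> 8 * (K + 1)" using integrable_8[OF i] eighth[OF i] prob_space by simp
  finally show "expectation (\<lambda>\<omega>. dg i \<omega> ^ 4) \<le> 8 * (K + 1)" .
qed

lemma cr_pow4: 
  assumes i: "i \<in> I" 
  shows "integrable M (\<lambda>\<omega>. cr i \<omega> ^ 4)" "expectation (\<lambda>\<omega>. cr i \<omega> ^ 4) \<le> K * (K + 3)"
proof -
  have m: "(\<lambda>\<omega>. lin i \<omega> ^ 4) \<in> borel_measurable (coords (I - {i}))" using lin_coords[OF i] by measurable
  note c = coord_mult[OF _ i _ _ m, of "\<lambda>y. y ^ 4", OF _ _ _ integrable_4[OF i] lin_moments(1)[OF i]]
  show "integrable M (\<lambda>\<omega>. cr i \<omega> ^ 4)" using c(1) by (auto simp: cr_def power_mult_distrib)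
  have "expectation (\<lambda>\<omega>. cr i \<omega> ^ 4) = expectation (\<lambda>\<omega>. x i \<omega> ^ 4) * expectation (\<lambda>\<omega>. lin i \<omega> ^ 4)"
    using c(2) by (auto simp: cr_def power_mult_distrib)
  also have "\<dots> \<le> K * (K + 3)" using fourth[OF i] lin_moments(4)[OF i] K_ge_1
    by (intro mult_mono) auto
  finally show "expectation (\<lambda>\<omega>. cr i \<omega> ^ 4) \<le> K * (K + 3)" .
qed

lemma majx_int:
  assumes i: "i \<in> I"
  shows "integrable M (majx i)" "expectation (majx i) \<le> 8 * (8 * (K + 1) + 16 * K * (K + 3))"
  unfolding majx_def[abs_def] using dg_pow4[OF i] cr_pow4[OF i] by auto

lemma majg_int:
  assumes i: "i \<in> I"
  shows "integrable M (majg i)" "expectation (majg i) \<le> 3 * (K\<^sup>2 + 9 * (1 + K)\<^sup>2 + 4 * (K + 3))"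
proof -
  note ints = lin_pow[OF i, of 2] lin_pow[OF i, of 4]
  show "integrable M (majg i)" unfolding majg_def[abs_def] using ints by auto
  have "expectation (majg i) = 3 * (K\<^sup>2 + 9 * (1 + K)\<^sup>2 * expectation (\<lambda>\<omega>. (lin i \<omega>)\<^sup>2) + 4 * expectation (\<lambda>\<omega>. lin i \<omega> ^ 4))"
    unfolding majg_def[abs_def] using ints prob_space by simp
  moreover have "expectation (\<lambda>\<omega>. (lin i \<omega>)\<^sup>2) \<le> 1"
    using lin_moments(3)[OF i] is_proj_diag_bounds[OF proj i] zero_le_power2[of "Q i i"] by linarith
  then have "9 * (1 + K)\<^sup>2 * expectation (\<lambda>\<omega>. (lin i \<omega>)\<^sup>2) \<le> 9 * (1 + K)\<^sup>2 * 1"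
    by (intro mult_left_mono) auto
  ultimately show "expectation (majg i) \<le> 3 * (K\<^sup>2 + 9 * (1 + K)\<^sup>2 + 4 * (K + 3))"
    using lin_moments(4)[OF i] by simp
qed

text \<open>A cubic expression is at most 1 plus a quartic one, so fourth moments of the increments
  control the Taylor remainder.\<close>

lemma remainder1: "\<bar>dg i \<omega> + cr i \<omega>\<bar> * (dg i \<omega> + 2 * cr i \<omega>)\<^sup>2 \<le> 1 + majx i \<omega>"
proof -
  let ?u = "\<bar>dg i \<omega>\<bar> + \<bar>2 * cr i \<omega>\<bar>"
  have "\<bar>dg i \<omega> + cr i \<omega>\<bar> * (dg i \<omega> + 2 * cr i \<omega>)\<^sup>2 = \<bar>dg i \<omega> + cr i \<omega>\<bar> * \<bar>dg i \<omega> + 2 * cr i \<omega>\<bar>\<^sup>2"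
    by simp
  also have "\<dots> \<le> ?u * ?u\<^sup>2" by (intro mult_mono power_mono) auto
  also have "\<dots> = \<bar>?u\<bar> ^ 3" by (simp add: power3_eq_cube power2_eq_square)
  also have "\<dots> \<le> 1 + \<bar>?u\<bar> ^ 4" by (rule abs_power_le_one_plus) simp
  also have "\<bar>?u\<bar> ^ 4 \<le> 8 * (\<bar>dg i \<omega>\<bar> ^ 4 + \<bar>2 * cr i \<omega>\<bar> ^ 4)"
    using power4_sum_le[of "\<bar>dg i \<omega>\<bar>" "\<bar>2 * cr i \<omega>\<bar>"] by simp
  finally show ?thesis by (simp add: majx_def power_abs power_mult_distrib)
qed

text \<open>AM-GM separates \<open>cvar i\<close> from the increment. As \<open>cvar i\<close> is
  quadratic in \<open>lin i\<close>, its square is controlled by the fourth power of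
  \<open>lin i\<close>.\<close>

lemma remainder2:
  assumes i: "i \<in> I"
  shows "\<bar>cvar i \<omega>\<bar> * \<bar>dg i \<omega> + 2 * cr i \<omega>\<bar> \<le> majg i \<omega> + 1 + majx i \<omega>"
proof -
  let ?g = "cvar i \<omega>" and ?e = "dg i \<omega> + 2 * cr i \<omega>"
  have ab: "\<bar>a\<bar> * \<bar>b\<bar> \<le> a\<^sup>2 + b\<^sup>2" for a b :: real
  proof -
    have "2 * (\<bar>a\<bar> * \<bar>b\<bar>) \<le> a\<^sup>2 + b\<^sup>2" using sum_squares_bound[of "\<bar>a\<bar>" "\<bar>b\<bar>"] by simp
    moreover have "0 \<le> \<bar>a\<bar> * \<bar>b\<bar>" by simp
    ultimately show ?thesis by linarith
  qed
  have "?e\<^sup>2 \<le> 1 + ?e ^ 4" using abs_power_le_one_plus[of 2 4 ?e] by (simp add: power_abs)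
  also have "?e ^ 4 \<le> majx i \<omega>"
    using power4_sum_le[of "dg i \<omega>" "2 * cr i \<omega>"] by (simp add: majx_def power_mult_distrib)
  finally have e: "?e\<^sup>2 \<le> 1 + majx i \<omega>" by simp
  have sq3: "(a + b + c)\<^sup>2 \<le> 3 * (a\<^sup>2 + b\<^sup>2 + c\<^sup>2)" for a b c :: real
    using zero_le_power2[of "a - b"] zero_le_power2[of "a - c"] zero_le_power2[of "b - c"]
    by (simp add: power2_eq_square algebra_simps)
  have q: "(Q i i)\<^sup>2 \<le> 1" using is_proj_diag_bounds[OF proj i] by (auto simp: power_le_one)
  have "((Q i i)\<^sup>2 * (\<kappa> - 1))\<^sup>2 \<le> (1 * K)\<^sup>2"
    using kappa_bound[OF i] q by (intro power_mono mult_mono) auto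
  moreover have "(3 * \<gamma> * Q i i * lin i \<omega>)\<^sup>2 \<le> 9 * (1 + K)\<^sup>2 * (lin i \<omega>)\<^sup>2"
  proof -
    have "\<gamma>\<^sup>2 \<le> (1 + K)\<^sup>2" using gamma_bound[OF i] by (metis abs_ge_zero power2_abs power_mono)
    then have "9 * \<gamma>\<^sup>2 * (Q i i)\<^sup>2 * (lin i \<omega>)\<^sup>2 \<le> 9 * (1 + K)\<^sup>2 * 1 * (lin i \<omega>)\<^sup>2"
      using q by (intro mult_mono) auto
    then show ?thesis by (simp add: power_mult_distrib)
  qed
  moreover have "(2 * (lin i \<omega>)\<^sup>2)\<^sup>2 = 4 * lin i \<omega> ^ 4" by (simp add: power_mult_distrib)
  ultimately have "?g\<^sup>2 \<le> majg i \<omega>"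
    using sq3[of "(Q i i)\<^sup>2 * (\<kappa> - 1)" "3 * \<gamma> * Q i i * lin i \<omega>" "2 * (lin i \<omega>)\<^sup>2"]
    unfolding cvar_def majg_def by simp
  then show ?thesis using ab[of ?g ?e] e by linarith
qed

section \<open>Leave-one-out expansion of the characteristic function\<close>

lemma centred_mult:
  fixes U :: "'a \<Rightarrow> complex"
  assumes i: "i \<in> I" and f: "f \<in> borel_measurable borel" "integrable M (\<lambda>\<omega>. f (x i \<omega>))"
    "expectation (\<lambda>\<omega>. f (x i \<omega>)) = 0"
    and U: "U \<in> borel_measurable (coords (I - {i}))" "integrable M U"
  shows "has_bochner_integral M (\<lambda>\<omega>. complex_of_real (f (x i \<omega>)) * U \<omega>) 0"
proof -
  note c = coord_mult[OF _ i _ _ U(1), of "\<lambda>y. complex_of_real (f y)", OF _ _ _ _ U(2)]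
  have "(\<lambda>y. complex_of_real (f y)) \<in> borel_measurable borel" using f(1) by measurable
  then show ?thesis using c f by (auto simp: has_bochner_integral_iff)
qed

text \<open>The product of the increments dg + cr and dg + 2 cr is dg^2 + 3 dg cr + 2 cr^2. Given
  the other coordinates, the factors in \<open>x i\<close> average to \<open>\<kappa> - 1\<close>,
  \<open>\<gamma>\<close> and 1, which gives \<open>cvar i\<close>. The integrand is therefore a sum
  of centred polynomials in \<open>x i\<close> times functions of the other coordinates.\<close>

lemma zero_part:
  fixes s :: real
  assumes i: "i \<in> I"
  shows "has_bochner_integral M (\<lambda>\<omega>. complex_of_real (dg i \<omega> + cr i \<omega>) * iexp (s * rest i \<omega>)
    + \<i> * complex_of_real s * complex_of_real ((dg i \<omega> + cr i \<omega>) * (dg i \<omega> + 2 * cr i \<omega>) - cvar i \<omega>) * iexp (s * rest i \<omega>)) 0"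
proof -
  let ?E = "\<lambda>\<omega>. iexp (s * rest i \<omega>)"
  have Em: "?E \<in> borel_measurable (coords (I - {i}))" using rest_coords by measurable
  have EM: "?E \<in> borel_measurable M" using rest_M by measurable
  have U: "(\<lambda>\<omega>. complex_of_real (lin i \<omega> ^ k) * ?E \<omega>) \<in> borel_measurable (coords (I - {i}))" for k
    using Em lin_coords[OF i] by measurable
  have UI: "integrable M (\<lambda>\<omega>. complex_of_real (lin i \<omega> ^ k) * ?E \<omega>)" if "k \<le> 4" for k
    by (rule Bochner_Integration.integrable_bound[OF lin_pow[OF i that]])
       (use EM lin_M[OF i] in \<open>auto simp: norm_mult norm_power power_abs\<close>)
  note z = centred_mult[OF i _ _ _ U UI]
  note p = integrable_pow8[OF i]
  have a: "has_bochner_integral M (\<lambda>\<omega>. complex_of_real ((x i \<omega>)\<^sup>2 - 1) * (complex_of_real (lin i \<omega> ^ 0) * ?E \<omega>)) 0"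
    by (rule z) (use p[of 2] var[OF i] prob_space in auto)
  have b: "has_bochner_integral M (\<lambda>\<omega>. complex_of_real (x i \<omega>) * (complex_of_real (lin i \<omega> ^ 1) * ?E \<omega>)) 0"
    by (rule z) (use p[of 1] mean[OF i] in auto)
  have c: "has_bochner_integral M (\<lambda>\<omega>. complex_of_real (((x i \<omega>)^4 - 2 * (x i \<omega>)\<^sup>2 + 1) - (\<kappa> - 1)) * (complex_of_real (lin i \<omega> ^ 0) * ?E \<omega>)) 0"
    by (rule z) (use p[of 2] p[of 4] var[OF i] fourth_eq[OF i] prob_space in auto)
  have d: "has_bochner_integral M (\<lambda>\<omega>. complex_of_real ((x i \<omega>)^3 - x i \<omega> - \<gamma>) * (complex_of_real (lin i \<omega> ^ 1) * ?E \<omega>)) 0"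
    by (rule z) (use p[of 1] p[of 3] mean[OF i] third_eq[OF i] prob_space in auto)
  have e: "has_bochner_integral M (\<lambda>\<omega>. complex_of_real ((x i \<omega>)\<^sup>2 - 1) * (complex_of_real (lin i \<omega> ^ 2) * ?E \<omega>)) 0"
    by (rule z) (use p[of 2] var[OF i] prob_space in auto)
  let ?q = "complex_of_real (Q i i)" and ?c = "\<i> * complex_of_real s"
  have "has_bochner_integral M (\<lambda>\<omega>.
     ?q * (complex_of_real ((x i \<omega>)\<^sup>2 - 1) * (complex_of_real (lin i \<omega> ^ 0) * ?E \<omega>))
     + complex_of_real (x i \<omega>) * (complex_of_real (lin i \<omega> ^ 1) * ?E \<omega>)
     + (?c * ?q\<^sup>2) * (complex_of_real (((x i \<omega>)^4 - 2 * (x i \<omega>)\<^sup>2 + 1) - (\<kappa> - 1)) * (complex_of_real (lin i \<omega> ^ 0) * ?E \<omega>))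
     + (?c * 3 * ?q) * (complex_of_real ((x i \<omega>)^3 - x i \<omega> - \<gamma>) * (complex_of_real (lin i \<omega> ^ 1) * ?E \<omega>))
     + (?c * 2) * (complex_of_real ((x i \<omega>)\<^sup>2 - 1) * (complex_of_real (lin i \<omega> ^ 2) * ?E \<omega>)))
     (?q * 0 + 0 + (?c * ?q\<^sup>2) * 0 + (?c * 3 * ?q) * 0 + (?c * 2) * 0)"
    by (intro has_bochner_integral_add has_bochner_integral_mult_right a b c d e)
  also have "(\<lambda>\<omega>.
     ?q * (complex_of_real ((x i \<omega>)\<^sup>2 - 1) * (complex_of_real (lin i \<omega> ^ 0) * ?E \<omega>))
     + complex_of_real (x i \<omega>) * (complex_of_real (lin i \<omega> ^ 1) * ?E \<omega>)
     + (?c * ?q\<^sup>2) * (complex_of_real (((x i \<omega>)^4 - 2 * (x i \<omega>)\<^sup>2 + 1) - (\<kappa> - 1)) * (complex_of_real (lin i \<omega> ^ 0) * ?E \<omega>))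
     + (?c * 3 * ?q) * (complex_of_real ((x i \<omega>)^3 - x i \<omega> - \<gamma>) * (complex_of_real (lin i \<omega> ^ 1) * ?E \<omega>))
     + (?c * 2) * (complex_of_real ((x i \<omega>)\<^sup>2 - 1) * (complex_of_real (lin i \<omega> ^ 2) * ?E \<omega>))) =
     (\<lambda>\<omega>. complex_of_real (dg i \<omega> + cr i \<omega>) * ?E \<omega>
    + ?c * complex_of_real ((dg i \<omega> + cr i \<omega>) * (dg i \<omega> + 2 * cr i \<omega>) - cvar i \<omega>) * ?E \<omega>)"
  proof
    fix \<omega>
    \<comment> \<open>Stated for complex letters, so that the ring normalisation meets no
      coercions.\<close>
    have alg: "q * ((y\<^sup>2 - 1) * (l ^ 0 * e)) + y * (l ^ 1 * e)
        + (c * q\<^sup>2) * (((y ^ 4 - 2 * y\<^sup>2 + 1) - (k - 1)) * (l ^ 0 * e))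
        + (c * 3 * q) * ((y ^ 3 - y - g) * (l ^ 1 * e)) + (c * 2) * ((y\<^sup>2 - 1) * (l ^ 2 * e)) =
       (q * (y\<^sup>2 - 1) + y * l) * e + c * ((q * (y\<^sup>2 - 1) + y * l) * (q * (y\<^sup>2 - 1) + 2 * (y * l))
         - (q\<^sup>2 * (k - 1) + 3 * g * q * l + 2 * l\<^sup>2)) * e" for q y l e c k g :: complex
      by (simp add: power2_eq_square power3_eq_cube power4_eq_xxxx algebra_simps)
    show "?q * (complex_of_real ((x i \<omega>)\<^sup>2 - 1) * (complex_of_real (lin i \<omega> ^ 0) * ?E \<omega>))
     + complex_of_real (x i \<omega>) * (complex_of_real (lin i \<omega> ^ 1) * ?E \<omega>)
     + (?c * ?q\<^sup>2) * (complex_of_real (((x i \<omega>)^4 - 2 * (x i \<omega>)\<^sup>2 + 1) - (\<kappa> - 1)) * (complex_of_real (lin i \<omega> ^ 0) * ?E \<omega>))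
     + (?c * 3 * ?q) * (complex_of_real ((x i \<omega>)^3 - x i \<omega> - \<gamma>) * (complex_of_real (lin i \<omega> ^ 1) * ?E \<omega>))
     + (?c * 2) * (complex_of_real ((x i \<omega>)\<^sup>2 - 1) * (complex_of_real (lin i \<omega> ^ 2) * ?E \<omega>)) =
      complex_of_real (dg i \<omega> + cr i \<omega>) * ?E \<omega>
    + ?c * complex_of_real ((dg i \<omega> + cr i \<omega>) * (dg i \<omega> + 2 * cr i \<omega>) - cvar i \<omega>) * ?E \<omega>"
      unfolding dg_def cr_def cvar_def of_real_add of_real_diff of_real_mult of_real_power of_real_1 of_real_numeral
      by (rule alg)
  qed
  finally show ?thesis by simp
qed

lemma cvar_M: "i \<in> I \<Longrightarrow> cvar i \<in> borel_measurable M"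
  unfolding cvar_def[abs_def] using lin_M by measurable

lemma cvar_int: 
  assumes "i \<in> I" 
  shows "integrable M (cvar i)"
    "expectation (cvar i) = (Q i i)\<^sup>2 * (\<kappa> - 1) + 2 * (Q i i - (Q i i)\<^sup>2)"
  unfolding cvar_def[abs_def]
  using lin_pow[OF assms, of 1] lin_pow[OF assms, of 2] lin_moments(2,3)[OF assms] prob_space by auto

text \<open>
  Tikhomirov's device: expand \<open>iexp (s * qf)\<close> around \<open>iexp (s * rest i)\<close>, integrate out \<open>x i\<close>, and return to \<open>qf\<close>.
  The zeroth-order term vanishes and the first-order term produces \<open>cvar i\<close>.
\<close>

lemma swap_step:
  fixes s :: real
  assumes i: "i \<in> I"
  shows "norm (expectation (\<lambda>\<omega>. complex_of_real (dg i \<omega> + cr i \<omega>) * iexp (s * qf \<omega>)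
           - \<i> * complex_of_real s * complex_of_real (cvar i \<omega>) * iexp (s * qf \<omega>))) \<le> s\<^sup>2 * clt_c1 K"
proof -
  define \<xi> \<eta> where "\<xi> \<omega> = dg i \<omega> + cr i \<omega>" and "\<eta> \<omega> = dg i \<omega> + 2 * cr i \<omega>" for \<omega>
  let ?E = "\<lambda>\<omega>. iexp (s * rest i \<omega>)" and ?c = "\<i> * complex_of_real s"
  let ?Z = "\<lambda>\<omega>. complex_of_real (\<xi> \<omega>) * ?E \<omega> + ?c * complex_of_real (\<xi> \<omega> * \<eta> \<omega> - cvar i \<omega>) * ?E \<omega>"
  let ?F = "\<lambda>\<omega>. complex_of_real (\<xi> \<omega>) * iexp (s * qf \<omega>) - ?c * complex_of_real (cvar i \<omega>) * iexp (s * qf \<omega>)"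
  let ?B = "\<lambda>\<omega>. s\<^sup>2 * ((1 + majx i \<omega>) + (majg i \<omega> + 1 + majx i \<omega>))"
  have Z: "has_bochner_integral M ?Z 0" using zero_part[OF i, of s] by (simp add: \<xi>_def \<eta>_def)
  have E: "iexp (s * qf \<omega>) = ?E \<omega> * iexp (s * \<eta> \<omega>)" for \<omega>
    by (simp add: qf_split[OF i] \<eta>_def exp_add[symmetric] algebra_simps)
  \<comment> \<open>Both terms are of order \<open>s\<^sup>2\<close>: a second-order Taylor
    remainder, and a first-order one whose prefactor is already \<open>s\<close>.\<close>
  have diff: "?F \<omega> - ?Z \<omega> = complex_of_real (\<xi> \<omega>) * ?E \<omega> * (iexp (s * \<eta> \<omega>) - 1 - \<i> * complex_of_real (s * \<eta> \<omega>))
      + ?c * complex_of_real (cvar i \<omega>) * ?E \<omega> * (1 - iexp (s * \<eta> \<omega>))" for \<omega>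
    unfolding E by (simp add: algebra_simps)
  have bound: "norm (?F \<omega> - ?Z \<omega>) \<le> ?B \<omega>" for \<omega>
  proof -
    have "norm (?F \<omega> - ?Z \<omega>) \<le> \<bar>\<xi> \<omega>\<bar> * norm (iexp (s * \<eta> \<omega>) - 1 - \<i> * complex_of_real (s * \<eta> \<omega>))
        + \<bar>s\<bar> * \<bar>cvar i \<omega>\<bar> * norm (1 - iexp (s * \<eta> \<omega>))"
      unfolding diff by (rule order_trans[OF norm_triangle_ineq]) (simp add: norm_mult)
    also have "\<dots> \<le> \<bar>\<xi> \<omega>\<bar> * ((s * \<eta> \<omega>)\<^sup>2 / 2) + \<bar>s\<bar> * \<bar>cvar i \<omega>\<bar> * \<bar>s * \<eta> \<omega>\<bar>"
      by (intro add_mono mult_left_mono iexp_linear_approx iexp_const_approx) auto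
    also have "\<dots> = s\<^sup>2 * ((\<bar>\<xi> \<omega>\<bar> * (\<eta> \<omega>)\<^sup>2) / 2 + \<bar>cvar i \<omega>\<bar> * \<bar>\<eta> \<omega>\<bar>)"
    proof -
      have "\<bar>s\<bar> * c * \<bar>s * e\<bar> = (\<bar>s\<bar> * \<bar>s\<bar>) * (c * \<bar>e\<bar>)" for c e :: real
        by (simp only: abs_mult mult_ac)
      then have "\<bar>s\<bar> * c * \<bar>s * e\<bar> = s\<^sup>2 * (c * \<bar>e\<bar>)" for c e :: real
        by (simp only: abs_mult_self_eq power2_eq_square)
      then show ?thesis by (simp only: power_mult_distrib distrib_left times_divide_eq_right mult.left_commute)
    qed
    also have "\<dots> \<le> s\<^sup>2 * ((1 + majx i \<omega>) + (majg i \<omega> + 1 + majx i \<omega>))"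
    proof (intro mult_left_mono add_mono)
      have "0 \<le> \<bar>\<xi> \<omega>\<bar> * (\<eta> \<omega>)\<^sup>2" by simp
      then show "\<bar>\<xi> \<omega>\<bar> * (\<eta> \<omega>)\<^sup>2 / 2 \<le> 1 + majx i \<omega>"
        using remainder1[of i \<omega>] unfolding \<xi>_def \<eta>_def by linarith
      show "\<bar>cvar i \<omega>\<bar> * \<bar>\<eta> \<omega>\<bar> \<le> majg i \<omega> + 1 + majx i \<omega>"
        using remainder2[OF i] unfolding \<eta>_def .
    qed simp
    finally show ?thesis .
  qed
  have iB: "integrable M ?B" using majx_int(1)[OF i] majg_int(1)[OF i] by simp
  have [measurable]: "\<xi> \<in> borel_measurable M" "cvar i \<in> borel_measurable M" "qf \<in> borel_measurable M"
    using dg_M[OF i] cr_M[OF i] cvar_M[OF i] qf_M unfolding \<xi>_def[abs_def] by auto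
  have i\<xi>: "integrable M \<xi>"
  proof -
    have "integrable M (dg i)" "integrable M (cr i)"
      using integrable_power_le[OF dg_pow4(1) dg_M, of i 1] integrable_power_le[OF cr_pow4(1) cr_M, of i 1] i by auto
    then show ?thesis unfolding \<xi>_def[abs_def] by simp
  qed
  have iF: "integrable M ?F"
  proof (rule Bochner_Integration.integrable_bound)
    show "integrable M (\<lambda>\<omega>. \<bar>\<xi> \<omega>\<bar> + \<bar>s\<bar> * \<bar>cvar i \<omega>\<bar>)" using i\<xi> cvar_int(1)[OF i] by simp
    show "AE \<omega> in M. norm (?F \<omega>) \<le> norm (\<bar>\<xi> \<omega>\<bar> + \<bar>s\<bar> * \<bar>cvar i \<omega>\<bar>)"
      by (intro AE_I2 order_trans[OF norm_triangle_ineq4]) (simp add: norm_mult)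
  qed measurable
  have iZ: "integrable M ?Z" "expectation ?Z = 0"
    using Z unfolding has_bochner_integral_iff by blast+
  have "expectation ?F = expectation (\<lambda>\<omega>. ?F \<omega> - ?Z \<omega>)"
    by (simp only: Bochner_Integration.integral_diff[OF iF iZ(1)] iZ(2) diff_0_right)
  then have "norm (expectation ?F) = norm (expectation (\<lambda>\<omega>. ?F \<omega> - ?Z \<omega>))"
    by (rule arg_cong)
  also have "\<dots> \<le> expectation ?B" by (rule norm_integral_le[OF iB bound])
  also have "expectation ?B = s\<^sup>2 * (2 + 2 * expectation (majx i) + expectation (majg i))"
    using majx_int(1)[OF i] majg_int(1)[OF i] prob_space by simp
  also have "\<dots> \<le> s\<^sup>2 * clt_c1 K"
    using majx_int(2)[OF i] majg_int(2)[OF i] unfolding clt_c1_def by (intro mult_left_mono) auto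
  finally show ?thesis by (simp add: \<xi>_def)
qed

section \<open>Concentration of the conditional variance\<close>

definition "vr = (\<kappa> - 3) * (\<Sum>i\<in>I. (Q i i)\<^sup>2) + 2 * trc I Q"

text \<open>The mean of \<open>cvar i\<close> is \<open>(\<kappa> - 1) * (Q i i)\<^sup>2 + 2 * (Q i
  i - (Q i i)\<^sup>2)\<close>. The first part sums to the variance of the squares in
  \<open>qf\<close>, the second to that of the mixed products, so \<open>vr\<close> is the variance
  of \<open>qf\<close>.\<close>

lemma vr_eq: "vr = (\<Sum>i\<in>I. expectation (cvar i))"
  by (simp add: cvar_int vr_def trc_def sum.distrib sum_subtractf sum_distrib_left sum_distrib_right algebra_simps)

lemma vr_nonneg: "0 \<le> vr"
  unfolding vr_eq
proof (rule sum_nonneg)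
  fix i assume i: "i \<in> I"
  have "(Q i i)\<^sup>2 \<le> Q i i"
    using is_proj_diag_bounds[OF proj i] mult_left_le[of "Q i i" "Q i i"] by (simp add: power2_eq_square)
  then show "0 \<le> expectation (cvar i)" using kappa_bound[OF i] by (simp add: cvar_int[OF i])
qed

lemma sum_lin_square:
  "(\<Sum>i\<in>I. (lin i \<omega>)\<^sup>2) = (\<Sum>j\<in>I. \<Sum>k\<in>I. (\<Sum>i\<in>I. off_diag Q i j * off_diag Q i k) * x j \<omega> * x k \<omega>)"
proof -
  have "(\<Sum>i\<in>I. (lin i \<omega>)\<^sup>2) = (\<Sum>i\<in>I. \<Sum>j\<in>I. \<Sum>k\<in>I. off_diag Q i j * x j \<omega> * (off_diag Q i k * x k \<omega>))"
    by (simp add: lin_def app_def power2_eq_square sum_product)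
  also have "\<dots> = (\<Sum>j\<in>I. \<Sum>k\<in>I. \<Sum>i\<in>I. off_diag Q i j * x j \<omega> * (off_diag Q i k * x k \<omega>))"
    by (subst sum.swap) (intro sum.cong refl sum.swap)
  finally show ?thesis by (simp add: sum_distrib_left sum_distrib_right ac_simps)
qed

text \<open>The deviation is a linear form plus a centred quadratic form in the \<open>x j\<close>.
  The coefficient vector is \<open>off_diag Q\<close> applied to the diagonal of \<open>Q\<close>,
  the matrix is the square of \<open>off_diag Q\<close>, and both have squared norm of order
  \<open>card I\<close>.\<close>

lemma cvar_concentration:
  "expectation (\<lambda>\<omega>. \<bar>(\<Sum>i\<in>I. cvar i \<omega>) - vr\<bar>) \<le> clt_c2 K * sqrt (card I)"
\<comment> \<open>\<open>gamma_bound\<close> needs some index, so the empty set is treated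
  apart.\<close>
proof (cases "I = {}")
  case True
  have "vr = 0" by (subst vr_def) (simp add: trc_def True)
  then show ?thesis using True by simp
next
  case False
  then obtain i0 where i0: "i0 \<in> I" by blast
  let ?A = "\<lambda>j k. \<Sum>i\<in>I. off_diag Q i j * off_diag Q i k"
  let ?q = "\<lambda>\<omega>. (\<Sum>j\<in>I. \<Sum>k\<in>I. ?A j k * x j \<omega> * x k \<omega>) - (\<Sum>j\<in>I. ?A j j)"
  let ?u = "\<lambda>j. app I (off_diag Q) (\<lambda>i. Q i i) j"
  let ?L = "\<lambda>\<omega>. \<Sum>j\<in>I. ?u j * x j \<omega>"
  have [measurable]: "\<And>j. j \<in> I \<Longrightarrow> x j \<in> borel_measurable M" by (rule x_measurable)
  have symA: "?A j k = ?A k j" for j k by (simp add: mult.commute)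
  have ods: "off_diag Q i j = off_diag Q j i" for i j
    using is_proj_sym[OF proj, of i j] by (simp add: off_diag_def)
  have qM: "?q \<in> borel_measurable M" and LM: "?L \<in> borel_measurable M" by measurable
  have tr: "(\<Sum>j\<in>I. ?A j j) = (\<Sum>i\<in>I. Q i i - (Q i i)\<^sup>2)"
    by (subst sum.swap) (simp add: off_diag_row flip: power2_eq_square)
  have L: "(\<Sum>i\<in>I. Q i i * lin i \<omega>) = ?L \<omega>" for \<omega>
  proof -
    have "(\<Sum>i\<in>I. Q i i * lin i \<omega>) = (\<Sum>i\<in>I. \<Sum>j\<in>I. off_diag Q j i * Q i i * x j \<omega>)"
      by (simp add: lin_def app_def sum_distrib_left ods ac_simps)
    also have "\<dots> = (\<Sum>j\<in>I. \<Sum>i\<in>I. off_diag Q j i * Q i i * x j \<omega>)" by (rule sum.swap)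
    finally show ?thesis by (simp add: app_def sum_distrib_right)
  qed
  have dev: "(\<Sum>i\<in>I. cvar i \<omega>) - vr = 3 * \<gamma> * ?L \<omega> + 2 * ?q \<omega>" for \<omega>
  proof -
    have "(\<Sum>i\<in>I. cvar i \<omega>) = (\<kappa> - 1) * (\<Sum>i\<in>I. (Q i i)\<^sup>2) + 3 * \<gamma> * (\<Sum>i\<in>I. Q i i * lin i \<omega>)
        + 2 * (\<Sum>i\<in>I. (lin i \<omega>)\<^sup>2)"
      by (simp add: cvar_def sum.distrib sum_distrib_left ac_simps)
    then show ?thesis
      unfolding L sum_lin_square tr by (simp add: vr_def trc_def sum_subtractf algebra_simps)
  qed
  have iL: "integrable M (\<lambda>\<omega>. (?L \<omega>)\<^sup>2)" "expectation (\<lambda>\<omega>. (?L \<omega>)\<^sup>2) \<le> 4 * card I"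
  proof -
    note l = linear_form[OF subset_refl, of ?u]
    show "integrable M (\<lambda>\<omega>. (?L \<omega>)\<^sup>2)" using integrable_power_le[OF _ LM, of 4 2] l by auto
    have "expectation (\<lambda>\<omega>. (?L \<omega>)\<^sup>2) = ssq I ?u" using l by (simp add: ssq_def)
    also have "\<dots> \<le> 4 * ssq I (\<lambda>i. Q i i)" by (rule ssq_app_off_diag_le[OF proj])
    also have "\<dots> \<le> 4 * card I"
      using sum_diag_squares_le[OF proj] trc_le_card[OF proj] by (simp add: ssq_def)
    finally show "expectation (\<lambda>\<omega>. (?L \<omega>)\<^sup>2) \<le> 4 * card I" .
  qed
  have iq: "integrable M (\<lambda>\<omega>. (?q \<omega>)\<^sup>2)" "expectation (\<lambda>\<omega>. (?q \<omega>)\<^sup>2) \<le> (K + 2) * (16 * card I)"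
  proof -
    note l = quadratic_form[OF subset_refl, of ?A, OF symA]
    show "integrable M (\<lambda>\<omega>. (?q \<omega>)\<^sup>2)" using l by blast
    have "(K + 2) * (\<Sum>j\<in>I. \<Sum>k\<in>I. (?A j k)\<^sup>2) \<le> (K + 2) * (16 * card I)"
      using K_ge_1 by (intro mult_left_mono sum_square_off_diag_square_le[OF proj]) auto
    then show "expectation (\<lambda>\<omega>. (?q \<omega>)\<^sup>2) \<le> (K + 2) * (16 * card I)"
      using l by linarith
  qed
  have i1: "integrable M (\<lambda>\<omega>. \<bar>?L \<omega>\<bar>)" "integrable M (\<lambda>\<omega>. \<bar>?q \<omega>\<bar>)"
    using integrable_power_le[OF iL(1) LM, of 1] integrable_power_le[OF iq(1) qM, of 1] by auto
  have "expectation (\<lambda>\<omega>. \<bar>(\<Sum>i\<in>I. cvar i \<omega>) - vr\<bar>) \<le> expectation (\<lambda>\<omega>. 3 * \<bar>\<gamma>\<bar> * \<bar>?L \<omega>\<bar> + 2 * \<bar>?q \<omega>\<bar>)"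
    unfolding dev
  proof (rule integral_mono)
    have "\<bar>3 * \<gamma> * a + 2 * b\<bar> \<le> 3 * \<bar>\<gamma>\<bar> * \<bar>a\<bar> + 2 * \<bar>b\<bar>" for a b :: real
      using abs_triangle_ineq[of "3 * \<gamma> * a" "2 * b"] by (simp add: abs_mult)
    then show "\<bar>3 * \<gamma> * ?L \<omega> + 2 * ?q \<omega>\<bar> \<le> 3 * \<bar>\<gamma>\<bar> * \<bar>?L \<omega>\<bar> + 2 * \<bar>?q \<omega>\<bar>" for \<omega> .
    show "integrable M (\<lambda>\<omega>. 3 * \<bar>\<gamma>\<bar> * \<bar>?L \<omega>\<bar> + 2 * \<bar>?q \<omega>\<bar>)" using i1 by simp
    show "integrable M (\<lambda>\<omega>. \<bar>3 * \<gamma> * ?L \<omega> + 2 * ?q \<omega>\<bar>)"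
      using i1 LM qM by (intro integrable_abs Bochner_Integration.integrable_add integrable_mult_right)
        (auto simp only: integrable_abs_cancel)
  qed
  also have "\<dots> = 3 * \<bar>\<gamma>\<bar> * expectation (\<lambda>\<omega>. \<bar>?L \<omega>\<bar>) + 2 * expectation (\<lambda>\<omega>. \<bar>?q \<omega>\<bar>)"
    using i1 by simp
  also have "\<dots> \<le> 3 * (1 + K) * sqrt (4 * card I) + 2 * sqrt ((K + 2) * (16 * card I))"
    using gamma_bound[OF i0] expectation_abs_le_sqrt[OF iL(1) LM iL(2)] expectation_abs_le_sqrt[OF iq(1) qM iq(2)]
    by (intro add_mono mult_mono) auto
  also have "\<dots> = clt_c2 K * sqrt (card I)"
  proof -
    have "sqrt (4 * card I) = 2 * sqrt (card I)" "sqrt ((K + 2) * (16 * card I)) = 4 * sqrt (K + 2) * sqrt (card I)"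
    proof -
      have "sqrt 4 = 2" "sqrt 16 = 4" by (simp_all add: real_sqrt_unique)
      then show "sqrt (4 * card I) = 2 * sqrt (card I)"
        "sqrt ((K + 2) * (16 * card I)) = 4 * sqrt (K + 2) * sqrt (card I)"
        unfolding real_sqrt_mult of_nat_mult of_nat_numeral by simp_all
    qed
    then show ?thesis by (simp add: clt_c2_def algebra_simps)
  qed
  finally show ?thesis .
qed

lemma qf_square: "integrable M (\<lambda>\<omega>. (qf \<omega>)\<^sup>2)" "expectation (\<lambda>\<omega>. (qf \<omega>)\<^sup>2) \<le> (K + 2) * trc I Q"
  using quadratic_form[OF subset_refl, of Q] is_proj_sym[OF proj] trc_eq_sum_squares[OF proj]
  unfolding qf_def[abs_def] trc_def by auto

lemma qf_int: "integrable M qf"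
  using integrable_power_le[OF qf_square(1) qf_M, of 1] by simp

text \<open>
  Summed over \<open>i\<close>, the characteristic function \<open>\<phi>\<close> of \<open>qf\<close> satisfies \<open>\<phi>' = - vr * s * \<phi>\<close> up to a small error.
\<close>

lemma charfun_ode:
  fixes s :: real
  shows "norm (\<i> * expectation (\<lambda>\<omega>. complex_of_real (qf \<omega>) * iexp (s * qf \<omega>))
     + complex_of_real (s * vr) * expectation (\<lambda>\<omega>. iexp (s * qf \<omega>)))
     \<le> s\<^sup>2 * (card I * clt_c1 K) + \<bar>s\<bar> * (clt_c2 K * sqrt (card I))"
proof -
  have [measurable]: "qf \<in> borel_measurable M" by (rule qf_M)
  let ?e = "\<lambda>\<omega>. iexp (s * qf \<omega>)" and ?c = "\<i> * complex_of_real s"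
  have ie: "integrable M (\<lambda>\<omega>. complex_of_real (V \<omega>) * ?e \<omega>)" if "integrable M V" for V
    by (rule Bochner_Integration.integrable_bound[OF that])
       (use borel_measurable_integrable[OF that] in \<open>auto simp: norm_mult\<close>)
  have iD: "integrable M (\<lambda>\<omega>. dg i \<omega> + cr i \<omega>)" if "i \<in> I" for i
    using integrable_power_le[OF dg_pow4(1) dg_M, of i 1] integrable_power_le[OF cr_pow4(1) cr_M, of i 1] that by auto
  let ?D = "\<lambda>i \<omega>. complex_of_real (dg i \<omega> + cr i \<omega>) * ?e \<omega> - ?c * complex_of_real (cvar i \<omega>) * ?e \<omega>"
  have iDD: "integrable M (?D i)" if "i \<in> I" for i
    using ie[OF iD[OF that]] integrable_mult_right[of "?c", OF _ , of M, OF ie[OF cvar_int(1)[OF that]]]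
    by (simp add: mult.assoc)
  have isum: "integrable M (\<lambda>\<omega>. \<Sum>i\<in>I. cvar i \<omega>)" using cvar_int(1) by (intro Bochner_Integration.integrable_sum) auto
  have 1: "norm (expectation (\<lambda>\<omega>. \<Sum>i\<in>I. ?D i \<omega>)) \<le> s\<^sup>2 * (card I * clt_c1 K)"
  proof -
    have "expectation (\<lambda>\<omega>. \<Sum>i\<in>I. ?D i \<omega>) = (\<Sum>i\<in>I. expectation (?D i))"
      using iDD by (intro Bochner_Integration.integral_sum) auto
    then have "norm (expectation (\<lambda>\<omega>. \<Sum>i\<in>I. ?D i \<omega>)) = norm (\<Sum>i\<in>I. expectation (?D i))"
      by (rule arg_cong)
    also have "\<dots> \<le> (\<Sum>i\<in>I. s\<^sup>2 * clt_c1 K)"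
      by (intro order_trans[OF norm_sum] sum_mono swap_step)
    finally show ?thesis by (simp add: ac_simps)
  qed
  have 2: "norm (expectation (\<lambda>\<omega>. complex_of_real ((\<Sum>i\<in>I. cvar i \<omega>) - vr) * ?e \<omega>)) \<le> clt_c2 K * sqrt (card I)"
    by (rule order_trans[OF norm_integral_le cvar_concentration])
       (use isum in \<open>auto simp: norm_mult simp del: of_real_diff of_real_sum\<close>)
  \<comment> \<open>The factor \<open>\<i>\<close> turns the \<open>cvar\<close> part of
    \<open>?D\<close> into \<open>s\<close> times the sum of the \<open>cvar i\<close>; subtracting
    \<open>s\<close> times the deviation of that sum from \<open>vr\<close> leaves
    \<open>s * vr\<close>.\<close>
  have eqn: "\<i> * (complex_of_real (qf \<omega>) * ?e \<omega>) + complex_of_real (s * vr) * ?e \<omega> =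
     \<i> * (\<Sum>i\<in>I. ?D i \<omega>) - complex_of_real s * (complex_of_real ((\<Sum>i\<in>I. cvar i \<omega>) - vr) * ?e \<omega>)" for \<omega>
  proof -
    have "(\<Sum>i\<in>I. ?D i \<omega>) = complex_of_real (qf \<omega>) * ?e \<omega> - ?c * complex_of_real (\<Sum>i\<in>I. cvar i \<omega>) * ?e \<omega>"
      by (simp only: sum_subtractf qf_eq_sum of_real_sum sum_distrib_left sum_distrib_right)
    moreover have "\<i> * (q * e) + r * v * e = \<i> * (q * e - \<i> * r * g * e) - r * ((g - v) * e)" for q e r v g
      by (simp add: algebra_simps)
    ultimately show ?thesis by (simp only: of_real_mult of_real_diff)
  qed
  have "\<i> * expectation (\<lambda>\<omega>. complex_of_real (qf \<omega>) * ?e \<omega>) + complex_of_real (s * vr) * expectation ?e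
     = expectation (\<lambda>\<omega>. \<i> * (complex_of_real (qf \<omega>) * ?e \<omega>) + complex_of_real (s * vr) * ?e \<omega>)"
    using ie[OF qf_int] ie[of "\<lambda>_. 1"] by simp
  also have "\<dots> = \<i> * expectation (\<lambda>\<omega>. \<Sum>i\<in>I. ?D i \<omega>)
      - complex_of_real s * expectation (\<lambda>\<omega>. complex_of_real ((\<Sum>i\<in>I. cvar i \<omega>) - vr) * ?e \<omega>)"
    unfolding eqn
    using iDD ie[of "\<lambda>\<omega>. (\<Sum>i\<in>I. cvar i \<omega>) - vr"] isum
    by (subst Bochner_Integration.integral_diff) (auto intro!: Bochner_Integration.integrable_sum integrable_mult_right)
  finally have *: "\<i> * expectation (\<lambda>\<omega>. complex_of_real (qf \<omega>) * ?e \<omega>) + complex_of_real (s * vr) * expectation ?e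
     = \<i> * expectation (\<lambda>\<omega>. \<Sum>i\<in>I. ?D i \<omega>)
      - complex_of_real s * expectation (\<lambda>\<omega>. complex_of_real ((\<Sum>i\<in>I. cvar i \<omega>) - vr) * ?e \<omega>)" .
  have "norm (\<i> * expectation (\<lambda>\<omega>. \<Sum>i\<in>I. ?D i \<omega>)
      - complex_of_real s * expectation (\<lambda>\<omega>. complex_of_real ((\<Sum>i\<in>I. cvar i \<omega>) - vr) * ?e \<omega>)) \<le> s\<^sup>2 * (card I * clt_c1 K) + \<bar>s\<bar> * (clt_c2 K * sqrt (card I))"
    using 1 mult_left_mono[OF 2, of "\<bar>s\<bar>"]
    by (intro order_trans[OF norm_triangle_ineq4]) (simp add: norm_mult)
  then show ?thesis unfolding * .
qed

text \<open>After integration the second moment of \<open>qf\<close> bounds the Taylor remainder by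
  \<open>(y - s)\<^sup>2 * V\<close>, which yields the derivative directly.\<close>

lemma charfun_derivative:
  "((\<lambda>s. expectation (\<lambda>\<omega>. iexp (s * qf \<omega>))) has_vector_derivative
     \<i> * expectation (\<lambda>\<omega>. complex_of_real (qf \<omega>) * iexp (s * qf \<omega>))) (at s within S)"
proof -
  have [measurable]: "qf \<in> borel_measurable M" by (rule qf_M)
  let ?\<phi> = "\<lambda>s. expectation (\<lambda>\<omega>. iexp (s * qf \<omega>))"
  let ?d = "\<i> * expectation (\<lambda>\<omega>. complex_of_real (qf \<omega>) * iexp (s * qf \<omega>))"
  define V where "V = expectation (\<lambda>\<omega>. (qf \<omega>)\<^sup>2)"
  have ie: "integrable M (\<lambda>\<omega>. complex_of_real (V \<omega>) * iexp (t * qf \<omega>))" if "integrable M V" for V t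
    by (rule Bochner_Integration.integrable_bound[OF that])
       (use borel_measurable_integrable[OF that] in \<open>auto simp: norm_mult\<close>)
  have ie1: "integrable M (\<lambda>\<omega>. iexp (t * qf \<omega>))" for t using ie[of "\<lambda>_. 1"] by simp
  have bd: "norm (?\<phi> y - ?\<phi> s - (y - s) *\<^sub>R ?d) \<le> (y - s)\<^sup>2 * V" for y
  proof -
    let ?g = "\<lambda>\<omega>. iexp (y * qf \<omega>) - iexp (s * qf \<omega>) - complex_of_real (y - s) * (\<i> * (complex_of_real (qf \<omega>) * iexp (s * qf \<omega>)))"
    have "?\<phi> y - ?\<phi> s - (y - s) *\<^sub>R ?d = expectation ?g"
      using ie1 ie[OF qf_int, of s] by (simp add: scaleR_conv_of_real)
    note * = this
    have "norm (expectation ?g) \<le> expectation (\<lambda>\<omega>. (y - s)\<^sup>2 * (qf \<omega>)\<^sup>2)"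
    proof (rule norm_integral_le)
      fix \<omega>
      let ?u = "(y - s) * qf \<omega>"
      have "iexp (y * qf \<omega>) = iexp (s * qf \<omega>) * iexp ?u"
        by (simp add: exp_add[symmetric] algebra_simps)
      then have "?g \<omega>
         = iexp (s * qf \<omega>) * (iexp ?u - 1 - \<i> * complex_of_real ?u)"
        by (simp add: algebra_simps)
      then have "norm (?g \<omega>)
         = norm (iexp ?u - 1 - \<i> * complex_of_real ?u)"
        by (simp add: norm_mult)
      also have "\<dots> \<le> ?u\<^sup>2 / 2" by (rule iexp_linear_approx)
      also have "\<dots> \<le> ?u\<^sup>2" by simp
      also have "\<dots> = (y - s)\<^sup>2 * (qf \<omega>)\<^sup>2" by (rule power_mult_distrib)
      finally show "norm (?g \<omega>)
         \<le> (y - s)\<^sup>2 * (qf \<omega>)\<^sup>2" .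
    qed (use qf_square(1) in simp)
    then show ?thesis unfolding * by (simp add: V_def)
  qed
  have "((\<lambda>y. norm (?\<phi> y - ?\<phi> s - (y - s) *\<^sub>R ?d) / norm (y - s)) \<longlongrightarrow> 0) (at s within S)"
  proof (rule Lim_null_comparison)
    show "\<forall>\<^sub>F y in at s within S. norm (norm (?\<phi> y - ?\<phi> s - (y - s) *\<^sub>R ?d) / norm (y - s)) \<le> \<bar>y - s\<bar> * V"
    proof (intro always_eventually allI)
      fix y
      show "norm (norm (?\<phi> y - ?\<phi> s - (y - s) *\<^sub>R ?d) / norm (y - s)) \<le> \<bar>y - s\<bar> * V"
      proof (cases "y = s")
        case False
        have "(y - s)\<^sup>2 = \<bar>y - s\<bar> * \<bar>y - s\<bar>" by (simp add: power2_eq_square)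
        then have "norm (?\<phi> y - ?\<phi> s - (y - s) *\<^sub>R ?d) \<le> \<bar>y - s\<bar> * V * norm (y - s)"
          using bd[of y] by (simp only: real_norm_def mult_ac)
        moreover have "0 < norm (y - s)" using False by simp
        ultimately have "norm (?\<phi> y - ?\<phi> s - (y - s) *\<^sub>R ?d) / norm (y - s) \<le> \<bar>y - s\<bar> * V"
          by (simp only: pos_divide_le_eq)
        then show ?thesis by (simp only: norm_divide real_norm_def abs_norm_cancel abs_abs abs_divide)
      qed simp
    qed
    show "((\<lambda>y. \<bar>y - s\<bar> * V) \<longlongrightarrow> 0) (at s within S)"
      by (rule tendsto_eq_intros refl | simp)+
  qed
  then show ?thesis
    unfolding has_vector_derivative_def has_derivative_iff_norm
    by (auto intro: bounded_linear_scaleR_left)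
qed

text \<open>After multiplication by the integrating factor \<open>exp (vr * s\<^sup>2 / 2)\<close>
  only the error of \<open>charfun_ode\<close> is left in the derivative. The factor is largest at
  the endpoints, so the mean value inequality loses \<open>exp (vr * t\<^sup>2 / 2)\<close>, which
  cancels on dividing it out. Hence the bound is free of \<open>vr\<close>.\<close>

theorem charfun_bound:
  "norm (expectation (\<lambda>\<omega>. iexp (t * qf \<omega>)) - complex_of_real (exp (- vr * t\<^sup>2 / 2)))
     \<le> \<bar>t\<bar> * (t\<^sup>2 * (card I * clt_c1 K) + \<bar>t\<bar> * (clt_c2 K * sqrt (card I)))"
proof -
  let ?\<phi> = "\<lambda>s. expectation (\<lambda>\<omega>. iexp (s * qf \<omega>))"
  let ?d = "\<lambda>s. \<i> * expectation (\<lambda>\<omega>. complex_of_real (qf \<omega>) * iexp (s * qf \<omega>))"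
  let ?e = "\<lambda>s. exp (vr * s\<^sup>2 / 2)"
  let ?h = "\<lambda>s. ?e s *\<^sub>R ?\<phi> s"
  let ?h' = "\<lambda>s. ?e s *\<^sub>R (?d s + complex_of_real (s * vr) * ?\<phi> s)"
  let ?b = "t\<^sup>2 * (card I * clt_c1 K) + \<bar>t\<bar> * (clt_c2 K * sqrt (card I))"
  let ?S = "{-\<bar>t\<bar>..\<bar>t\<bar>}"
  have C: "0 \<le> clt_c1 K" "0 \<le> clt_c2 K" using K_ge_1 by (auto simp: clt_c1_def clt_c2_def)
  have der: "(?h has_derivative (\<lambda>u. u *\<^sub>R ?h' s)) (at s within ?S)" for s
  proof -
    have "((\<lambda>s. ?e s) has_field_derivative (s * vr) * ?e s) (at s within ?S)"
      by (auto intro!: derivative_eq_intros)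
    from has_vector_derivative_scaleR[OF this charfun_derivative]
    have "(?h has_vector_derivative ?h' s) (at s within ?S)"
      by (simp add: scaleR_conv_of_real algebra_simps)
    then show ?thesis unfolding has_vector_derivative_def .
  qed
  have bnd: "onorm (\<lambda>u. u *\<^sub>R ?h' s) \<le> ?e t * ?b" if s: "s \<in> ?S" for s
  proof (rule onorm_bound)
    have s2: "s\<^sup>2 \<le> t\<^sup>2" using s by (intro abs_le_square_iff[THEN iffD1]) auto
    have "norm (?h' s) = ?e s * norm (?d s + complex_of_real (s * vr) * ?\<phi> s)"
      by simp
    also have "\<dots> \<le> ?e t * (s\<^sup>2 * (card I * clt_c1 K) + \<bar>s\<bar> * (clt_c2 K * sqrt (card I)))"
      using s2 vr_nonneg charfun_ode[of s] by (intro mult_mono) (auto intro!: mult_left_mono divide_right_mono)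
    also have "\<dots> \<le> ?e t * ?b"
      using s s2 C by (intro mult_left_mono add_mono mult_right_mono) auto
    finally have h: "norm (?h' s) \<le> ?e t * ?b" .
    show "norm (u *\<^sub>R ?h' s) \<le> ?e t * ?b * norm u" for u
    proof -
      have "norm (u *\<^sub>R ?h' s) = \<bar>u\<bar> * norm (?h' s)" by (rule norm_scaleR)
      also have "\<dots> \<le> \<bar>u\<bar> * (?e t * ?b)" by (rule mult_left_mono[OF h abs_ge_zero])
      also have "\<dots> = ?e t * ?b * norm u" by (subst mult.commute) (simp only: real_norm_def)
      finally show ?thesis .
    qed
  qed (use C in simp)
  have "norm (?h t - ?h 0) \<le> ?e t * ?b * norm (t - 0)"
    by (rule differentiable_bound[where S = ?S, OF _ der bnd]) auto
  moreover have "?h 0 = 1" by (simp add: prob_space)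
  moreover have "?e t * ?b * norm (t - 0) = ?e t * (\<bar>t\<bar> * ?b)"
    by (simp only: diff_0_right real_norm_def mult_ac)
  ultimately have "norm (?e t *\<^sub>R ?\<phi> t - 1) \<le> ?e t * (\<bar>t\<bar> * ?b)" by (simp only:)
  note hb = this
  have Ee: "exp (- vr * t\<^sup>2 / 2) * ?e t = 1" by (simp add: exp_add[symmetric])
  have "?\<phi> t - complex_of_real (exp (- vr * t\<^sup>2 / 2)) = exp (- vr * t\<^sup>2 / 2) *\<^sub>R (?e t *\<^sub>R ?\<phi> t - 1)"
    by (simp only: scaleR_right_diff_distrib scaleR_scaleR Ee scaleR_one) (simp only: scaleR_conv_of_real mult_1_right)
  then have "norm (?\<phi> t - complex_of_real (exp (- vr * t\<^sup>2 / 2))) = exp (- vr * t\<^sup>2 / 2) * norm (?e t *\<^sub>R ?\<phi> t - 1)"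
    by (simp only: norm_scaleR abs_exp_cancel)
  also have "\<dots> \<le> exp (- vr * t\<^sup>2 / 2) * (?e t * (\<bar>t\<bar> * ?b))"
    by (rule mult_left_mono[OF hb]) simp
  also have "\<dots> = \<bar>t\<bar> * ?b" by (simp only: mult.assoc[symmetric] Ee mult_1_left)
  finally show ?thesis .
qed

end

section \<open>One random column\<close>

text \<open>A standardised variable avoids any given point with probability at least
  \<open>1 / (8 * (K + 1))\<close>; see \<open>point_mass_le\<close>.\<close>

definition rho :: "real \<Rightarrow> real" where
  "rho K = 1 - 1 / (8 * (K + 1))"

lemma rho_bounds: "1 \<le> K \<Longrightarrow> 0 \<le> rho K" "1 \<le> K \<Longrightarrow> rho K < 1"
  by (auto simp: rho_def field_simps)

definition sumsq_diag :: "'i set \<Rightarrow> ('i \<Rightarrow> 'i \<Rightarrow> real) \<Rightarrow> real" where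
  "sumsq_diag I Q = (\<Sum>i\<in>I. (Q i i)\<^sup>2)"

text \<open>The first summand stems from the fluctuation of the squared length \<open>b\<close>
  around the trace, the second from the fourth powers \<open>e\<close>, both in
  \<open>expected_sumsq_diag_deflate\<close>.\<close>

definition step_const :: "real \<Rightarrow> real" where
  "step_const K = 4 * sqrt (K + 2) + 4 * (K + 3)"

context standard_indep
begin

text \<open>A Paley-Zygmund argument: \<open>x i - a\<close> has second moment
  \<open>1 + a\<^sup>2\<close> and fourth moment at most
  \<open>8 * (K + 1) * (1 + a\<^sup>2)\<^sup>2\<close>, so it cannot vanish with too large a
  probability. The square of the first against the second does not depend on \<open>a\<close>, hence
  a uniform bound.\<close>

lemma point_mass_le:
  assumes i: "i \<in> I"
  shows "prob {\<omega> \<in> space M. x i \<omega> = a} \<le> rho K"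
proof -
  have [measurable]: "x i \<in> borel_measurable M" by (rule x_measurable[OF i])
  let ?B = "{\<omega> \<in> space M. x i \<omega> \<noteq> a}"
  \<comment> \<open>The weight in \<open>2 * l * u \<le> l\<^sup>2 * u\<^sup>2 + 1\<close> is the
    ratio of the two moment bounds; the fourth moment term then uses up at most half of
    \<open>1 + a\<^sup>2\<close>.\<close>
  define l where "l = 1 / (8 * (K + 1) * (1 + a\<^sup>2))"
  have a1: "0 < 1 + a\<^sup>2" by (simp add: add_pos_nonneg)
  have l: "0 < l" using K_ge_1 a1 by (simp add: l_def)
  have p4: "(x i \<omega> - a) ^ 4 \<le> 8 * (x i \<omega> ^ 4 + a ^ 4)" for \<omega>
    using power4_sum_le[of "x i \<omega>" "- a"] by simp
  have ptw: "(x i \<omega> - a)\<^sup>2 \<le> l / 2 * (8 * (x i \<omega> ^ 4 + a ^ 4)) + 1 / (2 * l) * indicator ?B \<omega>"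
    if "\<omega> \<in> space M" for \<omega>
  proof (cases "x i \<omega> = a")
    case True
    then show ?thesis using l by simp
  next
    case False
    have "2 * l * u \<le> l\<^sup>2 * u\<^sup>2 + 1" for u
      using zero_le_power2[of "l * u - 1"] by (simp add: power2_diff power_mult_distrib)
    from this[of "(x i \<omega> - a)\<^sup>2"] have "2 * l * (x i \<omega> - a)\<^sup>2 \<le> l\<^sup>2 * (x i \<omega> - a) ^ 4 + 1"
      by (simp flip: power_mult)
    also have "\<dots> \<le> l\<^sup>2 * (8 * (x i \<omega> ^ 4 + a ^ 4)) + 1" using p4 by (intro add_mono mult_left_mono) auto
    finally have "(x i \<omega> - a)\<^sup>2 \<le> (l\<^sup>2 * (8 * (x i \<omega> ^ 4 + a ^ 4)) + 1) / (2 * l)"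
      using l by (simp add: le_divide_eq mult_ac)
    also have "\<dots> = l / 2 * (8 * (x i \<omega> ^ 4 + a ^ 4)) + 1 / (2 * l)"
      using l by (simp add: add_divide_distrib power2_eq_square)
    finally show ?thesis using False that by simp
  qed
  have iB: "integrable M (indicat_real ?B)"
    by (rule integrable_const_bound[of _ 1]) (auto simp: indicator_def)
  note ints = integrable_pow[OF i, of 4] integrable_pow[OF i, of 2] integrable_pow[OF i, of 1]
  have "1 + a\<^sup>2 = expectation (\<lambda>\<omega>. (x i \<omega> - a)\<^sup>2)"
    using ints var[OF i] mean[OF i] by (simp add: power2_diff prob_space)
  also have "\<dots> \<le> expectation (\<lambda>\<omega>. l / 2 * (8 * (x i \<omega> ^ 4 + a ^ 4)) + 1 / (2 * l) * indicator ?B \<omega>)"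
  proof (intro integral_mono ptw)
    show "integrable M (\<lambda>\<omega>. (x i \<omega> - a)\<^sup>2)" using ints by (auto simp: power2_diff)
    show "integrable M (\<lambda>\<omega>. l / 2 * (8 * (x i \<omega> ^ 4 + a ^ 4)) + 1 / (2 * l) * indicator ?B \<omega>)"
      using ints by (intro Bochner_Integration.integrable_add integrable_mult_right iB) auto
  qed
  also have "\<dots> = 4 * l * (expectation (\<lambda>\<omega>. x i \<omega> ^ 4) + a ^ 4) + 1 / (2 * l) * prob ?B"
  proof -
    have "expectation (\<lambda>\<omega>. l / 2 * (8 * (x i \<omega> ^ 4 + a ^ 4)) + 1 / (2 * l) * indicator ?B \<omega>)
        = expectation (\<lambda>\<omega>. l / 2 * (8 * (x i \<omega> ^ 4 + a ^ 4))) + expectation (\<lambda>\<omega>. 1 / (2 * l) * indicator ?B \<omega>)"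
      using ints by (intro Bochner_Integration.integral_add integrable_mult_right iB Bochner_Integration.integrable_add) auto
    moreover have "expectation (\<lambda>\<omega>. l / 2 * (8 * (x i \<omega> ^ 4 + a ^ 4))) = 4 * l * (expectation (\<lambda>\<omega>. x i \<omega> ^ 4) + a ^ 4)"
      using ints by (simp add: prob_space)
    moreover have "expectation (\<lambda>\<omega>. 1 / (2 * l) * indicator ?B \<omega>) = 1 / (2 * l) * prob ?B"
      by simp
    ultimately show ?thesis by simp
  qed
  also have "\<dots> \<le> (1 + a\<^sup>2) / 2 + 1 / (2 * l) * prob ?B"
  proof -
    have "expectation (\<lambda>\<omega>. x i \<omega> ^ 4) + a ^ 4 \<le> (K + 1) * (1 + a\<^sup>2)\<^sup>2"
    proof -
      have "(K + 1) * (1 + a\<^sup>2)\<^sup>2 = K + 1 + 2 * (K + 1) * a\<^sup>2 + K * a ^ 4 + a ^ 4"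
        by (simp add: power2_eq_square power4_eq_xxxx algebra_simps)
      moreover have "0 \<le> 2 * (K + 1) * a\<^sup>2" "0 \<le> K * a ^ 4" using K_ge_1 by auto
      ultimately show ?thesis using fourth[OF i] by linarith
    qed
    then have "4 * l * (expectation (\<lambda>\<omega>. x i \<omega> ^ 4) + a ^ 4) \<le> 4 * l * ((K + 1) * (1 + a\<^sup>2)\<^sup>2)"
      using l by (intro mult_left_mono) auto
    also have "\<dots> = (1 + a\<^sup>2) / 2"
    proof -
      have "4 * (1 / (8 * c * d)) * (c * d\<^sup>2) = d / 2" if "0 < c" "0 < d" for c d :: real
        using that by (simp add: power2_eq_square)
      from this[of "K + 1" "1 + a\<^sup>2"] show ?thesis using K_ge_1 a1 by (simp only: l_def)
    qed
    finally show ?thesis by simp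
  qed
  finally have "(1 + a\<^sup>2) / 2 \<le> 1 / (2 * l) * prob ?B" by (simp add: field_simps)
  also have "1 / (2 * l) = 4 * (K + 1) * (1 + a\<^sup>2)" by (simp add: l_def)
  finally have "(1 + a\<^sup>2) * (1 / 2) \<le> (1 + a\<^sup>2) * (4 * (K + 1) * prob ?B)" by (simp add: mult_ac)
  then have "1 / 2 \<le> 4 * (K + 1) * prob ?B" using a1 by (simp only: mult_le_cancel_left_pos)
  then have "1 / (8 * (K + 1)) \<le> prob ?B" using K_ge_1 by (simp add: field_simps)
  moreover have "prob {\<omega> \<in> space M. x i \<omega> = a} = 1 - prob ?B"
  proof -
    have "{\<omega> \<in> space M. x i \<omega> = a} = space M - ?B" by auto
    then show ?thesis by (simp add: prob_compl)
  qed
  ultimately show ?thesis by (simp add: rho_def)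
qed

text \<open>Given the other coordinates, \<open>g\<close> is a constant and \<open>A\<close> is
  decided, so Fubini on the joint law reduces the claim to \<open>point_mass_le\<close>.\<close>

lemma prob_coord_eq_le:
  fixes g :: "'a \<Rightarrow> real"
  assumes J: "J \<subseteq> I" "i \<in> I" "i \<notin> J" and g: "g \<in> borel_measurable (coords J)" and A: "A \<in> sets (coords J)"
  shows "prob {\<omega> \<in> A. x i \<omega> = g \<omega>} \<le> rho K * prob A"
proof -
  \<comment> \<open>\<open>indep_var\<close> wants a common value type, so \<open>x i\<close> is
    padded with a 0 to match the pair \<open>?U\<close>.\<close>
  let ?U = "\<lambda>\<omega>. (g \<omega>, indicator A \<omega> :: real)" and ?X = "\<lambda>\<omega>. (x i \<omega>, 0 :: real)"
  have U: "?U \<in> borel_measurable (coords J)" using g A by measurable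
  have [measurable]: "(\<lambda>y. (y, 0 :: real)) \<in> borel_measurable (borel :: real measure)" by measurable
  have ind: "indep_var borel ?X borel ?U"
    by (rule indep_coord[OF J _ U, where f = "\<lambda>y. (y, 0)"]) measurable
  have XM: "?X \<in> borel_measurable M" and UM: "?U \<in> borel_measurable M"
    using ind by (auto dest: indep_var_rv1 indep_var_rv2)
  have AM: "A \<in> sets M"
  proof -
    have "indicat_real A \<in> borel_measurable M"
      by (rule coords_measurable_M[OF J(1)]) (use A in measurable)
    then have "(indicat_real A) -` {1} \<inter> space M \<in> sets M" by measurable
    moreover have "A \<subseteq> space M" using sets.sets_into_space[OF A] by (simp add: coords_def)
    then have "(indicat_real A) -` {1} \<inter> space M = A" by (auto simp: indicator_def)
    ultimately show ?thesis by simp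
  qed
  let ?D1 = "distr M borel ?X" and ?D2 = "distr M borel ?U"
  interpret D1: prob_space ?D1 by (rule prob_space_distr[OF XM])
  interpret D2: prob_space ?D2 by (rule prob_space_distr[OF UM])
  interpret P: pair_sigma_finite ?D1 ?D2 ..
  let ?S = "{z \<in> space (borel \<Otimes>\<^sub>M borel). snd (snd z) = (1::real) \<and> fst (fst z) = (fst (snd z) :: real)} :: ((real \<times> real) \<times> (real \<times> real)) set"
  have b: "(fst :: real \<times> real \<Rightarrow> real) \<in> borel_measurable borel" "(snd :: real \<times> real \<Rightarrow> real) \<in> borel_measurable borel"
    by (intro borel_measurable_continuous_onI continuous_intros)+
  have S: "?S \<in> sets (borel \<Otimes>\<^sub>M borel)"
  proof -
    have f: "(\<lambda>z :: (real \<times> real) \<times> (real \<times> real). snd (snd z)) \<in> borel_measurable (borel \<Otimes>\<^sub>M borel)"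
      "(\<lambda>z :: (real \<times> real) \<times> (real \<times> real). fst (fst z)) \<in> borel_measurable (borel \<Otimes>\<^sub>M borel)"
      "(\<lambda>z :: (real \<times> real) \<times> (real \<times> real). fst (snd z)) \<in> borel_measurable (borel \<Otimes>\<^sub>M borel)"
      by (rule measurable_compose[OF measurable_snd b(2)] measurable_compose[OF measurable_fst b(1)]
        measurable_compose[OF measurable_snd b(1)])+
    show ?thesis
      by (intro sets.sets_Collect_conj borel_measurable_eq f borel_measurable_const)
  qed
  have slice: "emeasure ?D1 ((\<lambda>u. (u, v)) -` ?S) \<le> ennreal (rho K) * indicator {v. snd v = 1} v" for v
  proof (cases "snd v = 1")
    case True
    have "(\<lambda>u. (u, v)) -` ?S = {u \<in> space borel. fst u = fst v}" using True by (auto simp: space_pair_measure)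
    moreover have "{u \<in> space borel. fst u = fst v} \<in> sets (borel :: (real \<times> real) measure)"
      by (intro borel_measurable_eq b borel_measurable_const)
    ultimately have "emeasure ?D1 ((\<lambda>u. (u, v)) -` ?S) = emeasure M (?X -` {u. fst u = fst v} \<inter> space M)"
      by (simp add: emeasure_distr[OF XM])
    also have "?X -` {u. fst u = fst v} \<inter> space M = {\<omega> \<in> space M. x i \<omega> = fst v}" by auto
    also have "emeasure M \<dots> \<le> ennreal (rho K)"
      using point_mass_le[OF J(2), of "fst v"] by (simp add: emeasure_eq_measure ennreal_leI)
    finally show ?thesis using True by simp
  next
    case False
    then have "(\<lambda>u. (u, v)) -` ?S = {}" by auto
    then show ?thesis by (simp only: emeasure_empty zero_le)
  qed
  have s1: "{v. snd v = 1} \<in> sets (borel :: (real \<times> real) measure)"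
  proof -
    have "{v \<in> space borel. snd v = 1} \<in> sets (borel :: (real \<times> real) measure)"
      by (intro borel_measurable_eq b borel_measurable_const)
    then show ?thesis by simp
  qed
  have "emeasure M {\<omega> \<in> A. x i \<omega> = g \<omega>} = emeasure M ((\<lambda>\<omega>. (?X \<omega>, ?U \<omega>)) -` ?S \<inter> space M)"
    using sets.sets_into_space[OF AM]
    by (intro arg_cong[where f = "emeasure M"]) (auto simp: space_pair_measure indicator_def split: if_splits)
  also have "\<dots> = emeasure (distr M (borel \<Otimes>\<^sub>M borel) (\<lambda>\<omega>. (?X \<omega>, ?U \<omega>))) ?S"
    using XM UM S by (intro emeasure_distr[symmetric]) auto
  also have "distr M (borel \<Otimes>\<^sub>M borel) (\<lambda>\<omega>. (?X \<omega>, ?U \<omega>)) = ?D1 \<Otimes>\<^sub>M ?D2"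
    using ind unfolding indep_var_distribution_eq by simp
  also have "emeasure (?D1 \<Otimes>\<^sub>M ?D2) ?S = (\<integral>\<^sup>+v. emeasure ?D1 ((\<lambda>u. (u, v)) -` ?S) \<partial>?D2)"
    using S by (intro P.emeasure_pair_measure_alt2) (simp cong: sets_pair_measure_cong)
  also have "\<dots> \<le> (\<integral>\<^sup>+v. ennreal (rho K) * indicator {v. snd v = 1} v \<partial>?D2)"
    by (intro nn_integral_mono slice)
  also have "\<dots> = ennreal (rho K) * emeasure ?D2 {v. snd v = 1}"
    using s1 by (intro nn_integral_cmult_indicator) simp
  also have "emeasure ?D2 {v. snd v = 1} = emeasure M (?U -` {v. snd v = 1} \<inter> space M)"
    using s1 by (intro emeasure_distr[OF UM])
  also have "?U -` {v. snd v = 1} \<inter> space M = A"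
    using sets.sets_into_space[OF AM] by (auto simp: indicator_def split: if_splits)
  finally show ?thesis
    using rho_bounds(1)[OF K_ge_1] by (simp add: emeasure_eq_measure flip: ennreal_mult)
qed

text \<open>
  Odlyzko's argument: if \<open>Q i i \<noteq> 0\<close>, then \<open>Q x = 0\<close> determines \<open>x i\<close> from the other coordinates, which costs a
  factor \<open>rho K\<close>, and the remaining constraints are those of \<open>Q\<close> deflated by the \<open>i\<close>-th unit vector.
\<close>

lemma prob_kernel_le:
  assumes "is_proj I Q" "trc I Q = real m"
  shows "prob {\<omega> \<in> space M. \<forall>i\<in>I. app I Q (\<lambda>j. x j \<omega>) i = 0} \<le> rho K ^ m"
  using assms
proof (induction m arbitrary: Q)
  case 0
  then show ?case by simp
next
  case (Suc m)
  note Q = Suc.prems(1)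
  have "\<exists>i\<in>I. Q i i \<noteq> 0"
  proof (rule ccontr)
    assume "\<not> ?thesis"
    then have "trc I Q = 0" by (simp add: trc_def)
    then show False using Suc.prems(2) by simp
  qed
  then obtain i where i: "i \<in> I" "Q i i \<noteq> 0" by blast
  let ?e = "\<lambda>k. if k = i then 1 else 0 :: real" and ?J = "I - {i}"
  let ?Q' = "deflate I Q ?e"
  have app_e: "app I R ?e k = R k i" for R k
    using i(1) finite_I by (simp add: app_def if_distrib cong: if_cong)
  have "ssq I (app I Q ?e) = Q i i"
    using i(1) finite_I by (simp add: ssq_app[OF Q] app_e if_distrib[of "\<lambda>u. u * _"] cong: if_cong)
  then have tr': "trc I ?Q' = real m"
    using deflate_trc[OF Q, of ?e] i(2) Suc.prems(2) by simp
  have Q': "is_proj I ?Q'" by (rule deflate_proj[OF Q])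
  \<comment> \<open>Column \<open>i\<close> of the deflated kernel is 0, so the remaining
    constraints do not involve \<open>x i\<close> and \<open>?A\<close> is an event of the other
    coordinates.\<close>
  have z: "?Q' k i = 0" if "k \<in> I" for k
    using app_deflate_self[OF Q that, of ?e] by (simp add: app_e)
  have app': "app I ?Q' y k = (\<Sum>j\<in>?J. ?Q' k j * y j)" if "k \<in> I" for y k
    unfolding app_def using z[OF that] by (simp add: sum.remove[OF finite_I i(1)])
  let ?A = "{\<omega> \<in> space M. \<forall>k\<in>I. (\<Sum>j\<in>?J. ?Q' k j * x j \<omega>) = 0}"
  let ?g = "\<lambda>\<omega>. - (\<Sum>j\<in>?J. Q i j * x j \<omega>) / Q i i"
  have sub: "{\<omega> \<in> space M. \<forall>k\<in>I. app I Q (\<lambda>j. x j \<omega>) k = 0} \<subseteq> {\<omega> \<in> ?A. x i \<omega> = ?g \<omega>}"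
  proof safe
    fix \<omega> assume w: "\<forall>k\<in>I. app I Q (\<lambda>j. x j \<omega>) k = 0"
    fix k assume k: "k \<in> I"
    show "(\<Sum>j\<in>?J. ?Q' k j * x j \<omega>) = 0"
      using app_deflate_0[OF Q _ k, of "\<lambda>j. x j \<omega>" ?e] w app'[OF k] by simp
  next
    fix \<omega> assume w: "\<forall>k\<in>I. app I Q (\<lambda>j. x j \<omega>) k = 0"
    have "Q i i * x i \<omega> + (\<Sum>j\<in>?J. Q i j * x j \<omega>) = 0"
      using w i(1) by (auto simp: app_def sum.remove[OF finite_I i(1)])
    then show "x i \<omega> = ?g \<omega>" using i(2) by (simp add: field_simps eq_neg_iff_add_eq_0)
  qed
  have sp: "space (coords ?J) = space M" by (simp add: coords_def)
  have cm[measurable]: "j \<in> ?J \<Longrightarrow> x j \<in> borel_measurable (coords ?J)" for j by (rule coord_measurable)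
  have A: "?A \<in> sets (coords ?J)"
  proof -
    have "{\<omega> \<in> space (coords ?J). \<forall>k\<in>I. (\<Sum>j\<in>?J. ?Q' k j * x j \<omega>) = 0} \<in> sets (coords ?J)"
      using finite_I by measurable
    then show ?thesis unfolding sp .
  qed
  have g: "?g \<in> borel_measurable (coords ?J)" by measurable
  have AM: "{\<omega> \<in> ?A. x i \<omega> = ?g \<omega>} \<in> sets M"
  proof -
    have [measurable]: "j \<in> I \<Longrightarrow> x j \<in> borel_measurable M" for j by (rule x_measurable)
    have "{\<omega> \<in> space M. (\<forall>k\<in>I. (\<Sum>j\<in>?J. ?Q' k j * x j \<omega>) = 0) \<and> x i \<omega> = ?g \<omega>} \<in> sets M"
      using finite_I i(1) by measurable
    then show ?thesis by (simp add: conj_assoc Collect_conj_eq Int_assoc)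
  qed
  have "prob {\<omega> \<in> space M. \<forall>k\<in>I. app I Q (\<lambda>j. x j \<omega>) k = 0} \<le> prob {\<omega> \<in> ?A. x i \<omega> = ?g \<omega>}"
    by (rule finite_measure_mono[OF sub AM])
  also have "\<dots> \<le> rho K * prob ?A" by (rule prob_coord_eq_le[OF _ i(1) _ g A]) auto
  also have "?A = {\<omega> \<in> space M. \<forall>k\<in>I. app I ?Q' (\<lambda>j. x j \<omega>) k = 0}" using app' by auto
  also have "rho K * prob {\<omega> \<in> space M. \<forall>k\<in>I. app I ?Q' (\<lambda>j. x j \<omega>) k = 0} \<le> rho K * rho K ^ m"
    using rho_bounds[OF K_ge_1] by (intro mult_left_mono Suc.IH[OF Q' tr']) auto
  finally show ?case by simp
qed

text \<open>
  With \<open>w = Q x\<close> and \<open>b = w \<bullet> w\<close> the new diagonal is \<open>Q i i - (w i)\<^sup>2 / b\<close>.  Since \<open>b\<close> concentrates around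
  \<open>trc I Q\<close> and \<open>(w i)\<^sup>2\<close> has mean \<open>Q i i\<close>, the sum of squares shrinks by the factor \<open>1 - 2 / trc I Q\<close>.
\<close>

lemma expected_sumsq_diag_deflate:
  assumes Q: "is_proj I Q" and m: "1 \<le> trc I Q"
  shows "expectation (\<lambda>\<omega>. sumsq_diag I (deflate I Q (\<lambda>j. x j \<omega>))) \<le>
     sumsq_diag I Q * (1 - 2 / trc I Q) + step_const K / sqrt (trc I Q)"
proof -
  define m where "m = trc I Q"
  have m1: "1 \<le> m" "0 < m" using assms(2) by (auto simp: m_def)
  define w where "w \<omega> = app I Q (\<lambda>j. x j \<omega>)" for \<omega>
  define a b e where "a \<omega> = (\<Sum>i\<in>I. Q i i * (w \<omega> i)\<^sup>2)" and "b \<omega> = ssq I (w \<omega>)"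
    and "e \<omega> = (\<Sum>i\<in>I. w \<omega> i ^ 4)" for \<omega>
  have [measurable]: "j \<in> I \<Longrightarrow> x j \<in> borel_measurable M" for j by (rule x_measurable)
  have [measurable]: "(\<lambda>\<omega>. w \<omega> i) \<in> borel_measurable M" for i unfolding w_def app_def by measurable
  have [measurable]: "a \<in> borel_measurable M" "b \<in> borel_measurable M" "e \<in> borel_measurable M"
    unfolding a_def[abs_def] b_def[abs_def] e_def[abs_def] ssq_def by measurable
  have sd: "sumsq_diag I (deflate I Q (\<lambda>j. x j \<omega>)) = sumsq_diag I Q - 2 * (a \<omega> / b \<omega>) + e \<omega> / (b \<omega>)\<^sup>2" for \<omega>
  proof -
    have "(deflate I Q (\<lambda>j. x j \<omega>) i i)\<^sup>2 = (Q i i)\<^sup>2 - 2 * (Q i i * (w \<omega> i)\<^sup>2 / b \<omega>) + w \<omega> i ^ 4 / (b \<omega>)\<^sup>2" for i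
      by (simp add: deflate_def w_def b_def power2_eq_square power4_eq_xxxx algebra_simps)
    then show ?thesis
      by (simp add: sumsq_diag_def a_def e_def sum.distrib sum_subtractf sum_distrib_left sum_divide_distrib)
  qed
  have a0: "0 \<le> a \<omega>" and ab: "a \<omega> \<le> b \<omega>" and e0: "0 \<le> e \<omega>" and eb: "e \<omega> \<le> (b \<omega>)\<^sup>2" and b0: "0 \<le> b \<omega>" for \<omega>
  proof -
    show "0 \<le> a \<omega>" unfolding a_def using is_proj_diag_bounds[OF Q] by (intro sum_nonneg) auto
    show "a \<omega> \<le> b \<omega>" unfolding a_def b_def ssq_def
      using is_proj_diag_bounds[OF Q] by (intro sum_mono) (auto simp: mult_left_le_one_le)
    show "0 \<le> e \<omega>" by (simp add: e_def sum_nonneg)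
    show "0 \<le> b \<omega>" by (simp add: b_def ssq_nonneg)
    have "e \<omega> = (\<Sum>i\<in>I. (w \<omega> i)\<^sup>2 * (w \<omega> i)\<^sup>2)" by (simp add: e_def power4_eq_xxxx power2_eq_square mult.assoc)
    also have "\<dots> \<le> (\<Sum>i\<in>I. (w \<omega> i)\<^sup>2 * ssq I (w \<omega>))"
      unfolding ssq_def using finite_I by (intro sum_mono mult_left_mono member_le_sum) auto
    also have "\<dots> = (b \<omega>)\<^sup>2" by (simp add: b_def ssq_def sum_distrib_right[symmetric] power2_eq_square)
    finally show "e \<omega> \<le> (b \<omega>)\<^sup>2" .
  qed
  \<comment> \<open>The random denominators are traded for \<open>m\<close>: the term in
    \<open>a\<close> costs \<open>2 * \<bar>b \<omega> - m\<bar> / m\<close> and the term in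
    \<open>e\<close> as much again.\<close>
  have ptw: "sumsq_diag I (deflate I Q (\<lambda>j. x j \<omega>)) \<le> sumsq_diag I Q - 2 * (a \<omega> / m) + 4 * (e \<omega> / m\<^sup>2) + 4 * (\<bar>b \<omega> - m\<bar> / m)" for \<omega>
  proof -
    have 1: "a \<omega> / m - a \<omega> / b \<omega> \<le> \<bar>b \<omega> - m\<bar> / m"
    proof (cases "b \<omega> = 0")
      case True
      then have "a \<omega> = 0" using a0[of \<omega>] ab[of \<omega>] by simp
      then show ?thesis using m1 by simp
    next
      case False
      then have bp: "0 < b \<omega>" using b0[of \<omega>] by simp
      have "a \<omega> / m - a \<omega> / b \<omega> = (a \<omega> / b \<omega>) * ((b \<omega> - m) / m)"
        using bp m1 by (simp add: field_simps)
      also have "\<dots> \<le> (a \<omega> / b \<omega>) * (\<bar>b \<omega> - m\<bar> / m)"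
        using a0[of \<omega>] bp m1 by (intro mult_left_mono divide_right_mono) auto
      also have "\<dots> \<le> 1 * (\<bar>b \<omega> - m\<bar> / m)"
        using ab[of \<omega>] bp m1 by (intro mult_right_mono) auto
      finally show ?thesis by simp
    qed
    \<comment> \<open>Where \<open>b \<omega>\<close> is at least \<open>m / 2\<close>, the
      denominator is comparable to \<open>m\<^sup>2\<close>. Elsewhere the ratio is at most 1 while
      \<open>\<bar>b \<omega> - m\<bar> / m\<close> exceeds 1/2.\<close>
    have 2: "e \<omega> / (b \<omega>)\<^sup>2 \<le> 4 * (e \<omega> / m\<^sup>2) + 2 * (\<bar>b \<omega> - m\<bar> / m)"
    proof (cases "m / 2 \<le> b \<omega>")
      case True
      have "e \<omega> / (b \<omega>)\<^sup>2 \<le> e \<omega> / (m / 2)\<^sup>2"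
        using True m1 e0 by (intro divide_left_mono power_mono mult_pos_pos) auto
      moreover have "e \<omega> / (m / 2)\<^sup>2 = 4 * (e \<omega> / m\<^sup>2)" by (simp add: power_divide)
      moreover have "0 \<le> \<bar>b \<omega> - m\<bar> / m" using m1 by simp
      ultimately show ?thesis by linarith
    next
      case False
      have "e \<omega> / (b \<omega>)\<^sup>2 \<le> 1" using eb[of \<omega>] e0[of \<omega>] by (cases "b \<omega> = 0") (auto simp: divide_le_eq_1)
      moreover have "1 \<le> 2 * (\<bar>b \<omega> - m\<bar> / m)" using False m1 by (simp add: field_simps abs_if)
      moreover have "0 \<le> e \<omega> / m\<^sup>2" using e0 by simp
      ultimately show ?thesis by linarith
    qed
    show ?thesis unfolding sd using 1 2 by linarith
  qed
  have lf: "integrable M (\<lambda>\<omega>. w \<omega> i ^ 4)" "expectation (\<lambda>\<omega>. (w \<omega> i)\<^sup>2) = Q i i"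
    "expectation (\<lambda>\<omega>. w \<omega> i ^ 4) \<le> (K + 3) * Q i i" "integrable M (\<lambda>\<omega>. (w \<omega> i)\<^sup>2)" if i: "i \<in> I" for i
  proof -
    note l = linear_form[OF subset_refl, of "Q i"]
    show i4: "integrable M (\<lambda>\<omega>. w \<omega> i ^ 4)" "expectation (\<lambda>\<omega>. (w \<omega> i)\<^sup>2) = Q i i"
      using l is_proj_diag[OF Q i] by (auto simp: w_def app_def)
    show "integrable M (\<lambda>\<omega>. (w \<omega> i)\<^sup>2)" by (rule integrable_power_le[OF i4(1)]) auto
    have "(K + 3) * (Q i i)\<^sup>2 \<le> (K + 3) * Q i i"
      using is_proj_diag_bounds[OF Q i] K_ge_1 by (intro mult_left_mono) (auto simp: power2_eq_square mult_left_le)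
    then show "expectation (\<lambda>\<omega>. w \<omega> i ^ 4) \<le> (K + 3) * Q i i"
      using l is_proj_diag[OF Q i] by (auto simp: w_def app_def)
  qed
  have ia: "integrable M a" and Ea: "expectation a = sumsq_diag I Q"
    unfolding a_def[abs_def] using lf(2,4) by (auto simp: sumsq_diag_def power2_eq_square)
  have ie: "integrable M e" and Ee: "expectation e \<le> (K + 3) * m"
  proof -
    show "integrable M e" unfolding e_def[abs_def] using lf(1) by auto
    have "expectation e = (\<Sum>i\<in>I. expectation (\<lambda>\<omega>. w \<omega> i ^ 4))"
      unfolding e_def[abs_def] using lf(1) by (intro Bochner_Integration.integral_sum) auto
    also have "\<dots> \<le> (\<Sum>i\<in>I. (K + 3) * Q i i)" using lf(3) by (intro sum_mono) auto
    finally show "expectation e \<le> (K + 3) * m" by (simp add: m_def trc_def sum_distrib_left)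
  qed
  \<comment> \<open>Since \<open>Q\<close> is a projection, the squared length \<open>b\<close> is
    the quadratic form of \<open>Q\<close> itself, whose mean is the trace.\<close>
  have bq: "b \<omega> - m = (\<Sum>i\<in>I. \<Sum>j\<in>I. Q i j * x i \<omega> * x j \<omega>) - (\<Sum>i\<in>I. Q i i)" for \<omega>
    unfolding b_def w_def ssq_app[OF Q] m_def trc_def by (simp add: app_def sum_distrib_left ac_simps)
  have ib: "integrable M (\<lambda>\<omega>. (b \<omega> - m)\<^sup>2)" "expectation (\<lambda>\<omega>. (b \<omega> - m)\<^sup>2) \<le> (K + 2) * m"
    unfolding bq using quadratic_form[OF subset_refl, of Q] is_proj_sym[OF Q] trc_eq_sum_squares[OF Q]
    by (auto simp: m_def)
  have Eb: "expectation (\<lambda>\<omega>. \<bar>b \<omega> - m\<bar>) \<le> sqrt ((K + 2) * m)"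
    by (rule expectation_abs_le_sqrt[OF ib(1) _ ib(2)]) measurable
  have ib1: "integrable M (\<lambda>\<omega>. \<bar>b \<omega> - m\<bar>)"
    using integrable_power_le[OF ib(1), of 1] by simp
  have nn: "0 \<le> sumsq_diag I (deflate I Q (\<lambda>j. x j \<omega>))" for \<omega> by (simp add: sumsq_diag_def sum_nonneg)
  let ?R = "\<lambda>\<omega>. sumsq_diag I Q - 2 * (a \<omega> / m) + 4 * (e \<omega> / m\<^sup>2) + 4 * (\<bar>b \<omega> - m\<bar> / m)"
  have iR: "integrable M ?R" using ia ie ib1 by simp
  have "expectation (\<lambda>\<omega>. sumsq_diag I (deflate I Q (\<lambda>j. x j \<omega>))) \<le> expectation ?R"
    using norm_integral_le[OF iR, of "\<lambda>\<omega>. sumsq_diag I (deflate I Q (\<lambda>j. x j \<omega>))"] ptw nn by auto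
  also have "\<dots> = sumsq_diag I Q - 2 * (sumsq_diag I Q / m) + 4 * (expectation e / m\<^sup>2) + 4 * (expectation (\<lambda>\<omega>. \<bar>b \<omega> - m\<bar>) / m)"
    using ia ie ib1 prob_space Ea by simp
  also have "\<dots> \<le> sumsq_diag I Q - 2 * (sumsq_diag I Q / m) + 4 * ((K + 3) / sqrt m) + 4 * (sqrt (K + 2) / sqrt m)"
  proof -
    have "expectation e / m\<^sup>2 \<le> ((K + 3) * m) / m\<^sup>2" using Ee m1 by (intro divide_right_mono) auto
    also have "\<dots> = (K + 3) / m" using m1 by (simp add: power2_eq_square)
    \<comment> \<open>Weakened to the rate of the other error term, so that one constant serves
      both.\<close>
    also have "\<dots> \<le> (K + 3) / sqrt m"
    proof -
      have "sqrt m \<le> m" using m1 by (simp add: real_le_lsqrt power2_eq_square)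
      then show ?thesis using m1 K_ge_1 by (intro divide_left_mono) auto
    qed
    finally have 1: "expectation e / m\<^sup>2 \<le> (K + 3) / sqrt m" .
    have "expectation (\<lambda>\<omega>. \<bar>b \<omega> - m\<bar>) / m \<le> sqrt ((K + 2) * m) / m" using Eb m1 by (intro divide_right_mono) auto
    also have "\<dots> = sqrt (K + 2) / sqrt m"
      using m1 sqrt_divide_self_eq[of m] by (simp add: real_sqrt_mult divide_inverse mult.assoc)
    finally show ?thesis using 1 by linarith
  qed
  also have "\<dots> = sumsq_diag I Q * (1 - 2 / m) + step_const K / sqrt m"
    by (simp add: step_const_def add_divide_distrib algebra_simps)
  finally show ?thesis unfolding m_def .
qed

end

section \<open>Random designs\<close>

text \<open>
  \<open>resid_proj I k z\<close> projects onto the orthogonal complement of the columns \<open>z 0, \<dots>, z (k - 1)\<close>; here \<open>z j i\<close> is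
  the entry in column \<open>j\<close> and row \<open>i\<close>.
\<close>

primrec resid_proj :: "'i set \<Rightarrow> nat \<Rightarrow> (nat \<Rightarrow> 'i \<Rightarrow> real) \<Rightarrow> 'i \<Rightarrow> 'i \<Rightarrow> real" where
  "resid_proj I 0 z = (\<lambda>i j. if i = j then 1 else 0)"
| "resid_proj I (Suc k) z = deflate I (resid_proj I k z) (z k)"

text \<open>Phrased by vanishing pivots instead of rank, so that one more column adds one
  alternative, as in \<open>singular_Suc\<close>.\<close>

definition singular :: "'i set \<Rightarrow> nat \<Rightarrow> (nat \<Rightarrow> 'i \<Rightarrow> real) \<Rightarrow> bool" where
  "singular I k z \<longleftrightarrow> (\<exists>j<k. ssq I (app I (resid_proj I j z) (z j)) = 0)"

lemma resid_proj_cong: "(\<And>j. j < k \<Longrightarrow> z j = z' j) \<Longrightarrow> resid_proj I k z = resid_proj I k z'"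
  by (induction k) auto

lemma resid_proj_upd: "k \<le> m \<Longrightarrow> resid_proj I k (z(m := y)) = resid_proj I k z"
  by (rule resid_proj_cong) auto

lemma is_proj_resid: "finite I \<Longrightarrow> is_proj I (resid_proj I k z)"
  by (induction k) (simp_all add: is_proj_id deflate_proj)

lemma singular_Suc: "singular I (Suc k) z \<longleftrightarrow> singular I k z \<or> ssq I (app I (resid_proj I k z) (z k)) = 0"
  by (auto simp: singular_def less_Suc_eq)

lemma singular_upd: "singular I k (z(k := y)) = singular I k z"
  by (auto simp: singular_def resid_proj_upd)

lemma trc_resid:
  assumes "finite I" "\<not> singular I k z"
  shows "trc I (resid_proj I k z) = real (card I) - real k"
  using assms(2)
proof (induction k)
  case 0
  then show ?case by (simp add: trc_def)
next
  case (Suc k)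
  then show ?case using deflate_trc[OF is_proj_resid[OF assms(1)]] by (simp add: singular_Suc)
qed

lemma app_resid_column:
  assumes "finite I" "j < k" "i \<in> I"
  shows "app I (resid_proj I k z) (z j) i = 0"
  using assms(2,3)
proof (induction k arbitrary: i)
  case (Suc k)
  show ?case
  proof (cases "j = k")
    case True
    then show ?thesis using app_deflate_self[OF is_proj_resid[OF assms(1)]] Suc.prems by simp
  next
    case False
    then show ?thesis
      using app_deflate_0[OF is_proj_resid[OF assms(1)] Suc.IH] Suc.prems by simp
  qed
qed simp

text \<open>With \<open>app_resid_column\<close> this pins the projection down: it kills the columns
  and fixes their orthogonal complement. Residuals can thus be recognised without a formula for the
  hat matrix.\<close>

lemma app_resid_orthogonal:
  assumes "finite I" "\<And>j. j < k \<Longrightarrow> (\<Sum>i\<in>I. z j i * r i) = 0" "i \<in> I"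
  shows "app I (resid_proj I k z) r i = r i"
  using assms(2,3)
proof (induction k arbitrary: i)
  case 0
  then show ?case using assms(1) by (simp add: app_def if_distrib[of "\<lambda>u. u * _"] cong: if_cong)
next
  case (Suc k)
  then show ?case using app_deflate_fixed[OF is_proj_resid[OF assms(1)] Suc.IH] by simp
qed

lemma sumsq_diag_bounds:
  assumes "is_proj I Q" shows "0 \<le> sumsq_diag I Q" "sumsq_diag I Q \<le> card I"
  using sum_diag_squares_le[OF assms] trc_le_card[OF assms] by (auto simp: sumsq_diag_def sum_nonneg)

text \<open>The design lives on its canonical product space, grouped by columns, so that one column
  can be integrated out while the earlier ones are frozen. Probability laws at all indices keep the
  products well formed without side conditions.\<close>

locale random_columns =
  fixes I :: "'i set" and \<nu> :: "nat \<Rightarrow> 'i \<Rightarrow> real measure" and p :: nat and K :: real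
  assumes finite_I: "finite I"
    and prob_entry: "\<And>j i. prob_space (\<nu> j i)"
    and sets_entry: "\<And>j i. sets (\<nu> j i) = sets borel"
    and column: "\<And>j. j < p \<Longrightarrow> standard_indep (PiM I (\<nu> j)) I (\<lambda>i y. y i) K"
    and p_less: "p < card I"
    and K_ge_1: "1 \<le> K"
begin

abbreviation "column_law j \<equiv> PiM I (\<nu> j)"
abbreviation "design k \<equiv> PiM {..<k} column_law"

lemma prob_col: "prob_space (column_law j)"
  by (intro prob_space_PiM prob_entry)

lemma prob_design: "prob_space (design k)"
  by (intro prob_space_PiM prob_col)

lemma psf: "product_sigma_finite column_law"
  unfolding product_sigma_finite_def by (intro allI prob_space_imp_sigma_finite prob_col)

lemma entry_measurable:
  assumes "j < m" "i \<in> I" shows "(\<lambda>z. z j i) \<in> borel_measurable (design m)"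
proof -
  have "(\<lambda>y. y i) \<in> measurable (column_law j) (\<nu> j i)" using assms by (intro measurable_component_singleton)
  then have "(\<lambda>y. y i) \<in> borel_measurable (column_law j)" by (simp cong: measurable_cong_sets add: sets_entry)
  moreover have "(\<lambda>z. z j) \<in> measurable (design m) (column_law j)" using assms by (intro measurable_component_singleton) auto
  ultimately show ?thesis by (rule measurable_compose[rotated])
qed

lemma resid_measurable: "k \<le> m \<Longrightarrow> (\<lambda>z. resid_proj I k z i j) \<in> borel_measurable (design m)"
proof (induction k arbitrary: i j)
  case (Suc k)
  have [measurable]: "(\<lambda>z. resid_proj I k z i j) \<in> borel_measurable (design m)" for i j
    by (rule Suc.IH) (use Suc.prems in simp)
  have [measurable]: "i \<in> I \<Longrightarrow> (\<lambda>z. z k i) \<in> borel_measurable (design m)" for i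
    by (rule entry_measurable) (use Suc.prems in simp_all)
  show ?case unfolding resid_proj.simps deflate_def ssq_def app_def by measurable
qed simp

lemma pivot_measurable:
  assumes "k < m" shows "(\<lambda>z. ssq I (app I (resid_proj I k z) (z k))) \<in> borel_measurable (design m)"
proof -
  have [measurable]: "(\<lambda>z. resid_proj I k z i j) \<in> borel_measurable (design m)" for i j
    by (rule resid_measurable) (use assms in simp)
  have [measurable]: "i \<in> I \<Longrightarrow> (\<lambda>z. z k i) \<in> borel_measurable (design m)" for i
    by (rule entry_measurable) (use assms in simp_all)
  show ?thesis unfolding ssq_def app_def by measurable
qed

lemma singular_measurable:
  assumes "k \<le> m" shows "(\<lambda>z. of_bool (singular I k z) :: real) \<in> borel_measurable (design m)"
proof -
  have [measurable]: "j \<in> {..<k} \<Longrightarrow> (\<lambda>z. ssq I (app I (resid_proj I j z) (z j))) \<in> borel_measurable (design m)" for j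
    by (rule pivot_measurable) (use assms in simp)
  have "Measurable.pred (design m) (\<lambda>z. \<exists>j\<in>{..<k}. ssq I (app I (resid_proj I j z) (z j)) = 0)"
    by measurable
  then have "Measurable.pred (design m) (singular I k)"
    by (simp add: singular_def[abs_def] Bex_def)
  then show ?thesis by measurable
qed

lemma sumsq_measurable: "k \<le> m \<Longrightarrow> (\<lambda>z. sumsq_diag I (resid_proj I k z)) \<in> borel_measurable (design m)"
  unfolding sumsq_diag_def using resid_measurable by (intro borel_measurable_sum borel_measurable_power) auto

lemma integrable_bounded:
  assumes "f \<in> borel_measurable (design m)" "\<And>z. 0 \<le> f z" "\<And>z. f z \<le> (c::real)"
  shows "integrable (design m) f"
proof -
  interpret prob_space "design m" by (rule prob_design)
  show ?thesis by (rule integrable_const_bound[of _ c]) (use assms in auto)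
qed

text \<open>Fubini in the last column followed by monotonicity, the form that both recursions use;
  boundedness of \<open>f\<close> supplies its integrability.\<close>

lemma integral_design_Suc:
  assumes f: "f \<in> borel_measurable (design (Suc k))" "\<And>z. 0 \<le> f z" "\<And>z. f z \<le> (c::real)"
    and g: "integrable (design k) g"
    and le: "\<And>z. (\<integral>y. f (z(k := y)) \<partial>column_law k) \<le> g z"
  shows "(\<integral>z. f z \<partial>design (Suc k)) \<le> (\<integral>z. g z \<partial>design k)"
proof -
  interpret product_sigma_finite column_law by (rule psf)
  have "(\<integral>z. f z \<partial>design (Suc k)) = (\<integral>z. (\<integral>y. f (z(k := y)) \<partial>column_law k) \<partial>design k)"
    using integrable_bounded[OF f] by (simp add: lessThan_Suc product_integral_insert)
  also have "\<dots> \<le> (\<integral>z. g z \<partial>design k)"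
  proof -
    have "norm (\<integral>z. (\<integral>y. f (z(k := y)) \<partial>column_law k) \<partial>design k) \<le> (\<integral>z. g z \<partial>design k)"
    proof (rule norm_integral_le[OF g])
      fix z
      have "0 \<le> (\<integral>y. f (z(k := y)) \<partial>column_law k)" using f(2) by (intro Bochner_Integration.integral_nonneg) auto
      then show "norm (\<integral>y. f (z(k := y)) \<partial>column_law k) \<le> g z" using le[of z] by simp
    qed
    then show ?thesis by simp
  qed
  finally show ?thesis .
qed

text \<open>While no pivot has failed, the current projection has trace \<open>card I - k\<close>,
  and \<open>prob_kernel_le\<close> bounds the chance that the next pivot fails. A union bound adds
  up these chances.\<close>

theorem expected_singular_le:
  "k \<le> p \<Longrightarrow> (\<integral>z. of_bool (singular I k z) \<partial>design k) \<le> (\<Sum>j<k. rho K ^ (card I - j))"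
proof (induction k)
  case 0
  then show ?case by (simp add: singular_def)
next
  case (Suc k)
  interpret C: standard_indep "column_law k" I "\<lambda>i y. y i" K by (rule column) (use Suc.prems in simp)
  interpret D: prob_space "design k" by (rule prob_design)
  have sing_int: "integrable (design k) (\<lambda>z. of_bool (singular I k z) :: real)"
    by (rule integrable_bounded[where c = 1]) (auto intro: singular_measurable)
  have "(\<integral>z. of_bool (singular I (Suc k) z) \<partial>design (Suc k)) \<le>
     (\<integral>z. of_bool (singular I k z) + rho K ^ (card I - k) \<partial>design k)"
  proof (rule integral_design_Suc[where c = 1])
    show "(\<lambda>z. of_bool (singular I (Suc k) z) :: real) \<in> borel_measurable (design (Suc k))"
      by (rule singular_measurable) simp
    show "integrable (design k) (\<lambda>z. of_bool (singular I k z) + rho K ^ (card I - k))"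
      using sing_int by simp
    fix z
    let ?f = "\<lambda>y. of_bool (singular I (Suc k) (z(k := y))) :: real"
    show "(\<integral>y. ?f y \<partial>column_law k) \<le> of_bool (singular I k z) + rho K ^ (card I - k)"
    proof (cases "singular I k z")
      case True
      then show ?thesis
        using rho_bounds(1)[OF K_ge_1] C.prob_space by (simp add: singular_Suc singular_upd)
    next
      case False
      let ?Q = "resid_proj I k z" and ?B = "{y \<in> space (column_law k). \<forall>i\<in>I. app I (resid_proj I k z) (\<lambda>j. y j) i = 0}"
      have "(\<integral>y. ?f y \<partial>column_law k) = (\<integral>y. indicator ?B y \<partial>column_law k)"
        using False finite_I
        by (intro Bochner_Integration.integral_cong refl)
           (simp add: singular_Suc singular_upd resid_proj_upd ssq_eq_0_iff indicator_def)
      also have "\<dots> = C.prob ?B"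
      proof -
        have "?B \<inter> space (column_law k) = ?B" by auto
        then show ?thesis by simp
      qed
      also have "\<dots> \<le> rho K ^ (card I - k)"
        by (rule C.prob_kernel_le[OF is_proj_resid[OF finite_I]])
           (use trc_resid[OF finite_I False] Suc.prems p_less in simp)
      finally show ?thesis using False by simp
    qed
  qed auto
  also have "\<dots> = (\<integral>z. of_bool (singular I k z) \<partial>design k) + rho K ^ (card I - k)"
    using sing_int D.prob_space by simp
  also have "\<dots> \<le> (\<Sum>j<Suc k. rho K ^ (card I - j))" using Suc by simp
  finally show ?case .
qed

text \<open>
  The main term is an invariant of the recursion because \<open>(1 - 2 / m) * m\<^sup>2 \<le> (m - 1)\<^sup>2\<close>.
\<close>

theorem expected_sumsq_diag_le:
  "k \<le> p \<Longrightarrow> (\<integral>z. of_bool (\<not> singular I k z) * sumsq_diag I (resid_proj I k z) \<partial>design k)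
     \<le> (real (card I) - real k)\<^sup>2 / card I + (\<Sum>j<k. step_const K / sqrt (real (card I) - real j))"
proof (induction k)
  case 0
  interpret D: prob_space "design 0" by (rule prob_design)
  have "(\<integral>z. of_bool (\<not> singular I 0 z) * sumsq_diag I (resid_proj I 0 z) \<partial>design 0) = (\<integral>z. real (card I) \<partial>design 0)"
    by (intro Bochner_Integration.integral_cong) (auto simp: singular_def sumsq_diag_def)
  also have "\<dots> = card I" using D.prob_space by simp
  finally show ?case by (simp add: power2_eq_square)
next
  case (Suc k)
  interpret C: standard_indep "column_law k" I "\<lambda>i y. y i" K by (rule column) (use Suc.prems in simp)
  interpret D: prob_space "design k" by (rule prob_design)
  let ?F = "\<lambda>k z. of_bool (\<not> singular I k z) * sumsq_diag I (resid_proj I k z)"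
  define m where "m = real (card I) - real k"
  \<comment> \<open>From \<open>Suc k \<le> p\<close> and \<open>p < card I\<close>. It makes
    \<open>1 - 2 / m\<close> nonnegative, so that the induction hypothesis may be multiplied by
    it.\<close>
  have m2: "2 \<le> m" using Suc.prems p_less by (simp add: m_def)
  have sc: "0 \<le> step_const K" using K_ge_1 by (simp add: step_const_def)
  have F0: "0 \<le> ?F k z" and F1: "?F k z \<le> card I" for k z
    using sumsq_diag_bounds[OF is_proj_resid[OF finite_I]] by auto
  have FM: "(\<lambda>z. ?F k z) \<in> borel_measurable (design l)" if "k \<le> l" for k l
    using sumsq_measurable[OF that] singular_measurable[OF that] by (simp add: of_bool_not_iff)
  have iF: "integrable (design k) (?F k)"
    by (rule integrable_bounded[OF FM F0 F1]) simp
  have "(\<integral>z. ?F (Suc k) z \<partial>design (Suc k)) \<le> (\<integral>z. (1 - 2 / m) * ?F k z + step_const K / sqrt m \<partial>design k)"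
  proof (rule integral_design_Suc[OF FM F0 F1])
    show "integrable (design k) (\<lambda>z. (1 - 2 / m) * ?F k z + step_const K / sqrt m)" using iF by simp
    fix z
    show "(\<integral>y. ?F (Suc k) (z(k := y)) \<partial>column_law k) \<le> (1 - 2 / m) * ?F k z + step_const K / sqrt m"
    proof (cases "singular I k z")
      case True
      then show ?thesis using sc m2 by (simp add: singular_Suc singular_upd)
    next
      case False
      let ?Q = "resid_proj I k z"
      have Q: "is_proj I ?Q" by (rule is_proj_resid[OF finite_I])
      have tr: "trc I ?Q = m" using trc_resid[OF finite_I False] by (simp add: m_def)
      have [measurable]: "(\<lambda>y. y i) \<in> borel_measurable (column_law k)" if "i \<in> I" for i
        by (rule C.x_measurable[OF that])
      have sM: "(\<lambda>y. sumsq_diag I (deflate I ?Q (\<lambda>j. y j))) \<in> borel_measurable (column_law k)"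
        unfolding sumsq_diag_def deflate_def ssq_def app_def by measurable
      have iS: "integrable (column_law k) (\<lambda>y. sumsq_diag I (deflate I ?Q (\<lambda>j. y j)))"
        by (rule C.integrable_const_bound[of _ "card I"])
           (use sM sumsq_diag_bounds[OF deflate_proj[OF Q]] in auto)
      have "norm (\<integral>y. ?F (Suc k) (z(k := y)) \<partial>column_law k) \<le> (\<integral>y. sumsq_diag I (deflate I ?Q (\<lambda>j. y j)) \<partial>column_law k)"
        using sumsq_diag_bounds(1)[OF deflate_proj[OF Q]]
        by (intro norm_integral_le[OF iS]) (auto simp: resid_proj_upd)
      also have "\<dots> \<le> sumsq_diag I ?Q * (1 - 2 / m) + step_const K / sqrt m"
        using C.expected_sumsq_diag_deflate[OF Q] tr m2 by simp
      finally show ?thesis using False by (simp add: mult.commute)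
    qed
  qed auto
  also have "\<dots> = (1 - 2 / m) * (\<integral>z. ?F k z \<partial>design k) + step_const K / sqrt m"
    using iF D.prob_space by simp
  also have "\<dots> \<le> (real (card I) - real (Suc k))\<^sup>2 / card I + (\<Sum>j<Suc k. step_const K / sqrt (real (card I) - real j))"
  proof -
    let ?E = "\<Sum>j<k. step_const K / sqrt (real (card I) - real j)"
    have E0: "0 \<le> ?E" using sc Suc.prems p_less by (intro sum_nonneg) auto
    have "(1 - 2 / m) * (\<integral>z. ?F k z \<partial>design k) \<le> (1 - 2 / m) * (m\<^sup>2 / card I + ?E)"
      using Suc.IH Suc.prems m2 by (intro mult_left_mono) (auto simp: m_def)
    also have "\<dots> \<le> (m\<^sup>2 - 2 * m) / card I + ?E"
    proof -
      have "(1 - 2 / m) * (m\<^sup>2 / card I) = (m\<^sup>2 - 2 * m) / card I"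
        using m2 by (simp add: left_diff_distrib diff_divide_distrib power2_eq_square)
      moreover have "(1 - 2 / m) * ?E \<le> 1 * ?E" using m2 E0 by (intro mult_right_mono) auto
      ultimately show ?thesis unfolding distrib_left by linarith
    qed
    also have "\<dots> \<le> (m - 1)\<^sup>2 / card I + ?E"
      by (intro add_right_mono divide_right_mono) (auto simp: power2_diff)
    finally show ?thesis by (simp add: m_def diff_diff_eq add.commute[of 1])
  qed
  finally show ?case .
qed

end

section \<open>Least squares residuals\<close>

lemma mat_inv_nonsingular:
  assumes B: "B \<in> carrier_mat d d" and "Determinant.det B \<noteq> 0"
  shows "mat_inv B \<in> carrier_mat d d" "B * mat_inv B = 1\<^sub>m d" "mat_inv B * B = 1\<^sub>m d"
proof -
  have "mat_inverse B \<noteq> None"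
    using mat_inverse(1)[OF B, of "()"] det_non_zero_imp_unit[OF B assms(2), of "()"] by blast
  then obtain C where C: "mat_inverse B = Some C" by blast
  then show "mat_inv B \<in> carrier_mat d d" "B * mat_inv B = 1\<^sub>m d" "mat_inv B * B = 1\<^sub>m d"
    using mat_inverse(2)[OF B C] by (auto simp: mat_inv_def)
qed

lemma mat_inv_singular:
  assumes B: "B \<in> carrier_mat d d" and "Determinant.det B = 0"
  shows "mat_inv B = 0\<^sub>m d d"
proof (cases "mat_inverse B")
  case None
  then show ?thesis using B by (simp add: mat_inv_def)
next
  case (Some C)
  then have "B * C = 1\<^sub>m d" "C \<in> carrier_mat d d" using mat_inverse(2)[OF B] by auto
  then have "Determinant.det B * Determinant.det C = 1"
    using det_mult[OF B, of C] by simp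
  then show ?thesis using assms(2) by simp
qed

text \<open>Cramer's rule, with the conventional value 0 at singular matrices. Measurability of the
  estimator rests on it, since determinants and cofactors are polynomials in the entries.\<close>

lemma mat_inv_index:
  assumes B: "B \<in> carrier_mat d d" and ij: "i < d" "j < d"
  shows "mat_inv B $$ (i, j) = (if Determinant.det B = 0 then 0 else cofactor B j i / Determinant.det B)"
proof (cases "Determinant.det B = 0")
  case True
  then show ?thesis using mat_inv_singular[OF B True] ij by simp
next
  case False
  note inv = mat_inv_nonsingular[OF B False]
  have adj: "adj_mat B \<in> carrier_mat d d" by (rule adj_mat(1)[OF B])
  have "adj_mat B = adj_mat B * (B * mat_inv B)" using inv(2) adj by simp
  also have "\<dots> = (adj_mat B * B) * mat_inv B" using adj B inv(1) by (simp add: assoc_mult_mat)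
  also have "\<dots> = (Determinant.det B \<cdot>\<^sub>m 1\<^sub>m d) * mat_inv B" by (simp add: adj_mat(3)[OF B])
  also have "\<dots> = Determinant.det B \<cdot>\<^sub>m (1\<^sub>m d * mat_inv B)" by (rule mult_smult_assoc_mat[OF one_carrier_mat inv(1)])
  also have "\<dots> = Determinant.det B \<cdot>\<^sub>m mat_inv B" using inv(1) by simp
  finally have "adj_mat B $$ (i, j) = Determinant.det B * mat_inv B $$ (i, j)"
    using inv(1) ij by simp
  moreover have "adj_mat B $$ (i, j) = cofactor B j i" using B ij by (simp add: adj_mat_def)
  ultimately show ?thesis using False by (simp add: field_simps)
qed

lemma det_measurable:
  fixes F :: "'a \<Rightarrow> real mat"
  assumes "\<And>\<omega>. F \<omega> \<in> carrier_mat d d"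
    and "\<And>i j. i < d \<Longrightarrow> j < d \<Longrightarrow> (\<lambda>\<omega>. F \<omega> $$ (i, j)) \<in> borel_measurable M"
  shows "(\<lambda>\<omega>. Determinant.det (F \<omega>)) \<in> borel_measurable M"
  unfolding det_def'[OF assms(1)]
proof (intro borel_measurable_sum borel_measurable_times borel_measurable_prod borel_measurable_const)
  fix p i assume "p \<in> {p. p permutes {0..<d}}" "i \<in> {0..<d}"
  then have "i < d" "p i < d" using permutes_in_image[of p "{0..<d}" i] by auto
  then show "(\<lambda>\<omega>. F \<omega> $$ (i, p i)) \<in> borel_measurable M" by (rule assms(2))
qed

lemma mat_inv_measurable:
  fixes F :: "'a \<Rightarrow> real mat"
  assumes F: "\<And>\<omega>. F \<omega> \<in> carrier_mat d d"
    and FM: "\<And>i j. i < d \<Longrightarrow> j < d \<Longrightarrow> (\<lambda>\<omega>. F \<omega> $$ (i, j)) \<in> borel_measurable M"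
    and ij: "i < d" "j < d"
  shows "(\<lambda>\<omega>. mat_inv (F \<omega>) $$ (i, j)) \<in> borel_measurable M"
proof -
  have [measurable]: "(\<lambda>\<omega>. Determinant.det (F \<omega>)) \<in> borel_measurable M"
    by (rule det_measurable[OF F FM])
  have [measurable]: "(\<lambda>\<omega>. cofactor (F \<omega>) j i) \<in> borel_measurable M"
    unfolding cofactor_def
  proof (intro borel_measurable_times borel_measurable_const det_measurable[where d = "d - 1"])
    show "mat_delete (F \<omega>) j i \<in> carrier_mat (d - 1) (d - 1)" for \<omega> by (rule mat_delete_carrier[OF F])
    fix a b assume ab: "a < d - 1" "b < d - 1"
    have "mat_delete (F \<omega>) j i $$ (a, b) =
        F \<omega> $$ (if a < j then a else Suc a, if b < i then b else Suc b)" for \<omega>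
      using ab F[of \<omega>] by (simp add: mat_delete_def)
    then show "(\<lambda>\<omega>. mat_delete (F \<omega>) j i $$ (a, b)) \<in> borel_measurable M"
      using ab by (auto intro!: FM)
  qed
  show ?thesis unfolding mat_inv_index[OF F ij] by measurable
qed

lemma mult_mat_vec_index:
  assumes "A \<in> carrier_mat n d" "v \<in> carrier_vec d" "i < n"
  shows "vec_index (A *\<^sub>v v) i = (\<Sum>j<d. A $$ (i, j) * vec_index v j)"
  using assms by (simp add: scalar_prod_def atLeast0LessThan)

lemma mult_mat_index:
  assumes "A \<in> carrier_mat n d" "B \<in> carrier_mat d m" "i < n" "j < m"
  shows "(A * B) $$ (i, j) = (\<Sum>k<d. A $$ (i, k) * B $$ (k, j))"
  using assms by (simp add: scalar_prod_def atLeast0LessThan)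

lemma ols_carrier:
  assumes A: "A \<in> carrier_mat n d" and y: "y \<in> carrier_vec n"
  shows "mat_inv (transpose_mat A * A) \<in> carrier_mat d d"
    "mat_inv (transpose_mat A * A) * transpose_mat A \<in> carrier_mat d n"
    "ols A y \<in> carrier_vec d"
proof -
  have B: "transpose_mat A * A \<in> carrier_mat d d" by (rule mult_carrier_mat[where n = n]) (use A in auto)
  show inv: "mat_inv (transpose_mat A * A) \<in> carrier_mat d d"
    using mat_inv_nonsingular(1)[OF B] mat_inv_singular[OF B]
    by (cases "Determinant.det (transpose_mat A * A) = 0") auto
  then show "mat_inv (transpose_mat A * A) * transpose_mat A \<in> carrier_mat d n"
    using A by simp
  then show "ols A y \<in> carrier_vec d" unfolding ols_def using y by (rule mult_mat_vec_carrier)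
qed

lemma sigma_hat_sq_measurable:
  assumes a: "\<And>i j. i < n \<Longrightarrow> j < d \<Longrightarrow> (\<lambda>\<omega>. a i \<omega> j) \<in> borel_measurable M"
    and y: "\<And>i. i < n \<Longrightarrow> y i \<in> borel_measurable M"
  shows "sigma_hat_sq n d a y \<in> borel_measurable M"
proof -
  let ?A = "\<lambda>\<omega>. mat n d (\<lambda>(i, j). a i \<omega> j)" and ?y = "\<lambda>\<omega>. vec n (\<lambda>i. y i \<omega>)"
  let ?B = "\<lambda>\<omega>. transpose_mat (?A \<omega>) * ?A \<omega>"
  have AM: "(\<lambda>\<omega>. ?A \<omega> $$ (i, j)) \<in> borel_measurable M" if "i < n" "j < d" for i j
    using a[OF that] that by simp
  have BM: "(\<lambda>\<omega>. ?B \<omega> $$ (i, j)) \<in> borel_measurable M" if ij: "i < d" "j < d" for i j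
  proof -
    have "?B \<omega> $$ (i, j) = (\<Sum>k<n. ?A \<omega> $$ (k, i) * ?A \<omega> $$ (k, j))" for \<omega>
      using ij by (subst mult_mat_index[where n = d and d = n and m = d]) auto
    then show ?thesis using AM ij by (auto intro!: borel_measurable_sum borel_measurable_times)
  qed
  have IM: "(\<lambda>\<omega>. mat_inv (?B \<omega>) $$ (i, j)) \<in> borel_measurable M" if "i < d" "j < d" for i j
    by (rule mat_inv_measurable[OF _ BM that]) auto
  have ic: "mat_inv (?B \<omega>) \<in> carrier_mat d d" for \<omega>
    by (rule ols_carrier(1)[of _ n d "0\<^sub>v n"]) auto
  have ICM: "(\<lambda>\<omega>. (mat_inv (?B \<omega>) * transpose_mat (?A \<omega>)) $$ (i, k)) \<in> borel_measurable M" if ik: "i < d" "k < n" for i k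
  proof -
    have "(mat_inv (?B \<omega>) * transpose_mat (?A \<omega>)) $$ (i, k) = (\<Sum>l<d. mat_inv (?B \<omega>) $$ (i, l) * ?A \<omega> $$ (k, l))" for \<omega>
      using ik ic[of \<omega>] by (subst mult_mat_index[where n = d and d = d and m = n]) auto
    then show ?thesis using AM IM ik by (auto intro!: borel_measurable_sum borel_measurable_times)
  qed
  have OM: "(\<lambda>\<omega>. vec_index (ols (?A \<omega>) (?y \<omega>)) i) \<in> borel_measurable M" if i: "i < d" for i
  proof -
    have "vec_index (ols (?A \<omega>) (?y \<omega>)) i =
        (\<Sum>k<n. (mat_inv (?B \<omega>) * transpose_mat (?A \<omega>)) $$ (i, k) * vec_index (?y \<omega>) k)" for \<omega>
      unfolding ols_def using i ic[of \<omega>] by (intro mult_mat_vec_index[where n = d]) auto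
    then show ?thesis using ICM[OF i] y by (auto intro!: borel_measurable_sum borel_measurable_times)
  qed
  have RM: "(\<lambda>\<omega>. vec_index (?y \<omega> - ?A \<omega> *\<^sub>v ols (?A \<omega>) (?y \<omega>)) i) \<in> borel_measurable M" if i: "i < n" for i
  proof -
    have "vec_index (?y \<omega> - ?A \<omega> *\<^sub>v ols (?A \<omega>) (?y \<omega>)) i =
        y i \<omega> - (\<Sum>j<d. ?A \<omega> $$ (i, j) * vec_index (ols (?A \<omega>) (?y \<omega>)) j)" for \<omega>
      using i ols_carrier(3)[of "?A \<omega>" n d "?y \<omega>"]
      by (subst mult_mat_vec_index[where n = n and d = d, symmetric]) auto
    then show ?thesis using AM OM y i by (auto intro!: borel_measurable_sum borel_measurable_times borel_measurable_diff)
  qed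
  have "sigma_hat_sq n d a y \<omega> = (\<Sum>i<n. vec_index (?y \<omega> - ?A \<omega> *\<^sub>v ols (?A \<omega>) (?y \<omega>)) i *
      vec_index (?y \<omega> - ?A \<omega> *\<^sub>v ols (?A \<omega>) (?y \<omega>)) i) / (real n - real d)" for \<omega>
    unfolding sigma_hat_sq_def Let_def by (simp add: scalar_prod_def atLeast0LessThan)
  then show ?thesis
    using RM by (simp add: fun_eq_iff[symmetric] cong: measurable_cong)
qed

text \<open>In matrix form X = Z R^T. The array \<open>z\<close> has the column index first, as in
  \<open>resid_proj\<close>.\<close>

locale factored_design =
  fixes n d :: nat and R :: "real mat" and x :: "nat \<Rightarrow> nat \<Rightarrow> real" and z :: "nat \<Rightarrow> nat \<Rightarrow> real"
  assumes R: "R \<in> carrier_mat d d" "Determinant.det R \<noteq> 0"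
    and x_eq: "\<And>i j. i < n \<Longrightarrow> j < d \<Longrightarrow> x i j = (\<Sum>k<d. R $$ (j, k) * z k i)"
    and regular: "\<not> singular {..<n} d z"
begin

abbreviation "A \<equiv> mat n d (\<lambda>(i, j). x i j)"

lemma A_mult_index:
  assumes "v \<in> carrier_vec d" "i < n"
  shows "vec_index (A *\<^sub>v v) i = (\<Sum>k<d. vec_index (transpose_mat R *\<^sub>v v) k * z k i)"
proof -
  have "vec_index (A *\<^sub>v v) i = (\<Sum>j<d. (\<Sum>k<d. R $$ (j, k) * z k i) * vec_index v j)"
    using assms by (subst mult_mat_vec_index[where n = n and d = d]) (auto simp: x_eq)
  also have "\<dots> = (\<Sum>k<d. \<Sum>j<d. R $$ (j, k) * z k i * vec_index v j)"
    by (simp only: sum_distrib_right) (rule sum.swap)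
  also have "\<dots> = (\<Sum>k<d. vec_index (transpose_mat R *\<^sub>v v) k * z k i)"
  proof (rule sum.cong[OF refl])
    fix k assume k: "k \<in> {..<d}"
    then have "vec_index (transpose_mat R *\<^sub>v v) k = (\<Sum>j<d. R $$ (j, k) * vec_index v j)"
      using R assms by (subst mult_mat_vec_index[where n = d and d = d]) auto
    then show "(\<Sum>j<d. R $$ (j, k) * z k i * vec_index v j) = vec_index (transpose_mat R *\<^sub>v v) k * z k i"
      by (simp add: sum_distrib_left ac_simps)
  qed
  finally show ?thesis .
qed

lemma At_mult_index:
  assumes "r \<in> carrier_vec n" "j < d"
  shows "vec_index (transpose_mat A *\<^sub>v r) j = vec_index (R *\<^sub>v vec d (\<lambda>k. \<Sum>i<n. z k i * vec_index r i)) j"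
proof -
  have "vec_index (transpose_mat A *\<^sub>v r) j = (\<Sum>i<n. (\<Sum>k<d. R $$ (j, k) * z k i) * vec_index r i)"
    using assms by (subst mult_mat_vec_index[where n = d and d = n]) (auto simp: x_eq)
  also have "\<dots> = (\<Sum>k<d. \<Sum>i<n. R $$ (j, k) * z k i * vec_index r i)"
    by (simp only: sum_distrib_right) (rule sum.swap)
  also have "\<dots> = (\<Sum>k<d. R $$ (j, k) * (\<Sum>i<n. z k i * vec_index r i))"
    by (simp add: sum_distrib_left ac_simps)
  also have "\<dots> = vec_index (R *\<^sub>v vec d (\<lambda>k. \<Sum>i<n. z k i * vec_index r i)) j"
    using R assms by (subst mult_mat_vec_index[where n = d and d = d]) auto
  finally show ?thesis .
qed

text \<open>Let \<open>l\<close> be the last index with a nonzero coefficient. The projection built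
  from the first \<open>l\<close> columns kills those columns, later columns have coefficient 0, and
  so column \<open>l\<close> would have pivot 0.\<close>

lemma columns_independent:
  assumes "\<And>i. i < n \<Longrightarrow> (\<Sum>k<d. u k * z k i) = 0" "k < d"
  shows "u k = 0"
proof (rule ccontr)
  assume "u k \<noteq> 0"
  then have ne: "{k. k < d \<and> u k \<noteq> 0} \<noteq> {}" using assms(2) by blast
  define l where "l = Max {k. k < d \<and> u k \<noteq> 0}"
  have "l \<in> {k. k < d \<and> u k \<noteq> 0}" unfolding l_def by (rule Max_in[OF _ ne]) simp
  then have l: "l < d" "u l \<noteq> 0" by auto
  have above: "u k = 0" if "l < k" "k < d" for k
  proof (rule ccontr)
    assume "u k \<noteq> 0"
    then have "k \<le> l" unfolding l_def using that(2) by (intro Max_ge) auto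
    then show False using that(1) by simp
  qed
  let ?Q = "resid_proj {..<n} l z"
  have "app {..<n} ?Q (z l) i = 0" if i: "i < n" for i
  proof -
    have "0 = app {..<n} ?Q (\<lambda>i. \<Sum>k<d. u k * z k i) i"
      using assms(1) by (simp add: app_def)
    also have "\<dots> = (\<Sum>k<d. u k * app {..<n} ?Q (z k) i)"
      unfolding app_def by (simp add: sum_distrib_left, subst sum.swap) (simp add: ac_simps)
    also have "\<dots> = (\<Sum>k<d. if k = l then u l * app {..<n} ?Q (z l) i else 0)"
    proof (rule sum.cong[OF refl])
      fix k assume "k \<in> {..<d}"
      then show "u k * app {..<n} ?Q (z k) i = (if k = l then u l * app {..<n} ?Q (z l) i else 0)"
        using above[of k] app_resid_column[of "{..<n}" k l i z] i by (cases k l rule: linorder_cases) auto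
    qed
    also have "\<dots> = u l * app {..<n} ?Q (z l) i" using l by simp
    finally show ?thesis using l by simp
  qed
  then have "ssq {..<n} (app {..<n} ?Q (z l)) = 0" by (simp add: ssq_def)
  then show False using regular l by (auto simp: singular_def)
qed

text \<open>A kernel vector v of the Gram matrix satisfies A v = 0, because the squared length of A
  v is v \<bullet> (A^T A v). Independence of the columns of \<open>z\<close> then gives R^T v = 0,
  and invertibility of \<open>R\<close> gives v = 0.\<close>

lemma gram_invertible: "Determinant.det (transpose_mat A * A) \<noteq> 0"
proof
  assume det0: "Determinant.det (transpose_mat A * A) = 0"
  have B: "transpose_mat A * A \<in> carrier_mat d d" by (rule mult_carrier_mat[where n = n]) auto
  obtain v where v: "v \<in> carrier_vec d" "v \<noteq> 0\<^sub>v d" "(transpose_mat A * A) *\<^sub>v v = 0\<^sub>v d"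
    using det0 det_0_iff_vec_prod_zero_field[OF B] by blast
  let ?w = "A *\<^sub>v v"
  have w: "?w \<in> carrier_vec n" by (rule carrier_vecI) simp
  have Aw: "transpose_mat A *\<^sub>v ?w = 0\<^sub>v d"
    using v by (subst assoc_mult_mat_vec[symmetric, where n\<^sub>1 = d and n\<^sub>2 = n and n\<^sub>3 = d]) auto
  have "(\<Sum>i<n. vec_index ?w i * vec_index ?w i) = (\<Sum>i<n. \<Sum>j<d. vec_index v j * (A $$ (i, j) * vec_index ?w i))"
  proof (rule sum.cong[OF refl])
    fix i assume "i \<in> {..<n}"
    then have "vec_index ?w i = (\<Sum>j<d. A $$ (i, j) * vec_index v j)"
      using v by (intro mult_mat_vec_index[where n = n]) auto
    then have "vec_index ?w i * vec_index ?w i = vec_index ?w i * (\<Sum>j<d. A $$ (i, j) * vec_index v j)"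
      by (rule arg_cong)
    then show "vec_index ?w i * vec_index ?w i = (\<Sum>j<d. vec_index v j * (A $$ (i, j) * vec_index ?w i))"
      by (simp only: sum_distrib_left mult_ac)
  qed
  also have "\<dots> = (\<Sum>j<d. vec_index v j * (\<Sum>i<n. A $$ (i, j) * vec_index ?w i))"
    by (subst sum.swap) (simp add: sum_distrib_left)
  also have "\<dots> = (\<Sum>j<d. vec_index v j * vec_index (transpose_mat A *\<^sub>v ?w) j)"
  proof (rule sum.cong[OF refl])
    fix j assume j: "j \<in> {..<d}"
    then have "vec_index (transpose_mat A *\<^sub>v ?w) j = (\<Sum>i<n. A $$ (i, j) * vec_index ?w i)"
      using w by (subst mult_mat_vec_index[where n = d and d = n]) auto
    then show "vec_index v j * (\<Sum>i<n. A $$ (i, j) * vec_index ?w i) = vec_index v j * vec_index (transpose_mat A *\<^sub>v ?w) j"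
      by simp
  qed
  also have "\<dots> = 0" unfolding Aw by simp
  finally have "\<forall>i\<in>{..<n}. vec_index ?w i * vec_index ?w i = 0"
    by (subst (asm) sum_nonneg_eq_0_iff) auto
  then have w0: "vec_index ?w i = 0" if "i < n" for i using that by simp
  let ?u = "transpose_mat R *\<^sub>v v"
  have "vec_index ?u k = 0" if "k < d" for k
    by (rule columns_independent[OF _ that]) (use A_mult_index[OF v(1)] w0 in simp)
  then have "?u = 0\<^sub>v d" using R by (intro eq_vecI) auto
  then have "Determinant.det (transpose_mat R) = 0"
    using det_0_iff_vec_prod_zero_field[of "transpose_mat R" d] R v by auto
  then show False using R det_transpose[OF R(1)] by simp
qed

text \<open>By the normal equations and invertibility of \<open>R\<close>, the residual
  \<open>r\<close> is orthogonal to the columns of \<open>z\<close>, so the projection fixes it. On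
  the other hand \<open>r\<close> differs from \<open>e\<close> by a combination of these columns,
  which the projection kills. Therefore \<open>r\<close> is the projection of \<open>e\<close>,
  whatever \<open>\<beta>\<close>.\<close>

theorem residual_sum_of_squares:
  assumes \<beta>: "\<beta> \<in> carrier_vec d" and y: "\<And>i. i < n \<Longrightarrow> y i = scalar_prod (vec d (x i)) \<beta> + e i"
  shows "(let r = vec n y - A *\<^sub>v ols A (vec n y) in scalar_prod r r) = ssq {..<n} (app {..<n} (resid_proj {..<n} d z) e)"
proof -
  let ?y = "vec n y" and ?b = "ols A (vec n y)" and ?Q = "resid_proj {..<n} d z"
  define r where "r = ?y - A *\<^sub>v ?b"
  have Ac: "A \<in> carrier_mat n d" by simp
  have b: "?b \<in> carrier_vec d" by (rule ols_carrier(3)[OF Ac]) simp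
  have rc: "r \<in> carrier_vec n" by (rule carrier_vecI) (simp add: r_def)
  let ?B = "transpose_mat A * A"
  have B: "?B \<in> carrier_mat d d" by (rule mult_carrier_mat[where n = n]) auto
  note inv = mat_inv_nonsingular[OF B gram_invertible]
  have At: "transpose_mat A \<in> carrier_mat d n" by simp
  have "transpose_mat A *\<^sub>v (A *\<^sub>v ?b) = ?B *\<^sub>v ?b"
    using b by (subst assoc_mult_mat_vec[where n\<^sub>1 = d and n\<^sub>2 = n and n\<^sub>3 = d]) auto
  also have "?B *\<^sub>v ?b = ?B *\<^sub>v (mat_inv ?B *\<^sub>v (transpose_mat A *\<^sub>v ?y))"
    unfolding ols_def by (subst assoc_mult_mat_vec[OF inv(1) At]) simp_all
  also have "?B *\<^sub>v (mat_inv ?B *\<^sub>v (transpose_mat A *\<^sub>v ?y)) = (?B * mat_inv ?B) *\<^sub>v (transpose_mat A *\<^sub>v ?y)"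
    by (rule assoc_mult_mat_vec[OF B inv(1), symmetric]) (rule carrier_vecI, simp)
  also have "\<dots> = transpose_mat A *\<^sub>v ?y" unfolding inv(2) by (rule one_mult_mat_vec) (rule carrier_vecI, simp)
  finally have Ab: "transpose_mat A *\<^sub>v (A *\<^sub>v ?b) = transpose_mat A *\<^sub>v ?y" .
  have Atr: "transpose_mat A *\<^sub>v r = 0\<^sub>v d"
    unfolding r_def by (subst mult_minus_distrib_mat_vec[OF At]) (auto simp: Ab intro!: carrier_vecI)
  let ?t = "vec d (\<lambda>k. \<Sum>i<n. z k i * vec_index r i)"
  have "R *\<^sub>v ?t = 0\<^sub>v d"
    using R At_mult_index[OF rc] Atr by (intro eq_vecI) auto
  then have t0: "?t = 0\<^sub>v d"
    using det_0_iff_vec_prod_zero_field[OF R(1)] R(2) vec_carrier[of d] by blast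
  have orth: "(\<Sum>i<n. z k i * vec_index r i) = 0" if k: "k < d" for k
  proof -
    have "vec_index ?t k = vec_index (0\<^sub>v d) k" by (rule arg_cong[OF t0])
    then show ?thesis using k by simp
  qed
  have fixed: "app {..<n} ?Q (\<lambda>i. vec_index r i) i = vec_index r i" if "i < n" for i
    by (rule app_resid_orthogonal) (use orth that in auto)
  let ?u = "\<lambda>k. vec_index (transpose_mat R *\<^sub>v (\<beta> - ?b)) k"
  have ri: "vec_index r i = e i + (\<Sum>k<d. ?u k * z k i)" if i: "i < n" for i
  proof -
    have row: "scalar_prod (vec d (x i)) \<beta> = vec_index (A *\<^sub>v \<beta>) i"
      using i \<beta> by (auto simp: scalar_prod_def intro!: sum.cong)
    have "vec_index (A *\<^sub>v (\<beta> - ?b)) i = vec_index (A *\<^sub>v \<beta>) i - vec_index (A *\<^sub>v ?b) i"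
      unfolding mult_minus_distrib_mat_vec[OF Ac \<beta> b] by (rule index_minus_vec(1)) (use i in simp)
    moreover have "vec_index r i = vec_index ?y i - vec_index (A *\<^sub>v ?b) i"
      unfolding r_def by (rule index_minus_vec(1)) (use i in simp)
    moreover have "vec_index ?y i = vec_index (A *\<^sub>v \<beta>) i + e i"
      unfolding index_vec[OF i] y[OF i] row ..
    ultimately have "vec_index r i = e i + vec_index (A *\<^sub>v (\<beta> - ?b)) i" by linarith
    also have "vec_index (A *\<^sub>v (\<beta> - ?b)) i = (\<Sum>k<d. ?u k * z k i)"
      by (rule A_mult_index) (use b \<beta> i in auto)
    finally show ?thesis .
  qed
  have "vec_index r i = app {..<n} ?Q e i" if i: "i < n" for i
  proof -
    have "vec_index r i = app {..<n} ?Q (\<lambda>i. e i + (\<Sum>k<d. ?u k * z k i)) i"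
      unfolding fixed[OF i, symmetric] by (simp add: app_def ri)
    also have "\<dots> = app {..<n} ?Q e i + (\<Sum>k<d. ?u k * app {..<n} ?Q (z k) i)"
    proof -
      have "(\<Sum>j<n. ?Q i j * (\<Sum>k<d. ?u k * z k j)) = (\<Sum>j<n. \<Sum>k<d. ?u k * (?Q i j * z k j))"
        by (simp only: sum_distrib_left mult.left_commute)
      also have "\<dots> = (\<Sum>k<d. \<Sum>j<n. ?u k * (?Q i j * z k j))" by (rule sum.swap)
      finally show ?thesis by (simp only: app_def distrib_left sum.distrib sum_distrib_left)
    qed
    also have "\<dots> = app {..<n} ?Q e i" using app_resid_column[of "{..<n}" _ d i z] i by simp
    finally show ?thesis .
  qed
  then have "scalar_prod r r = ssq {..<n} (app {..<n} ?Q e)"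
    using rc by (simp add: scalar_prod_def ssq_def power2_eq_square atLeast0LessThan)
  then show ?thesis by (simp add: r_def)
qed

end

text \<open>A positive \<open>lambda_min\<close> excludes the eigenvalue 0, and the determinant of
  \<open>S\<close> is the square of that of \<open>R\<close>.\<close>

lemma sqrt_mat_invertible:
  assumes S: "is_sqrt_mat d S R" and l: "0 < lambda_min S"
  shows "R \<in> carrier_mat d d" "Determinant.det R \<noteq> 0"
proof -
  show R: "R \<in> carrier_mat d d" using S by (simp add: is_sqrt_mat_def psd_mat_def)
  have SR: "S = R * R" using S by (simp add: is_sqrt_mat_def)
  have Sc: "S \<in> carrier_mat d d" using R by (simp add: SR)
  have "0 \<notin> spectrum S"
  proof
    assume "0 \<in> spectrum S"
    then have "lambda_min S \<le> 0"
      unfolding lambda_min_def using card_finite_spectrum(1)[OF Sc] by (intro Min_le)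
    then show False using l by simp
  qed
  moreover have "0 \<in> spectrum S" if det0: "Determinant.det S = 0"
  proof -
    obtain v where "v \<in> carrier_vec d" "v \<noteq> 0\<^sub>v d" "S *\<^sub>v v = 0\<^sub>v d"
      using det0 det_0_iff_vec_prod_zero_field[OF Sc] by blast
    then have "eigenvector S v 0" using Sc by (auto simp: eigenvector_def)
    then show ?thesis by (auto simp: spectrum_def eigenvalue_def)
  qed
  ultimately have "Determinant.det S \<noteq> 0" by blast
  then show "Determinant.det R \<noteq> 0" using det_mult[OF R R] by (simp add: SR)
qed

section \<open>Laws of the design and of the errors\<close>

lemma measurable_coordinate:
  assumes "\<And>i. i \<in> I \<Longrightarrow> sets (\<nu> i) = sets borel" "i \<in> I"
  shows "(\<lambda>y. y i) \<in> borel_measurable (PiM I \<nu>)"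
proof -
  have "(\<lambda>y. y i) \<in> measurable (PiM I \<nu>) (\<nu> i)" using assms(2) by (rule measurable_component_singleton)
  then show ?thesis by (simp cong: measurable_cong_sets add: assms)
qed

lemma distr_coordinate:
  assumes "\<And>i. i \<in> I \<Longrightarrow> prob_space (\<nu> i)" "\<And>i. i \<in> I \<Longrightarrow> sets (\<nu> i) = sets borel" "i \<in> I"
  shows "distr (PiM I \<nu>) borel (\<lambda>y. y i) = \<nu> i"
proof -
  have "distr (PiM I \<nu>) borel (\<lambda>y. y i) = distr (PiM I \<nu>) (\<nu> i) (\<lambda>y. y i)"
    by (rule distr_cong) (use assms in auto)
  then show ?thesis using distr_PiM_component[of I \<nu> i] assms by simp
qed

lemma indep_coordinates:
  fixes \<nu> :: "'i \<Rightarrow> real measure"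
  assumes \<nu>: "\<And>i. i \<in> I \<Longrightarrow> prob_space (\<nu> i)" "\<And>i. i \<in> I \<Longrightarrow> sets (\<nu> i) = sets borel" and I: "I \<noteq> {}"
  shows "prob_space.indep_vars (PiM I \<nu>) (\<lambda>_. borel) (\<lambda>i y. y i) I"
proof -
  interpret prob_space "PiM I \<nu>" by (rule prob_space_PiM[OF \<nu>(1)])
  have "distr (PiM I \<nu>) (PiM I (\<lambda>_. borel)) (\<lambda>x. \<lambda>i\<in>I. x i) = distr (PiM I \<nu>) (PiM I \<nu>) (\<lambda>x. x)"
    by (rule distr_cong) (auto simp: \<nu>(2) space_PiM PiE_def extensional_restrict intro!: sets_PiM_cong)
  also have "\<dots> = PiM I (\<lambda>i. distr (PiM I \<nu>) borel (\<lambda>y. y i))"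
    unfolding distr_id by (rule PiM_cong) (simp_all add: distr_coordinate[OF \<nu>])
  finally show ?thesis
    by (subst indep_vars_iff_distr_eq_PiM'[OF I measurable_coordinate[OF \<nu>(2)]]) auto
qed

lemma integral_coordinate:
  fixes f :: "real \<Rightarrow> real"
  assumes \<nu>: "\<And>i. i \<in> I \<Longrightarrow> prob_space (\<nu> i)" "\<And>i. i \<in> I \<Longrightarrow> sets (\<nu> i) = sets borel"
    and i: "i \<in> I" and f: "f \<in> borel_measurable borel"
  shows "(\<integral>y. f (y i) \<partial>PiM I \<nu>) = (\<integral>u. f u \<partial>\<nu> i)"
    "integrable (PiM I \<nu>) (\<lambda>y. f (y i)) \<longleftrightarrow> integrable (\<nu> i) f"
  using integral_distr[OF measurable_coordinate[of I \<nu>, OF \<nu>(2) i] f]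
    integrable_distr_eq[OF measurable_coordinate[of I \<nu>, OF \<nu>(2) i] f] distr_coordinate[of I \<nu>, OF \<nu> i] by auto

lemma standard_indep_PiM:
  fixes \<nu> :: "'i \<Rightarrow> real measure"
  assumes I: "finite I" "I \<noteq> {}"
    and \<nu>: "\<And>i. i \<in> I \<Longrightarrow> prob_space (\<nu> i)" "\<And>i. i \<in> I \<Longrightarrow> sets (\<nu> i) = sets borel"
    and m: "\<And>i. i \<in> I \<Longrightarrow> integrable (\<nu> i) (\<lambda>u. u ^ 4)" "\<And>i. i \<in> I \<Longrightarrow> (\<integral>u. u \<partial>\<nu> i) = 0"
      "\<And>i. i \<in> I \<Longrightarrow> (\<integral>u. u ^ 2 \<partial>\<nu> i) = 1" "\<And>i. i \<in> I \<Longrightarrow> (\<integral>u. u ^ 4 \<partial>\<nu> i) \<le> K"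
    and K: "1 \<le> K"
  shows "standard_indep (PiM I \<nu>) I (\<lambda>i y. y i) K"
proof -
  interpret prob_space "PiM I \<nu>" by (rule prob_space_PiM[OF \<nu>(1)])
  note int = integral_coordinate[of I \<nu>, OF \<nu>]
  show ?thesis
  proof
    show "indep_vars (\<lambda>_. borel) (\<lambda>i y. y i) I" by (rule indep_coordinates[OF \<nu> I(2)])
    fix i assume i: "i \<in> I"
    show "integrable (PiM I \<nu>) (\<lambda>y. y i ^ 4)" using int(2)[OF _ _ i, of "\<lambda>u. u ^ 4"] m(1)[OF i] by simp
    show "(\<integral>y. y i \<partial>PiM I \<nu>) = 0" using int(1)[OF _ _ i, of "\<lambda>u. u"] m(2)[OF i] by simp
    show "(\<integral>y. y i ^ 2 \<partial>PiM I \<nu>) = 1" using int(1)[OF _ _ i, of "\<lambda>u. u ^ 2"] m(3)[OF i] by simp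
    show "(\<integral>y. y i ^ 4 \<partial>PiM I \<nu>) \<le> K" using int(1)[OF _ _ i, of "\<lambda>u. u ^ 4"] m(4)[OF i] by simp
  qed (use I K in auto)
qed

text \<open>Rectangles determine the product measure, and on them the claim is the product rule for
  preimages under \<open>U\<close> and \<open>V\<close>.\<close>

lemma indep_elems_distr:
  assumes M: "prob_space M" and ind: "indep_elems M N1 U N2 V"
    and f: "f \<in> measurable N1 L1" and g: "g \<in> measurable N2 L2"
  shows "distr M (L1 \<Otimes>\<^sub>M L2) (\<lambda>\<omega>. (f (U \<omega>), g (V \<omega>))) =
    distr M L1 (\<lambda>\<omega>. f (U \<omega>)) \<Otimes>\<^sub>M distr M L2 (\<lambda>\<omega>. g (V \<omega>))"
proof -
  interpret prob_space M by (rule M)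
  have UV: "U \<in> measurable M N1" "V \<in> measurable M N2" using ind by (auto simp: indep_elems_def)
  have fU: "(\<lambda>\<omega>. f (U \<omega>)) \<in> measurable M L1" by (rule measurable_compose[OF UV(1) f])
  have gV: "(\<lambda>\<omega>. g (V \<omega>)) \<in> measurable M L2" by (rule measurable_compose[OF UV(2) g])
  show ?thesis
  proof (rule pair_measure_eqI[symmetric])
    show "sigma_finite_measure (distr M L1 (\<lambda>\<omega>. f (U \<omega>)))" "sigma_finite_measure (distr M L2 (\<lambda>\<omega>. g (V \<omega>)))"
      by (intro prob_space_imp_sigma_finite prob_space_distr fU gV)+
    show "sets (distr M L1 (\<lambda>\<omega>. f (U \<omega>)) \<Otimes>\<^sub>M distr M L2 (\<lambda>\<omega>. g (V \<omega>))) =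
        sets (distr M (L1 \<Otimes>\<^sub>M L2) (\<lambda>\<omega>. (f (U \<omega>), g (V \<omega>))))"
      by (simp cong: sets_pair_measure_cong)
    fix A B assume "A \<in> sets (distr M L1 (\<lambda>\<omega>. f (U \<omega>)))" "B \<in> sets (distr M L2 (\<lambda>\<omega>. g (V \<omega>)))"
    then have A: "A \<in> sets L1" and B: "B \<in> sets L2" by auto
    let ?A = "f -` A \<inter> space N1" and ?B = "g -` B \<inter> space N2"
    have AB: "?A \<in> sets N1" "?B \<in> sets N2" using A B f g by (auto intro: measurable_sets)
    have eA: "(\<lambda>\<omega>. f (U \<omega>)) -` A \<inter> space M = U -` ?A \<inter> space M"
      and eB: "(\<lambda>\<omega>. g (V \<omega>)) -` B \<inter> space M = V -` ?B \<inter> space M"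
      using UV by (auto dest: measurable_space)
    have "prob ((U -` ?A \<inter> space M) \<inter> (V -` ?B \<inter> space M)) = prob (U -` ?A \<inter> space M) * prob (V -` ?B \<inter> space M)"
    proof (rule indep_setD)
      show "indep_set {U -` A \<inter> space M |A. A \<in> sets N1} {V -` B \<inter> space M |B. B \<in> sets N2}"
        using ind by (simp add: indep_elems_def)
      show "U -` ?A \<inter> space M \<in> {U -` A \<inter> space M |A. A \<in> sets N1}" using AB(1) by blast
      show "V -` ?B \<inter> space M \<in> {V -` B \<inter> space M |B. B \<in> sets N2}" using AB(2) by blast
    qed
    moreover have "(\<lambda>\<omega>. (f (U \<omega>), g (V \<omega>))) -` (A \<times> B) \<inter> space M = (U -` ?A \<inter> space M) \<inter> (V -` ?B \<inter> space M)"
      using UV by (auto dest: measurable_space)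
    ultimately show "emeasure (distr M L1 (\<lambda>\<omega>. f (U \<omega>))) A * emeasure (distr M L2 (\<lambda>\<omega>. g (V \<omega>))) B =
        emeasure (distr M (L1 \<Otimes>\<^sub>M L2) (\<lambda>\<omega>. (f (U \<omega>), g (V \<omega>)))) (A \<times> B)"
      using A B fU gV
      by (simp add: emeasure_distr eA eB emeasure_eq_measure ennreal_mult)
  qed
qed

section \<open>From independent rows to independent columns\<close>

context prob_space
begin

text \<open>The model gives independence in two layers, between rows and within each row. A box in
  all entries is an intersection of row boxes, so its probability factors twice.\<close>

lemma indep_vars_pairs:
  fixes Z :: "nat \<Rightarrow> nat \<Rightarrow> 'a \<Rightarrow> real"
  assumes nd: "0 < n" "0 < d"
    and rows: "indep_vars (\<lambda>_. PiM {..<d} (\<lambda>_. borel)) (\<lambda>i \<omega>. \<lambda>j\<in>{..<d}. Z i j \<omega>) {..<n}"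
    and row: "\<And>i. i < n \<Longrightarrow> indep_vars (\<lambda>_. borel) (Z i) {..<d}"
  shows "indep_vars (\<lambda>_. borel) (\<lambda>(i, j). Z i j) ({..<n} \<times> {..<d})"
proof -
  have rv: "random_variable borel (Z i j)" if "i < n" "j < d" for i j
    using row[OF that(1)] that(2) by (auto simp: indep_vars_def)
  show ?thesis
  proof (subst indep_vars_finite[where E = "\<lambda>_. sets borel"])
    show "\<forall>A\<in>{..<n} \<times> {..<d} \<rightarrow> sets borel.
       prob (\<Inter>j\<in>{..<n} \<times> {..<d}. (case j of (i, j) \<Rightarrow> Z i j) -` A j \<inter> space M) =
       (\<Prod>j\<in>{..<n} \<times> {..<d}. prob ((case j of (i, j) \<Rightarrow> Z i j) -` A j \<inter> space M))"
    proof
      fix A :: "nat \<times> nat \<Rightarrow> real set" assume A: "A \<in> {..<n} \<times> {..<d} \<rightarrow> sets borel"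
      let ?T = "\<lambda>i \<omega>. \<lambda>j\<in>{..<d}. Z i j \<omega>" and ?B = "\<lambda>i. PiE {..<d} (\<lambda>j. A (i, j))"
      have B: "?B i \<in> sets (PiM {..<d} (\<lambda>_. borel))" if "i < n" for i
        using A that by (intro sets_PiM_I_finite) auto
      have T: "?T i -` ?B i \<inter> space M = (\<Inter>j\<in>{..<d}. Z i j -` A (i, j) \<inter> space M)" for i
        using nd(2) by (auto simp: PiE_iff)
      have "(\<Inter>j\<in>{..<n} \<times> {..<d}. (case j of (i, j) \<Rightarrow> Z i j) -` A j \<inter> space M)
          = (\<Inter>i\<in>{..<n}. ?T i -` ?B i \<inter> space M)"
        unfolding T by auto
      then have "prob (\<Inter>j\<in>{..<n} \<times> {..<d}. (case j of (i, j) \<Rightarrow> Z i j) -` A j \<inter> space M)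
          = (\<Prod>i\<in>{..<n}. prob (?T i -` ?B i \<inter> space M))"
        using indep_varsD_finite[OF rows, of ?B] B nd by auto
      also have "\<dots> = (\<Prod>i\<in>{..<n}. \<Prod>j\<in>{..<d}. prob (Z i j -` A (i, j) \<inter> space M))"
      proof (rule prod.cong[OF refl])
        fix i assume i: "i \<in> {..<n}"
        have "A (i, j) \<in> sets borel" if "j \<in> {..<d}" for j using A i that by auto
        then show "prob (?T i -` ?B i \<inter> space M) = (\<Prod>j\<in>{..<d}. prob (Z i j -` A (i, j) \<inter> space M))"
          unfolding T using i nd by (intro indep_varsD_finite[OF row, of i "\<lambda>j. A (i, j)"]) auto
      qed
      finally show "prob (\<Inter>j\<in>{..<n} \<times> {..<d}. (case j of (i, j) \<Rightarrow> Z i j) -` A j \<inter> space M) =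
         (\<Prod>j\<in>{..<n} \<times> {..<d}. prob ((case j of (i, j) \<Rightarrow> Z i j) -` A j \<inter> space M))"
        by (simp add: prod.cartesian_product case_prod_unfold)
    qed
    show "random_variable borel (case k of (i, j) \<Rightarrow> Z i j)" if "k \<in> {..<n} \<times> {..<d}" for k
      using that rv by auto
    show "sets borel = sigma_sets (space borel) (sets (borel :: real measure))"
      by (rule sets.sigma_sets_eq[symmetric])
    show "Int_stable (sets (borel :: real measure))" by (rule sets.Int_stable)
    show "space (borel :: real measure) \<in> sets borel" by simp
    show "sets (borel :: real measure) \<subseteq> Pow (space borel)" by simp
    show "{..<n} \<times> {..<d} \<noteq> {}" using nd by auto
  qed simp
qed

text \<open>Deflation consumes the design by columns, whereas the model supplies it by rows; joint
  independence of all entries permits the regrouping.\<close>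

lemma distr_columns:
  fixes Z :: "nat \<Rightarrow> nat \<Rightarrow> 'a \<Rightarrow> real"
  assumes nd: "0 < n" "0 < d"
    and ind: "indep_vars (\<lambda>_. borel) (\<lambda>(i, j). Z i j) ({..<n} \<times> {..<d})"
  shows "distr M (PiM {..<d} (\<lambda>_. PiM {..<n} (\<lambda>_. borel))) (\<lambda>\<omega>. \<lambda>j\<in>{..<d}. \<lambda>i\<in>{..<n}. Z i j \<omega>)
    = PiM {..<d} (\<lambda>j. PiM {..<n} (\<lambda>i. distr M borel (Z i j)))"
proof -
  have rv: "random_variable borel (Z i j)" if "i < n" "j < d" for i j
    using ind that by (auto simp: indep_vars_def)
  let ?Kj = "\<lambda>j. {..<n} \<times> {j}"
  have "indep_vars (\<lambda>j. PiM (?Kj j) (\<lambda>_. borel)) (\<lambda>j \<omega>. restrict (\<lambda>k. (case k of (i, j) \<Rightarrow> Z i j) \<omega>) (?Kj j)) {..<d}"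
    by (rule indep_vars_restrict[OF ind]) (auto simp: disjoint_family_on_def)
  then have "indep_vars (\<lambda>_. PiM {..<n} (\<lambda>_. borel))
      (\<lambda>j \<omega>. (\<lambda>f. \<lambda>i\<in>{..<n}. f (i, j)) (restrict (\<lambda>k. (case k of (i, j) \<Rightarrow> Z i j) \<omega>) (?Kj j))) {..<d}"
  proof (rule indep_vars_compose2)
    fix j assume "j \<in> {..<d}"
    show "(\<lambda>f. \<lambda>i\<in>{..<n}. f (i, j)) \<in> measurable (PiM (?Kj j) (\<lambda>_. borel)) (PiM {..<n} (\<lambda>_. borel))"
      by (intro measurable_restrict measurable_component_singleton) auto
  qed
  also have "(\<lambda>j \<omega>. (\<lambda>f. \<lambda>i\<in>{..<n}. f (i, j)) (restrict (\<lambda>k. (case k of (i, j) \<Rightarrow> Z i j) \<omega>) (?Kj j)))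
      = (\<lambda>j \<omega>. \<lambda>i\<in>{..<n}. Z i j \<omega>)"
    by (auto simp: fun_eq_iff)
  finally have cols: "indep_vars (\<lambda>_. PiM {..<n} (\<lambda>_. borel)) (\<lambda>j \<omega>. \<lambda>i\<in>{..<n}. Z i j \<omega>) {..<d}" .
  have col: "distr M (PiM {..<n} (\<lambda>_. borel)) (\<lambda>\<omega>. \<lambda>i\<in>{..<n}. Z i j \<omega>) = PiM {..<n} (\<lambda>i. distr M borel (Z i j))"
    if j: "j < d" for j
  proof -
    have sub: "indep_vars (\<lambda>_. borel) (\<lambda>(i, j). Z i j) (?Kj j)"
      by (rule indep_vars_subset[OF ind]) (use j in auto)
    have "indep_vars (\<lambda>_. borel) (\<lambda>i. Z i j) {..<n}"
    proof (subst indep_vars_finite[where E = "\<lambda>_. sets borel"])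
      show "\<forall>A\<in>{..<n} \<rightarrow> sets borel. prob (\<Inter>i\<in>{..<n}. Z i j -` A i \<inter> space M) =
          (\<Prod>i\<in>{..<n}. prob (Z i j -` A i \<inter> space M))"
      proof
        fix A :: "nat \<Rightarrow> real set" assume A: "A \<in> {..<n} \<rightarrow> sets borel"
        have "prob (\<Inter>k\<in>?Kj j. (case k of (i, j) \<Rightarrow> Z i j) -` A (fst k) \<inter> space M) =
          (\<Prod>k\<in>?Kj j. prob ((case k of (i, j) \<Rightarrow> Z i j) -` A (fst k) \<inter> space M))"
          by (rule indep_varsD_finite[OF sub]) (use A nd in auto)
        moreover have "(\<Inter>k\<in>?Kj j. (case k of (i, j) \<Rightarrow> Z i j) -` A (fst k) \<inter> space M) =
            (\<Inter>i\<in>{..<n}. Z i j -` A i \<inter> space M)" by auto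
        moreover have "(\<Prod>k\<in>?Kj j. prob ((case k of (i, j) \<Rightarrow> Z i j) -` A (fst k) \<inter> space M)) =
            (\<Prod>i\<in>{..<n}. prob (Z i j -` A i \<inter> space M))"
          by (rule prod.reindex_bij_witness[where i = "\<lambda>i. (i, j)" and j = fst]) auto
        ultimately show "prob (\<Inter>i\<in>{..<n}. Z i j -` A i \<inter> space M) =
          (\<Prod>i\<in>{..<n}. prob (Z i j -` A i \<inter> space M))" by simp
      qed
      show "random_variable borel (Z i j)" if "i \<in> {..<n}" for i using that j rv by auto
      show "sets borel = sigma_sets (space borel) (sets (borel :: real measure))"
        by (rule sets.sigma_sets_eq[symmetric])
      show "Int_stable (sets (borel :: real measure))" by (rule sets.Int_stable)
      show "{..<n} \<noteq> {}" using nd by auto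
    qed auto
    then show ?thesis
      using rv j nd by (subst (asm) indep_vars_iff_distr_eq_PiM') auto
  qed
  have "distr M (PiM {..<d} (\<lambda>_. PiM {..<n} (\<lambda>_. borel))) (\<lambda>\<omega>. \<lambda>j\<in>{..<d}. \<lambda>i\<in>{..<n}. Z i j \<omega>)
      = PiM {..<d} (\<lambda>j. distr M (PiM {..<n} (\<lambda>_. borel)) (\<lambda>\<omega>. \<lambda>i\<in>{..<n}. Z i j \<omega>))"
  proof -
    have "random_variable (PiM {..<n} (\<lambda>_. borel)) (\<lambda>\<omega>. \<lambda>i\<in>{..<n}. Z i j \<omega>)" if "j \<in> {..<d}" for j
      using that rv by (intro measurable_restrict) auto
    then show ?thesis using cols nd by (subst (asm) indep_vars_iff_distr_eq_PiM') auto
  qed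
  also have "\<dots> = PiM {..<d} (\<lambda>j. PiM {..<n} (\<lambda>i. distr M borel (Z i j)))"
    by (rule PiM_cong) (auto simp: col)
  finally show ?thesis .
qed

end

section \<open>Fourth moments from sub-Gaussian tails\<close>

definition subgauss_const :: "real \<Rightarrow> real" where
  "subgauss_const c = (\<Sum>k. (real k + 1) ^ 4 * (2 * exp (- c * (real k)\<^sup>2)))"

lemma subgauss_summable:
  assumes "0 < c" shows "summable (\<lambda>k. (real k + 1) ^ 4 * (2 * exp (- c * (real k)\<^sup>2)))"
proof (rule summable_comparison_test_bigo)
  show "summable (\<lambda>k. norm (1 / real k ^ 2))" using inverse_power_summable[of 2] by (simp add: inverse_eq_divide)
  show "(\<lambda>k. (real k + 1) ^ 4 * (2 * exp (- c * (real k)\<^sup>2))) \<in> O(\<lambda>k. 1 / real k ^ 2)"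
    using assms by real_asymp
qed

text \<open>If the integer part of the absolute value is \<open>k\<close>, the fourth power is at
  most \<open>(k + 1) ^ 4\<close> and the tail event at \<open>k\<close> has occurred. Summing over
  \<open>k\<close> yields a bound that depends on \<open>c\<close> alone.\<close>

lemma (in prob_space) subgauss_fourth_moment:
  assumes Z[measurable]: "Z \<in> borel_measurable M" and c: "0 < c"
    and tail: "\<And>t. 0 < t \<Longrightarrow> prob {\<omega> \<in> space M. \<bar>Z \<omega>\<bar> \<ge> t} \<le> 2 * exp (- c * t\<^sup>2)"
  shows "integrable M (\<lambda>\<omega>. Z \<omega> ^ 4)" "expectation (\<lambda>\<omega>. Z \<omega> ^ 4) \<le> subgauss_const c"
proof -
  let ?a = "\<lambda>k. (real k + 1) ^ 4" and ?A = "\<lambda>k. {\<omega> \<in> space M. \<bar>Z \<omega>\<bar> \<ge> real k}"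
  have prob_le: "prob (?A k) \<le> 2 * exp (- c * (real k)\<^sup>2)" for k
  \<comment> \<open>The tail bound is for positive arguments only; at 0 its right-hand side would be
    2, more than any probability.\<close>
  proof (cases "k = 0")
    case True
    then show ?thesis by (simp add: prob_space)
  next
    case False
    then show ?thesis using tail[of "real k"] by simp
  qed
  have "(\<integral>\<^sup>+\<omega>. ennreal (Z \<omega> ^ 4) \<partial>M) \<le> (\<integral>\<^sup>+\<omega>. (\<Sum>k. ennreal (?a k) * indicator (?A k) \<omega>) \<partial>M)"
  proof (rule nn_integral_mono)
    fix \<omega> assume \<omega>: "\<omega> \<in> space M"
    define k where "k = nat \<lfloor>\<bar>Z \<omega>\<bar>\<rfloor>"
    have k: "real k \<le> \<bar>Z \<omega>\<bar>" "\<bar>Z \<omega>\<bar> \<le> real k + 1" by (auto simp: k_def)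
    have "Z \<omega> ^ 4 = \<bar>Z \<omega>\<bar> ^ 4" by simp
    also have "\<dots> \<le> ?a k" using k by (intro power_mono) auto
    finally have "ennreal (Z \<omega> ^ 4) \<le> ennreal (?a k) * indicator (?A k) \<omega>"
      using k \<omega> by (simp add: ennreal_leI)
    also have "\<dots> = (\<Sum>i\<in>{k}. ennreal (?a i) * indicator (?A i) \<omega>)"
      by (simp only: sum.insert finite.emptyI empty_iff not_False_eq_True sum.empty add_0_right)
    also have "\<dots> \<le> (\<Sum>i. ennreal (?a i) * indicator (?A i) \<omega>)"
      by (rule sum_le_suminf) auto
    finally show "ennreal (Z \<omega> ^ 4) \<le> (\<Sum>k. ennreal (?a k) * indicator (?A k) \<omega>)" .
  qed
  also have "\<dots> = (\<Sum>k. \<integral>\<^sup>+\<omega>. ennreal (?a k) * indicator (?A k) \<omega> \<partial>M)"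
    by (rule nn_integral_suminf) measurable
  also have "\<dots> = (\<Sum>k. ennreal (?a k * prob (?A k)))"
    by (intro suminf_cong) (simp add: nn_integral_cmult_indicator emeasure_eq_measure ennreal_mult)
  also have "\<dots> \<le> (\<Sum>k. ennreal (?a k * (2 * exp (- c * (real k)\<^sup>2))))"
    by (intro suminf_le ennreal_leI mult_left_mono prob_le) auto
  also have "\<dots> = ennreal (subgauss_const c)"
    unfolding subgauss_const_def by (intro suminf_ennreal2 subgauss_summable[OF c]) auto
  finally have le: "(\<integral>\<^sup>+\<omega>. ennreal (Z \<omega> ^ 4) \<partial>M) \<le> ennreal (subgauss_const c)" .
  have K0: "0 \<le> subgauss_const c"
    unfolding subgauss_const_def by (intro suminf_nonneg subgauss_summable[OF c]) auto
  show int: "integrable M (\<lambda>\<omega>. Z \<omega> ^ 4)"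
  proof (rule integrableI_nonneg)
    show "(\<integral>\<^sup>+\<omega>. ennreal (Z \<omega> ^ 4) \<partial>M) < \<infinity>" by (rule le_less_trans[OF le]) simp
  qed auto
  show "expectation (\<lambda>\<omega>. Z \<omega> ^ 4) \<le> subgauss_const c"
    using le K0 by (subst (asm) nn_integral_eq_integral[OF int]) auto
qed

section \<open>Residual sum of squares on the product space\<close>

lemma exp_minus_diff_le:
  fixes a b :: real assumes "0 \<le> a" "0 \<le> b" shows "\<bar>exp (- a) - exp (- b)\<bar> \<le> \<bar>a - b\<bar>"
proof -
  have *: "exp (- a) - exp (- b) \<le> b - a" if "0 \<le> a" "a \<le> b" for a b :: real
  proof -
    have "exp (- a) - exp (- b) = exp (- a) * (1 - exp (- (b - a)))"
      by (simp add: right_diff_distrib exp_add[symmetric])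
    also have "\<dots> \<le> 1 * (1 - exp (- (b - a)))" using that by (intro mult_right_mono) auto
    also have "\<dots> \<le> b - a"
    proof -
      obtain w where w: "w = exp (- (b - a))" by blast
      have "1 + - (b - a) \<le> w" unfolding w by (rule exp_ge_add_one_self)
      then show ?thesis unfolding w[symmetric] by (simp add: algebra_simps)
    qed
    finally show ?thesis .
  qed
  show ?thesis
  proof (cases "a \<le> b")
    case True
    then show ?thesis using *[of a b] assms by simp
  next
    case False
    then show ?thesis using *[of b a] assms by simp
  qed
qed

text \<open>On regular designs this makes \<open>sumsq_diag\<close> minus its target nonnegative, so
  an upper bound on the mean controls the mean absolute deviation.\<close>

lemma trc_square_le:
  assumes "finite I" shows "(trc I Q)\<^sup>2 \<le> card I * sumsq_diag I Q"
  using Cauchy_Schwarz_ineq_sum[of "\<lambda>_. 1" "\<lambda>i. Q i i" I] by (simp add: trc_def sumsq_diag_def)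

text \<open>Errors and design are placed on one canonical product space. The locale of the normal
  approximation is required for every projection because the design supplies a random one.\<close>

locale quadratic_sample = random_columns "{..<n}" \<nu> d K
  for n :: nat and \<nu> :: "nat \<Rightarrow> nat \<Rightarrow> real measure" and d :: nat and K :: real +
  fixes \<mu> :: "real measure" and \<kappa> \<gamma> :: real
  assumes prob_\<mu>: "prob_space \<mu>" and sets_\<mu>: "sets \<mu> = sets borel"
    and clt: "\<And>Q. is_proj {..<n} Q \<Longrightarrow> quadratic_clt (PiM {..<n} (\<lambda>_. \<mu>)) {..<n} (\<lambda>i y. y i) K Q \<kappa> \<gamma>"
begin

abbreviation "errors \<equiv> PiM {..<n} (\<lambda>_. \<mu>)"
abbreviation "joint \<equiv> errors \<Otimes>\<^sub>M design d"
abbreviation "rss e z \<equiv> ssq {..<n} (app {..<n} (resid_proj {..<n} d z) e)"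
abbreviation "dof \<equiv> real n - real d"
definition sing_prob :: real where
  "sing_prob = (\<integral>z. of_bool (singular {..<n} d z) \<partial>design d)"

lemma dof_pos: "1 \<le> dof" "0 < dof" using p_less by auto

lemma prob_errors: "prob_space errors" by (intro prob_space_PiM prob_\<mu>)

lemma prob_joint: "prob_space joint"
proof -
  interpret E: prob_space errors by (rule prob_errors)
  interpret D: prob_space "design d" by (rule prob_design)
  interpret P: pair_prob_space errors "design d" ..
  show ?thesis by (intro prob_spaceI P.emeasure_space_1)
qed

lemma rss_measurable: "(\<lambda>(e, z). rss e z) \<in> borel_measurable joint"
proof -
  have [measurable]: "(\<lambda>w. resid_proj {..<n} d (snd w) i j) \<in> borel_measurable joint" for i j
    by (rule measurable_compose[OF measurable_snd resid_measurable]) simp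
  have [measurable]: "i \<in> {..<n} \<Longrightarrow> (\<lambda>w. fst w i) \<in> borel_measurable joint" for i
    by (rule measurable_compose[OF measurable_fst measurable_coordinate]) (auto simp: sets_\<mu>)
  show ?thesis unfolding case_prod_unfold ssq_def app_def by measurable
qed

lemma sing_measurable_joint: "(\<lambda>w. of_bool (singular {..<n} d (snd w)) :: real) \<in> borel_measurable joint"
  by (rule measurable_compose[OF measurable_snd singular_measurable]) simp

lemma sing_pred_joint: "Measurable.pred joint (\<lambda>w. singular {..<n} d (snd w))"
proof -
  have "Measurable.pred joint (\<lambda>w. of_bool (singular {..<n} d (snd w)) = (1 :: real))"
    using sing_measurable_joint by measurable
  then show ?thesis by simp
qed

lemma rss_eq_qf:
  assumes "\<not> singular {..<n} d z"
  shows "rss e z - dof = quadratic_clt.qf {..<n} (\<lambda>i y. y i) (resid_proj {..<n} d z) e"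
    "trc {..<n} (resid_proj {..<n} d z) = dof"
proof -
  let ?Q = "resid_proj {..<n} d z"
  have Q: "is_proj {..<n} ?Q" by (rule is_proj_resid) simp
  interpret C: quadratic_clt errors "{..<n}" "\<lambda>i y. y i" K ?Q \<kappa> \<gamma> by (rule clt[OF Q])
  show tr: "trc {..<n} ?Q = dof" using trc_resid[of "{..<n}" d z] assms by simp
  show "rss e z - dof = C.qf e"
    unfolding C.qf_def tr ssq_app[OF Q] by (simp add: app_def sum_distrib_left ac_simps)
qed

lemma sing_prob_bounds: "0 \<le> sing_prob" "sing_prob \<le> real d * rho K ^ (n - d)"
proof -
  show "0 \<le> sing_prob" unfolding sing_prob_def by (intro Bochner_Integration.integral_nonneg) auto
  have "sing_prob \<le> (\<Sum>j<d. rho K ^ (n - j))"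
    using expected_singular_le[of d] by (simp add: sing_prob_def)
  also have "\<dots> \<le> (\<Sum>j<d. rho K ^ (n - d))"
    using rho_bounds[OF K_ge_1] by (intro sum_mono power_decreasing) auto
  finally show "sing_prob \<le> real d * rho K ^ (n - d)" by simp
qed

lemma sing_integrable: "integrable (design d) (\<lambda>z. of_bool (singular {..<n} d z) :: real)"
  by (rule integrable_bounded[where c = 1]) (auto intro: singular_measurable)

lemma integral_joint:
  fixes f :: "(nat \<Rightarrow> real) \<Rightarrow> (nat \<Rightarrow> nat \<Rightarrow> real) \<Rightarrow> 'b::{banach, second_countable_topology}"
  assumes "case_prod f \<in> borel_measurable joint" "\<And>e z. norm (f e z) \<le> B"
  shows "(\<integral>w. case_prod f w \<partial>joint) = (\<integral>z. (\<integral>e. f e z \<partial>errors) \<partial>design d)"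
proof -
  interpret E: prob_space errors by (rule prob_errors)
  interpret D: prob_space "design d" by (rule prob_design)
  interpret P: pair_prob_space errors "design d" ..
  have "integrable joint (case_prod f)"
    by (rule P.integrable_const_bound[of _ B]) (use assms in auto)
  then show ?thesis by (rule P.integral_snd[symmetric])
qed

lemma sing_prob_joint: "(\<integral>w. of_bool (singular {..<n} d (snd w)) \<partial>joint) = sing_prob"
proof -
  interpret E: prob_space errors by (rule prob_errors)
  show ?thesis
    using integral_joint[of "\<lambda>e z. of_bool (singular {..<n} d z) :: real" 1] sing_measurable_joint
    by (simp add: case_prod_unfold sing_prob_def E.prob_space)
qed

text \<open>Chebyshev's inequality conditionally on the design: for a regular design the second
  moment of the centred form is at most \<open>(K + 2) * dof\<close>.\<close>

lemma deviation_joint: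
  assumes c: "0 < c"
  shows "(\<integral>w. of_bool (\<not> singular {..<n} d (snd w) \<and> c < \<bar>rss (fst w) (snd w) - dof\<bar>) \<partial>joint) \<le> (K + 2) * dof / c\<^sup>2"
proof -
  interpret E: prob_space errors by (rule prob_errors)
  interpret D: prob_space "design d" by (rule prob_design)
  let ?f = "\<lambda>e z. of_bool (\<not> singular {..<n} d z \<and> c < \<bar>rss e z - dof\<bar>) :: real"
  have m: "case_prod ?f \<in> borel_measurable joint"
  proof -
    have [measurable]: "Measurable.pred joint (\<lambda>w. singular {..<n} d (snd w))" by (rule sing_pred_joint)
    have [measurable]: "(\<lambda>w. rss (fst w) (snd w)) \<in> borel_measurable joint"
      using rss_measurable by (simp add: case_prod_unfold)
    show ?thesis unfolding case_prod_unfold by measurable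
  qed
  have inner: "(\<integral>e. ?f e z \<partial>errors) \<le> (K + 2) * dof / c\<^sup>2" for z
  proof (cases "singular {..<n} d z")
    case True
    then show ?thesis using K_ge_1 dof_pos by simp
  next
    case False
    let ?Q = "resid_proj {..<n} d z"
    have Q: "is_proj {..<n} ?Q" by (rule is_proj_resid) simp
    interpret C: quadratic_clt errors "{..<n}" "\<lambda>i y. y i" K ?Q \<kappa> \<gamma> by (rule clt[OF Q])
    have i: "integrable errors (\<lambda>e. (C.qf e)\<^sup>2 / c\<^sup>2)" using C.qf_square(1) by simp
    have "norm (\<integral>e. ?f e z \<partial>errors) \<le> (\<integral>e. (C.qf e)\<^sup>2 / c\<^sup>2 \<partial>errors)"
    proof (rule norm_integral_le[OF i])
      fix e
      show "norm (?f e z) \<le> (C.qf e)\<^sup>2 / c\<^sup>2"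
      proof (cases "c < \<bar>C.qf e\<bar>")
        case True
        then have "c\<^sup>2 \<le> (C.qf e)\<^sup>2" using c by (simp add: abs_le_square_iff[symmetric])
        then show ?thesis using c by simp
      next
        case False
        then show ?thesis using rss_eq_qf(1)[OF \<open>\<not> singular {..<n} d z\<close>] by simp
      qed
    qed
    also have "\<dots> \<le> (K + 2) * dof / c\<^sup>2"
      using C.qf_square(2) rss_eq_qf(2)[OF False] by (simp add: divide_right_mono)
    finally show ?thesis by simp
  qed
  have "(\<integral>w. case_prod ?f w \<partial>joint) = (\<integral>z. (\<integral>e. ?f e z \<partial>errors) \<partial>design d)"
    by (rule integral_joint[OF m, of 1]) simp
  also have "\<dots> \<le> (\<integral>z. (K + 2) * dof / c\<^sup>2 \<partial>design d)"
  proof -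
    have "0 \<le> (\<integral>e. ?f e z \<partial>errors)" for z by (intro Bochner_Integration.integral_nonneg) auto
    then have "norm (\<integral>z. (\<integral>e. ?f e z \<partial>errors) \<partial>design d) \<le> (\<integral>z. (K + 2) * dof / c\<^sup>2 \<partial>design d)"
      using inner by (intro norm_integral_le) auto
    then show ?thesis by simp
  qed
  finally show ?thesis using D.prob_space by (simp add: case_prod_unfold)
qed

text \<open>\<open>expected_sumsq_diag_le\<close> with every summand replaced by the largest. The
  last term accounts for the singular event, on which \<open>dof\<^sup>2 / n\<close> must not be
  subtracted.\<close>

lemma diag_fluctuation:
  "(\<integral>z. of_bool (\<not> singular {..<n} d z) * (sumsq_diag {..<n} (resid_proj {..<n} d z) - dof\<^sup>2 / n) \<partial>design d)
     \<le> real d * step_const K / sqrt dof + dof\<^sup>2 / n * sing_prob"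
  "integrable (design d) (\<lambda>z. of_bool (\<not> singular {..<n} d z) * (sumsq_diag {..<n} (resid_proj {..<n} d z) - dof\<^sup>2 / n))"
proof -
  interpret D: prob_space "design d" by (rule prob_design)
  let ?b = "\<lambda>z. of_bool (singular {..<n} d z) :: real" and ?s = "\<lambda>z. sumsq_diag {..<n} (resid_proj {..<n} d z)"
  have split: "of_bool (\<not> singular {..<n} d z) * (?s z - dof\<^sup>2 / n) =
      of_bool (\<not> singular {..<n} d z) * ?s z - dof\<^sup>2 / n + dof\<^sup>2 / n * ?b z" for z
    by (simp add: of_bool_not_iff algebra_simps)
  have i1: "integrable (design d) (\<lambda>z. of_bool (\<not> singular {..<n} d z) * ?s z)"
  proof (rule integrable_bounded)
    show "(\<lambda>z. of_bool (\<not> singular {..<n} d z) * ?s z) \<in> borel_measurable (design d)"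
      using sumsq_measurable[of d d] singular_measurable[of d d] by (simp add: of_bool_not_iff)
    show "0 \<le> of_bool (\<not> singular {..<n} d z) * ?s z" "of_bool (\<not> singular {..<n} d z) * ?s z \<le> n" for z
      using sumsq_diag_bounds[OF is_proj_resid, of "{..<n}" d z] by auto
  qed
  show "integrable (design d) (\<lambda>z. of_bool (\<not> singular {..<n} d z) * (?s z - dof\<^sup>2 / n))"
    unfolding split using i1 sing_integrable by simp
  have "(\<Sum>j<d. step_const K / sqrt (real n - real j)) \<le> (\<Sum>j<d. step_const K / sqrt dof)"
    using K_ge_1 dof_pos by (intro sum_mono divide_left_mono) (auto simp: step_const_def)
  then have "(\<integral>z. of_bool (\<not> singular {..<n} d z) * ?s z \<partial>design d) \<le> dof\<^sup>2 / n + real d * step_const K / sqrt dof"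
    using expected_sumsq_diag_le[of d] by simp
  then show "(\<integral>z. of_bool (\<not> singular {..<n} d z) * (?s z - dof\<^sup>2 / n) \<partial>design d)
     \<le> real d * step_const K / sqrt dof + dof\<^sup>2 / n * sing_prob"
    unfolding split using i1 sing_integrable D.prob_space by (simp add: sing_prob_def)
qed

text \<open>The first line is \<open>charfun_bound\<close> at \<open>t * c\<close>. The rest bounds
  the distance of \<open>c\<^sup>2 * vr\<close> from 1: first the fluctuation of the diagonal, with
  \<open>K + 2\<close> dominating \<open>\<bar>\<kappa> - 3\<bar>\<close>, then the mismatch at the
  ideal diagonal \<open>dof\<^sup>2 / n\<close>.\<close>

definition "charfun_error c t =
   \<bar>t * c\<bar> * ((t * c)\<^sup>2 * (n * clt_c1 K) + \<bar>t * c\<bar> * (clt_c2 K * sqrt n))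
   + t\<^sup>2 / 2 * (c\<^sup>2 * (K + 2) * (real d * step_const K / sqrt dof + dof\<^sup>2 / n * sing_prob)
        + \<bar>c\<^sup>2 * ((\<kappa> - 3) * dof\<^sup>2 / n + 2 * dof) - 1\<bar>)"

text \<open>Given a regular design, the characteristic function is compared with the Gaussian one of
  the conditional variance, and that one with the standard one by \<open>exp_minus_diff_le\<close>.
  On singular designs the trivial bound 2 is used.\<close>

lemma charfun_joint:
  "norm ((\<integral>w. iexp (t * (c * (rss (fst w) (snd w) - dof))) \<partial>joint) - complex_of_real (exp (- (t\<^sup>2 / 2))))
     \<le> charfun_error c t + 2 * sing_prob"
proof -
  interpret E: prob_space errors by (rule prob_errors)
  interpret D: prob_space "design d" by (rule prob_design)
  let ?g = "complex_of_real (exp (- (t\<^sup>2 / 2)))"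
  let ?f = "\<lambda>e z. iexp (t * (c * (rss e z - dof))) - ?g"
  let ?s = "\<lambda>z. sumsq_diag {..<n} (resid_proj {..<n} d z)"
  let ?lo = "dof\<^sup>2 / n" and ?r = "c\<^sup>2 * ((\<kappa> - 3) * dof\<^sup>2 / n + 2 * dof) - 1"
  let ?B = "\<bar>t * c\<bar> * ((t * c)\<^sup>2 * (n * clt_c1 K) + \<bar>t * c\<bar> * (clt_c2 K * sqrt n))"
  let ?h = "\<lambda>z. ?B + t\<^sup>2 / 2 * (c\<^sup>2 * (K + 2) * (of_bool (\<not> singular {..<n} d z) * (?s z - ?lo)) + \<bar>?r\<bar>)
      + 2 * of_bool (singular {..<n} d z)"
  have n0: "0 < real n" using p_less by simp
  have B0: "0 \<le> ?B" using K_ge_1 by (simp add: clt_c1_def clt_c2_def)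
  have m: "case_prod ?f \<in> borel_measurable joint"
  proof -
    have [measurable]: "(\<lambda>w. rss (fst w) (snd w)) \<in> borel_measurable joint"
      using rss_measurable by (simp add: case_prod_unfold)
    show ?thesis unfolding case_prod_unfold by measurable
  qed
  have nf: "norm (?f e z) \<le> 2" for e z
    by (rule order_trans[OF norm_triangle_ineq4]) simp
  have sM: "(\<lambda>e. rss e z) \<in> borel_measurable errors" for z
  proof -
    have [measurable]: "i \<in> {..<n} \<Longrightarrow> (\<lambda>e. e i) \<in> borel_measurable errors" for i
      by (rule measurable_coordinate) (auto simp: sets_\<mu>)
    show ?thesis unfolding ssq_def app_def by measurable
  qed
  have inner: "norm (\<integral>e. ?f e z \<partial>errors) \<le> ?h z" for z
  proof (cases "singular {..<n} d z")
    case True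
    have "norm (\<integral>e. ?f e z \<partial>errors) \<le> (\<integral>e. 2 \<partial>errors)"
      by (rule norm_integral_le) (use nf in auto)
    then have "norm (\<integral>e. ?f e z \<partial>errors) \<le> 2" using E.prob_space by simp
    moreover have "0 \<le> t\<^sup>2 / 2 * \<bar>?r\<bar>" by simp
    ultimately have "norm (\<integral>e. ?f e z \<partial>errors) \<le> ?B + t\<^sup>2 / 2 * \<bar>?r\<bar> + 2" using B0 by linarith
    then show ?thesis using True by (simp only: of_bool_eq mult_zero_left mult_zero_right add_0_left mult_1_right not_True_eq_False)
  next
    case False
    let ?Q = "resid_proj {..<n} d z"
    have Q: "is_proj {..<n} ?Q" by (rule is_proj_resid) simp
    interpret C: quadratic_clt errors "{..<n}" "\<lambda>i y. y i" K ?Q \<kappa> \<gamma> by (rule clt[OF Q])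
    note q = rss_eq_qf[OF False]
    have vr: "C.vr = (\<kappa> - 3) * ?s z + 2 * dof"
      unfolding C.vr_def q(2) sumsq_diag_def ..
    have s_ge: "?lo \<le> ?s z"
      using trc_square_le[of "{..<n}" ?Q] n0 unfolding q(2) by (simp add: divide_le_eq mult.commute)
    have kap: "\<bar>\<kappa> - 3\<bar> \<le> K + 2" using C.kappa_bound[of 0] K_ge_1 n0 by auto
    define f where "f = (\<integral>e. iexp ((t * c) * C.qf e) \<partial>errors)"
    define h where "h = complex_of_real (exp (- C.vr * (t * c)\<^sup>2 / 2))"
    have cb: "norm (f - h) \<le> ?B"
      unfolding f_def h_def using C.charfun_bound[of "t * c"] by (simp only: card_lessThan)
    have ed: "norm (h - ?g) \<le> t\<^sup>2 / 2 * (c\<^sup>2 * (K + 2) * (?s z - ?lo) + \<bar>?r\<bar>)"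
    proof -
      have "norm (h - ?g)
          = \<bar>exp (- (C.vr * (t * c)\<^sup>2 / 2)) - exp (- (t\<^sup>2 / 2))\<bar>"
        unfolding h_def by (simp only: of_real_diff[symmetric] norm_of_real minus_mult_left minus_divide_left)
      also have "\<dots> \<le> \<bar>C.vr * (t * c)\<^sup>2 / 2 - t\<^sup>2 / 2\<bar>"
        using C.vr_nonneg by (intro exp_minus_diff_le) auto
      also have "C.vr * (t * c)\<^sup>2 / 2 - t\<^sup>2 / 2 = t\<^sup>2 / 2 * (c\<^sup>2 * (\<kappa> - 3) * (?s z - ?lo) + ?r)"
        unfolding vr by (simp add: power_mult_distrib field_simps)
      also have "\<bar>\<dots>\<bar> \<le> t\<^sup>2 / 2 * (c\<^sup>2 * (K + 2) * (?s z - ?lo) + \<bar>?r\<bar>)"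
      proof -
        have "\<bar>c\<^sup>2 * (\<kappa> - 3) * (?s z - ?lo) + ?r\<bar> \<le> c\<^sup>2 * \<bar>\<kappa> - 3\<bar> * (?s z - ?lo) + \<bar>?r\<bar>"
          using s_ge by (intro order_trans[OF abs_triangle_ineq]) (simp add: abs_mult)
        also have "\<dots> \<le> c\<^sup>2 * (K + 2) * (?s z - ?lo) + \<bar>?r\<bar>"
          using s_ge kap by (intro add_mono mult_right_mono mult_left_mono) auto
        finally show ?thesis unfolding abs_mult by (intro mult_mono) auto
      qed
      finally show ?thesis .
    qed
    have "integrable errors (\<lambda>e. iexp (t * c * C.qf e))"
      by (rule E.integrable_const_bound[of _ 1]) (use C.qf_M in auto)
    then have "(\<integral>e. ?f e z \<partial>errors) = f - ?g"
      using E.prob_space by (simp add: f_def q(1) mult.assoc)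
    then have "norm (\<integral>e. ?f e z \<partial>errors) = norm ((f - h) + (h - ?g))"
      by (simp only: diff_add_cancel add_diff_eq)
    also have "\<dots> \<le> norm (f - h) + norm (h - ?g)" by (rule norm_triangle_ineq)
    also have "\<dots> \<le> ?B + t\<^sup>2 / 2 * (c\<^sup>2 * (K + 2) * (?s z - ?lo) + \<bar>?r\<bar>)"
      by (rule add_mono[OF cb ed])
    finally show ?thesis using False by simp
  qed
  have ih: "integrable (design d) ?h"
    by (intro Bochner_Integration.integrable_add integrable_mult_right diag_fluctuation(2) sing_integrable
        D.integrable_const)
  have "(\<integral>w. iexp (t * (c * (rss (fst w) (snd w) - dof))) \<partial>joint) - ?g = (\<integral>w. case_prod ?f w \<partial>joint)"
  proof -
    interpret P: prob_space joint by (rule prob_joint)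
    have [measurable]: "(\<lambda>w. rss (fst w) (snd w)) \<in> borel_measurable joint"
      using rss_measurable by (simp add: case_prod_unfold)
    have "integrable joint (\<lambda>w. iexp (t * (c * (rss (fst w) (snd w) - dof))))"
      by (rule P.integrable_const_bound[of _ 1]) auto
    then show ?thesis using P.prob_space by (simp add: case_prod_unfold)
  qed
  also have "\<dots> = (\<integral>z. (\<integral>e. ?f e z \<partial>errors) \<partial>design d)"
    by (rule integral_joint[OF m nf])
  finally have "norm ((\<integral>w. iexp (t * (c * (rss (fst w) (snd w) - dof))) \<partial>joint) - ?g) \<le> (\<integral>z. ?h z \<partial>design d)"
    using norm_integral_le[OF ih inner] by simp
  also have "\<dots> = ?B + t\<^sup>2 / 2 * (c\<^sup>2 * (K + 2) * (\<integral>z. of_bool (\<not> singular {..<n} d z) * (?s z - ?lo) \<partial>design d) + \<bar>?r\<bar>)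
      + 2 * sing_prob"
    using diag_fluctuation(2) sing_integrable D.prob_space by (simp add: sing_prob_def)
  also have "\<dots> \<le> charfun_error c t + 2 * sing_prob"
    unfolding charfun_error_def
    using diag_fluctuation(1) K_ge_1 by (intro add_mono mult_left_mono order_refl) auto
  finally show ?thesis .
qed

text \<open>\<open>T\<close> agrees with the canonical statistic on regular designs only, since the
  estimator has a conventional value elsewhere. The disagreement costs \<open>2 * sing_prob\<close>,
  on top of the same amount in \<open>charfun_joint\<close>.\<close>

lemma transfer:
  assumes M: "prob_space M" and J: "J \<in> measurable M joint" "distr M joint J = joint"
    and T: "T \<in> borel_measurable M"
    and eq: "\<And>\<omega>. \<omega> \<in> space M \<Longrightarrow> \<not> singular {..<n} d (snd (J \<omega>)) \<Longrightarrow> T \<omega> = rss (fst (J \<omega>)) (snd (J \<omega>)) - dof"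
  shows "0 < a \<Longrightarrow> measure M {\<omega> \<in> space M. a < \<bar>T \<omega>\<bar>} \<le> sing_prob + (K + 2) * dof / a\<^sup>2"
    and "norm ((\<integral>\<omega>. iexp (t * (c * T \<omega>)) \<partial>M) - complex_of_real (exp (- (t\<^sup>2 / 2)))) \<le> charfun_error c t + 4 * sing_prob"
proof -
  interpret M: prob_space M by (rule M)
  note [measurable] = J(1) T
  have [measurable]: "Measurable.pred joint (\<lambda>w. singular {..<n} d (snd w))" by (rule sing_pred_joint)
  have [measurable]: "(\<lambda>w. rss (fst w) (snd w)) \<in> borel_measurable joint"
    using rss_measurable by (simp add: case_prod_unfold)
  have tr: "(\<integral>w. f w \<partial>joint) = (\<integral>\<omega>. f (J \<omega>) \<partial>M)" if "f \<in> borel_measurable joint"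
    for f :: "_ \<Rightarrow> 'b::{banach, second_countable_topology}"
    using integral_distr[OF J(1) that] J(2) by simp
  let ?b = "\<lambda>\<omega>. of_bool (singular {..<n} d (snd (J \<omega>))) :: real"
  have b: "M.expectation ?b = sing_prob"
    using tr[of "\<lambda>w. of_bool (singular {..<n} d (snd w)) :: real"] sing_prob_joint by simp
  have ib: "integrable M ?b" by (rule M.integrable_const_bound[of _ 1]) auto
  show "measure M {\<omega> \<in> space M. a < \<bar>T \<omega>\<bar>} \<le> sing_prob + (K + 2) * dof / a\<^sup>2" if a: "0 < a"
  proof -
    let ?d = "\<lambda>\<omega>. of_bool (\<not> singular {..<n} d (snd (J \<omega>)) \<and> a < \<bar>rss (fst (J \<omega>)) (snd (J \<omega>)) - dof\<bar>) :: real"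
    have id: "integrable M ?d" by (rule M.integrable_const_bound[of _ 1]) auto
    have "measure M {\<omega> \<in> space M. a < \<bar>T \<omega>\<bar>} = M.expectation (indicator {\<omega> \<in> space M. a < \<bar>T \<omega>\<bar>})"
      by (simp add: Int_absorb2)
    also have "\<dots> \<le> M.expectation (\<lambda>\<omega>. ?b \<omega> + ?d \<omega>)"
    proof (rule integral_mono)
      show "integrable M (indicat_real {\<omega> \<in> space M. a < \<bar>T \<omega>\<bar>})"
        by (rule M.integrable_const_bound[of _ 1]) (auto simp: indicator_def)
      show "integrable M (\<lambda>\<omega>. ?b \<omega> + ?d \<omega>)" using ib id by simp
      show "indicator {\<omega> \<in> space M. a < \<bar>T \<omega>\<bar>} \<omega> \<le> ?b \<omega> + ?d \<omega>" if "\<omega> \<in> space M" for \<omega>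
        using eq[OF that] by (auto simp: indicator_def)
    qed
    also have "\<dots> = sing_prob + M.expectation ?d" using ib id b by simp
    also have "M.expectation ?d \<le> (K + 2) * dof / a\<^sup>2"
      using deviation_joint[OF a]
      by (subst (asm) tr) auto
    finally show ?thesis by simp
  qed
  let ?V = "\<lambda>\<omega>. rss (fst (J \<omega>)) (snd (J \<omega>)) - dof" and ?g = "complex_of_real (exp (- (t\<^sup>2 / 2)))"
  have i: "integrable M (\<lambda>\<omega>. iexp (t * (c * T \<omega>)))" "integrable M (\<lambda>\<omega>. iexp (t * (c * ?V \<omega>)))"
    by (rule M.integrable_const_bound[of _ 1]; auto)+
  have "norm ((\<integral>\<omega>. iexp (t * (c * T \<omega>)) \<partial>M) - (\<integral>\<omega>. iexp (t * (c * ?V \<omega>)) \<partial>M))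
      = norm (\<integral>\<omega>. iexp (t * (c * T \<omega>)) - iexp (t * (c * ?V \<omega>)) \<partial>M)"
    by (simp only: Bochner_Integration.integral_diff[OF i])
  also have "\<dots> \<le> (\<integral>\<omega>. 2 * ?b \<omega> \<partial>M)"
  proof (rule norm_integral_le)
    show "integrable M (\<lambda>\<omega>. 2 * ?b \<omega>)" using ib by simp
    fix \<omega> assume \<omega>: "\<omega> \<in> space M"
    show "norm (iexp (t * (c * T \<omega>)) - iexp (t * (c * ?V \<omega>))) \<le> 2 * ?b \<omega>"
    proof (cases "singular {..<n} d (snd (J \<omega>))")
      case True
      have "norm (iexp (t * (c * T \<omega>)) - iexp (t * (c * ?V \<omega>))) \<le> 1 + 1"
        by (rule order_trans[OF norm_triangle_ineq4]) (simp only: norm_exp_i_times add_mono order_refl)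
      then show ?thesis using True by simp
    next
      case False
      then show ?thesis using eq[OF \<omega>] by simp
    qed
  qed
  also have "\<dots> = 2 * sing_prob" using b by simp
  finally have 1: "norm ((\<integral>\<omega>. iexp (t * (c * T \<omega>)) \<partial>M) - (\<integral>\<omega>. iexp (t * (c * ?V \<omega>)) \<partial>M)) \<le> 2 * sing_prob" .
  have 2: "norm ((\<integral>\<omega>. iexp (t * (c * ?V \<omega>)) \<partial>M) - ?g) \<le> charfun_error c t + 2 * sing_prob"
    using charfun_joint[of t c] by (subst (asm) tr) auto
  have "norm ((\<integral>\<omega>. iexp (t * (c * T \<omega>)) \<partial>M) - ?g) \<le>
      norm ((\<integral>\<omega>. iexp (t * (c * T \<omega>)) \<partial>M) - (\<integral>\<omega>. iexp (t * (c * ?V \<omega>)) \<partial>M))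
      + norm ((\<integral>\<omega>. iexp (t * (c * ?V \<omega>)) \<partial>M) - ?g)"
    by norm
  then show "norm ((\<integral>\<omega>. iexp (t * (c * T \<omega>)) \<partial>M) - ?g) \<le> charfun_error c t + 4 * sing_prob"
    using 1 2 by linarith
qed

end

section \<open>The regression model at one sample size\<close>

text \<open>The relation between \<open>X\<close> and \<open>Z\<close> holds on
  \<open>space M\<close> only, so the families to be exchanged are not equal as functions.\<close>

lemma (in prob_space) indep_vars_cong_space:
  assumes ind: "indep_vars M' X I" and I: "I \<noteq> {}"
    and eq: "\<And>i \<omega>. i \<in> I \<Longrightarrow> \<omega> \<in> space M \<Longrightarrow> X i \<omega> = Y i \<omega>"
  shows "indep_vars M' Y I"
proof -
  have X: "random_variable (M' i) (X i)" if "i \<in> I" for i using ind that by (auto simp: indep_vars_def)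
  have Y: "random_variable (M' i) (Y i)" if "i \<in> I" for i
    using X[OF that] by (rule measurable_cong[THEN iffD1, rotated]) (use eq that in auto)
  have "distr M (PiM I M') (\<lambda>\<omega>. \<lambda>i\<in>I. Y i \<omega>) = distr M (PiM I M') (\<lambda>\<omega>. \<lambda>i\<in>I. X i \<omega>)"
    by (rule distr_cong) (auto simp: eq)
  also have "\<dots> = PiM I (\<lambda>i. distr M (M' i) (X i))"
    using ind by (subst (asm) indep_vars_iff_distr_eq_PiM'[OF I X]) auto
  also have "\<dots> = PiM I (\<lambda>i. distr M (M' i) (Y i))"
    by (intro PiM_cong refl distr_cong) (auto simp: eq)
  finally show ?thesis by (subst indep_vars_iff_distr_eq_PiM'[OF I Y]) auto
qed

text \<open>\<open>charfun_error\<close> plus \<open>4 * sing_prob\<close>, with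
  \<open>sing_prob\<close> replaced by its bound; the laws remain visible only through
  \<open>\<kappa>\<close> and \<open>K\<close>.\<close>

definition sample_error :: "real \<Rightarrow> nat \<Rightarrow> nat \<Rightarrow> real \<Rightarrow> real \<Rightarrow> real \<Rightarrow> real" where
  "sample_error K n d \<kappa> c t =
    \<bar>t * c\<bar> * ((t * c)\<^sup>2 * (n * clt_c1 K) + \<bar>t * c\<bar> * (clt_c2 K * sqrt n))
    + t\<^sup>2 / 2 * (c\<^sup>2 * (K + 2) * (real d * step_const K / sqrt (real n - real d)
         + (real n - real d)\<^sup>2 / n * (real d * rho K ^ (n - d)))
       + \<bar>c\<^sup>2 * ((\<kappa> - 3) * (real n - real d)\<^sup>2 / n + 2 * (real n - real d)) - 1\<bar>)
    + 4 * (real d * rho K ^ (n - d))"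

text \<open>The model at one sample size, with a single constant \<open>K\<close> for the fourth
  moments of the design entries and the eighth moments of the standardised errors. Uniformity in
  \<open>n\<close> is thereby reduced to a choice of \<open>K\<close>.\<close>

locale regression_sample = prob_space M for M :: "'a measure" +
  fixes n d :: nat and R :: "real mat" and \<beta> :: "real vec" and \<sigma> K :: real
    and X :: "nat \<Rightarrow> 'a \<Rightarrow> nat \<Rightarrow> real" and Z :: "nat \<Rightarrow> nat \<Rightarrow> 'a \<Rightarrow> real" and \<epsilon> Y :: "nat \<Rightarrow> 'a \<Rightarrow> real"
  assumes dims: "0 < d" "d < n" and K_ge_1: "1 \<le> K"
    and R: "R \<in> carrier_mat d d" "Determinant.det R \<noteq> 0" and \<beta>: "\<beta> \<in> carrier_vec d"
    and X_indep: "indep_vars (\<lambda>_. Rvec d) X {..<n}"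
    and X_eq: "\<And>i \<omega>. i < n \<Longrightarrow> \<omega> \<in> space M \<Longrightarrow> vec d (X i \<omega>) = R *\<^sub>v vec d (\<lambda>j. Z i j \<omega>)"
    and Z_indep: "\<And>i. i < n \<Longrightarrow> indep_vars (\<lambda>_. borel) (Z i) {..<d}"
    and Z_moments: "\<And>i j. i < n \<Longrightarrow> j < d \<Longrightarrow> integrable M (\<lambda>\<omega>. Z i j \<omega> ^ 4)"
      "\<And>i j. i < n \<Longrightarrow> j < d \<Longrightarrow> expectation (Z i j) = 0"
      "\<And>i j. i < n \<Longrightarrow> j < d \<Longrightarrow> expectation (\<lambda>\<omega>. Z i j \<omega> ^ 2) = 1"
      "\<And>i j. i < n \<Longrightarrow> j < d \<Longrightarrow> expectation (\<lambda>\<omega>. Z i j \<omega> ^ 4) \<le> K"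
    and \<epsilon>_iid: "iid_vars M borel n \<epsilon>"
    and \<epsilon>_X: "indep_elems M (PiM {..<n} (\<lambda>_. borel)) (\<lambda>\<omega>. \<lambda>i\<in>{..<n}. \<epsilon> i \<omega>)
      (PiM {..<n} (\<lambda>_. Rvec d)) (\<lambda>\<omega>. \<lambda>i\<in>{..<n}. X i \<omega>)"
    and \<sigma>: "\<sigma> \<noteq> 0"
    and \<epsilon>_moments: "integrable M (\<lambda>\<omega>. \<epsilon> 0 \<omega> ^ 8)" "expectation (\<epsilon> 0) = 0"
      "expectation (\<lambda>\<omega>. (\<epsilon> 0 \<omega>)\<^sup>2) = \<sigma>\<^sup>2" "expectation (\<lambda>\<omega>. \<epsilon> 0 \<omega> ^ 8) \<le> K * \<sigma> ^ 8"
    and Y_eq: "\<And>i \<omega>. i < n \<Longrightarrow> \<omega> \<in> space M \<Longrightarrow> Y i \<omega> = scalar_prod (vec d (X i \<omega>)) \<beta> + \<epsilon> i \<omega>"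
begin

definition "\<mu> = distr M borel (\<lambda>\<omega>. \<epsilon> 0 \<omega> / \<sigma>)"
definition "\<kappa> = expectation (\<lambda>\<omega>. \<epsilon> 0 \<omega> ^ 4) / \<sigma> ^ 4"
text \<open>Outside the index range a point mass is inserted, because \<open>random_columns\<close>
  asks for probability laws at all indices.\<close>

definition "\<nu> j i = (if i < n \<and> j < d then distr M borel (Z i j) else return borel 0)"
definition "coords_of \<omega> = (\<lambda>i\<in>{..<n}. \<epsilon> i \<omega> / \<sigma>, \<lambda>j\<in>{..<d}. \<lambda>i\<in>{..<n}. Z i j \<omega>)"

lemma n_pos: "0 < n" using dims by simp

lemma \<epsilon>_measurable: "i < n \<Longrightarrow> \<epsilon> i \<in> borel_measurable M"
  using \<epsilon>_iid by (auto simp: iid_vars_def indep_vars_def)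

lemma Z_measurable: "i < n \<Longrightarrow> j < d \<Longrightarrow> Z i j \<in> borel_measurable M"
  using Z_indep[of i] by (auto simp: indep_vars_def)

lemma X_measurable: "i < n \<Longrightarrow> X i \<in> measurable M (Rvec d)"
  using X_indep by (auto simp: indep_vars_def)

lemma \<mu>_space: "prob_space \<mu>" "sets \<mu> = sets borel"
  using \<epsilon>_measurable[OF n_pos] by (auto simp: \<mu>_def intro!: prob_space_distr)

lemma \<nu>_space: "prob_space (\<nu> j i)" "sets (\<nu> j i) = sets borel"
  using Z_measurable by (auto simp: \<nu>_def intro!: prob_space_distr prob_space_return)

lemma \<mu>_moments:
  shows "integrable \<mu> (\<lambda>u. u ^ k) \<longleftrightarrow> integrable M (\<lambda>\<omega>. \<epsilon> 0 \<omega> ^ k)"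
    and "(\<integral>u. u ^ k \<partial>\<mu>) = expectation (\<lambda>\<omega>. \<epsilon> 0 \<omega> ^ k) / \<sigma> ^ k"
proof -
  have p: "(u / \<sigma>) ^ k = u ^ k * inverse (\<sigma> ^ k)" for u :: real
    unfolding power_divide by (rule divide_inverse)
  have [measurable]: "\<epsilon> 0 \<in> borel_measurable M" by (rule \<epsilon>_measurable[OF n_pos])
  show "integrable \<mu> (\<lambda>u. u ^ k) \<longleftrightarrow> integrable M (\<lambda>\<omega>. \<epsilon> 0 \<omega> ^ k)"
    using \<sigma> by (simp add: \<mu>_def integrable_distr_eq p)
  show "(\<integral>u. u ^ k \<partial>\<mu>) = expectation (\<lambda>\<omega>. \<epsilon> 0 \<omega> ^ k) / \<sigma> ^ k"
    by (simp add: \<mu>_def integral_distr power_divide)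
qed

lemma \<epsilon>_integrable: "k \<le> 8 \<Longrightarrow> integrable M (\<lambda>\<omega>. \<epsilon> 0 \<omega> ^ k)"
  by (rule integrable_power_le[OF \<epsilon>_moments(1) \<epsilon>_measurable[OF n_pos]])

lemma \<mu>_eighth: "(\<integral>u. u ^ 8 \<partial>\<mu>) \<le> K"
proof -
  have "0 < \<sigma> ^ 8" using \<sigma> by (simp add: zero_less_power_eq)
  then show ?thesis using \<epsilon>_moments(4) by (simp add: \<mu>_moments(2) divide_le_eq)
qed

text \<open>\<open>u ^ 4\<close> is at most the mean of 1 and \<open>u ^ 8\<close>, so with
  \<open>1 \<le> K\<close> the eighth moment bound serves for the fourth moment too.\<close>

lemma \<mu>_fourth: "(\<integral>u. u ^ 4 \<partial>\<mu>) \<le> K"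
proof -
  interpret m: prob_space \<mu> by (rule \<mu>_space(1))
  have i: "integrable \<mu> (\<lambda>u. u ^ 8)" "integrable \<mu> (\<lambda>u. u ^ 4)"
    using \<epsilon>_integrable[of 8] \<epsilon>_integrable[of 4] by (simp_all add: \<mu>_moments(1))
  have "u ^ 4 \<le> 1 / 2 + u ^ 8 / 2" for u :: real
    using zero_le_power2[of "u ^ 4 - 1"] by (simp add: power2_diff flip: power_mult)
  then have "(\<integral>u. u ^ 4 \<partial>\<mu>) \<le> (\<integral>u. 1 / 2 + u ^ 8 / 2 \<partial>\<mu>)"
    using i by (intro integral_mono) auto
  also have "\<dots> = 1 / 2 + (\<integral>u. u ^ 8 \<partial>\<mu>) / 2" using i m.prob_space by simp
  finally show ?thesis using \<mu>_eighth K_ge_1 by linarith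
qed

lemma quadratic_clt_errors:
  assumes "is_proj {..<n} Q"
  shows "quadratic_clt (PiM {..<n} (\<lambda>_. \<mu>)) {..<n} (\<lambda>i y. y i) K Q \<kappa> (\<integral>u. u ^ 3 \<partial>\<mu>)"
proof -
  have s2: "expectation (\<lambda>\<omega>. \<epsilon> 0 \<omega> ^ 2) / \<sigma> ^ 2 = 1" using \<epsilon>_moments(3) \<sigma> by simp
  interpret S: standard_indep "PiM {..<n} (\<lambda>_. \<mu>)" "{..<n}" "\<lambda>i y. y i" K
  proof (rule standard_indep_PiM)
    show "{..<n} \<noteq> {}" using n_pos by auto
    show "(\<integral>u. u \<partial>\<mu>) = 0" using \<mu>_moments(2)[of 1] \<epsilon>_moments(2) by simp
    show "integrable \<mu> (\<lambda>u. u ^ 4)" using \<epsilon>_integrable[of 4] by (simp add: \<mu>_moments(1))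
    show "(\<integral>u. u ^ 2 \<partial>\<mu>) = 1" using s2 by (simp only: \<mu>_moments(2))
  qed (use \<mu>_space \<mu>_fourth K_ge_1 in auto)
  note int = integral_coordinate[of "{..<n}" "\<lambda>_. \<mu>", OF \<mu>_space]
  show ?thesis
  proof
    show "is_proj {..<n} Q" by (rule assms)
    fix i assume i: "i \<in> {..<n}"
    show "integrable (PiM {..<n} (\<lambda>_. \<mu>)) (\<lambda>y. y i ^ 8)"
      using int(2)[OF i, of "\<lambda>u. u ^ 8"] \<epsilon>_integrable[of 8] by (simp add: \<mu>_moments(1))
    show "(\<integral>y. y i ^ 8 \<partial>PiM {..<n} (\<lambda>_. \<mu>)) \<le> K"
      using int(1)[OF i, of "\<lambda>u. u ^ 8"] \<mu>_eighth by simp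
    show "(\<integral>y. y i ^ 3 \<partial>PiM {..<n} (\<lambda>_. \<mu>)) = (\<integral>u. u ^ 3 \<partial>\<mu>)"
      using int(1)[OF i, of "\<lambda>u. u ^ 3"] by simp
    show "(\<integral>y. y i ^ 4 \<partial>PiM {..<n} (\<lambda>_. \<mu>)) = \<kappa>"
      using int(1)[OF i, of "\<lambda>u. u ^ 4"] by (simp add: \<mu>_moments(2) \<kappa>_def)
  qed
qed

lemma quadratic_sample: "quadratic_sample n \<nu> d K \<mu> \<kappa> (\<integral>u. u ^ 3 \<partial>\<mu>)"
proof (intro quadratic_sample.intro random_columns.intro quadratic_sample_axioms.intro)
  show "prob_space (\<nu> j i)" "sets (\<nu> j i) = sets borel" for j i by (rule \<nu>_space)+
  show "standard_indep (PiM {..<n} (\<nu> j)) {..<n} (\<lambda>i y. y i) K" if j: "j < d" for j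
  proof (rule standard_indep_PiM)
    show "{..<n} \<noteq> {}" using n_pos by auto
    fix i assume i: "i \<in> {..<n}"
    have n: "\<nu> j i = distr M borel (Z i j)" using i j by (simp add: \<nu>_def)
    have [measurable]: "Z i j \<in> borel_measurable M" using i j Z_measurable by simp
    show "integrable (\<nu> j i) (\<lambda>u. u ^ 4)" "(\<integral>u. u \<partial>\<nu> j i) = 0" "(\<integral>u. u\<^sup>2 \<partial>\<nu> j i) = 1" "(\<integral>u. u ^ 4 \<partial>\<nu> j i) \<le> K"
      using Z_moments[of i j] i j by (simp_all add: n integrable_distr_eq integral_distr)
  qed (use \<nu>_space K_ge_1 in auto)
  show "d < card {..<n}" using dims by simp
qed (use K_ge_1 \<mu>_space quadratic_clt_errors in auto)

lemma kappa_ge_1: "1 \<le> \<kappa>"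
proof -
  interpret C: quadratic_clt "PiM {..<n} (\<lambda>_. \<mu>)" "{..<n}" "\<lambda>i y. y i" K "\<lambda>i j. if i = j then 1 else 0" \<kappa> "\<integral>u. u ^ 3 \<partial>\<mu>"
    by (rule quadratic_clt_errors[OF is_proj_id]) simp
  show ?thesis using C.kappa_bound[of 0] n_pos by simp
qed

text \<open>Independence between rows is given for \<open>X\<close>. Solving for \<open>Z\<close>
  transports it to the rows of \<open>Z\<close>, and likewise the independence from the
  errors.\<close>

lemma Z_eq:
  assumes "i < n" "j < d" "\<omega> \<in> space M"
  shows "Z i j \<omega> = (\<Sum>k<d. mat_inv R $$ (j, k) * X i \<omega> k)"
proof -
  note inv = mat_inv_nonsingular[OF R]
  have "mat_inv R *\<^sub>v vec d (X i \<omega>) = (mat_inv R * R) *\<^sub>v vec d (\<lambda>j. Z i j \<omega>)"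
    unfolding X_eq[OF assms(1,3)] by (rule assoc_mult_mat_vec[OF inv(1) R(1), symmetric]) simp
  also have "\<dots> = vec d (\<lambda>j. Z i j \<omega>)" unfolding inv(3) by (rule one_mult_mat_vec) simp
  finally have "vec_index (mat_inv R *\<^sub>v vec d (X i \<omega>)) j = vec_index (vec d (\<lambda>j. Z i j \<omega>)) j"
    by (rule arg_cong)
  then have "Z i j \<omega> = vec_index (mat_inv R *\<^sub>v vec d (X i \<omega>)) j" using assms by simp
  also have "\<dots> = (\<Sum>k<d. mat_inv R $$ (j, k) * vec_index (vec d (X i \<omega>)) k)"
    by (rule mult_mat_vec_index[OF inv(1) _ assms(2)]) simp
  finally show ?thesis by simp
qed

lemma X_eq_index:
  assumes "i < n" "j < d" "\<omega> \<in> space M"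
  shows "X i \<omega> j = (\<Sum>k<d. R $$ (j, k) * Z i k \<omega>)"
proof -
  have "vec_index (vec d (X i \<omega>)) j = vec_index (R *\<^sub>v vec d (\<lambda>j. Z i j \<omega>)) j"
    by (rule arg_cong[OF X_eq[OF assms(1,3)]])
  also have "\<dots> = (\<Sum>k<d. R $$ (j, k) * vec_index (vec d (\<lambda>j. Z i j \<omega>)) k)"
    by (rule mult_mat_vec_index[OF R(1) _ assms(2)]) simp
  finally show ?thesis using assms by simp
qed

lemma Z_pairs: "indep_vars (\<lambda>_. borel) (\<lambda>(i, j). Z i j) ({..<n} \<times> {..<d})"
proof (rule indep_vars_pairs[OF n_pos dims(1) _ Z_indep])
  let ?H = "\<lambda>x. \<lambda>j\<in>{..<d}. \<Sum>k<d. mat_inv R $$ (j, k) * x k"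
  have "indep_vars (\<lambda>_. Rvec d) (\<lambda>i \<omega>. ?H (X i \<omega>)) {..<n}"
    by (rule indep_vars_compose2[OF X_indep])
       (intro measurable_restrict borel_measurable_sum borel_measurable_times borel_measurable_const
         measurable_component_singleton)
  then show "indep_vars (\<lambda>_. Rvec d) (\<lambda>i \<omega>. \<lambda>j\<in>{..<d}. Z i j \<omega>) {..<n}"
    by (rule indep_vars_cong_space) (use n_pos in \<open>auto simp: Z_eq\<close>)
qed

lemma errors_law: "distr M (PiM {..<n} (\<lambda>_. borel)) (\<lambda>\<omega>. \<lambda>i\<in>{..<n}. \<epsilon> i \<omega> / \<sigma>) = PiM {..<n} (\<lambda>_. \<mu>)"
proof -
  have ind: "indep_vars (\<lambda>_. borel) (\<lambda>i \<omega>. \<epsilon> i \<omega> / \<sigma>) {..<n}"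
    by (rule indep_vars_compose2[of "\<lambda>_. borel"]) (use \<epsilon>_iid in \<open>auto simp: iid_vars_def\<close>)
  have eq: "distr M borel (\<lambda>\<omega>. \<epsilon> i \<omega> / \<sigma>) = \<mu>" if i: "i < n" for i
  proof -
    have "distr M borel (\<lambda>\<omega>. \<epsilon> i \<omega> / \<sigma>) = distr (distr M borel (\<epsilon> i)) borel (\<lambda>u. u / \<sigma>)"
      using \<epsilon>_measurable[OF i] by (subst distr_distr) (auto simp: comp_def)
    also have "distr M borel (\<epsilon> i) = distr M borel (\<epsilon> 0)"
      using \<epsilon>_iid i n_pos unfolding iid_vars_def by blast
    also have "distr (distr M borel (\<epsilon> 0)) borel (\<lambda>u. u / \<sigma>) = \<mu>"
      using \<epsilon>_measurable[OF n_pos] by (subst distr_distr) (auto simp: comp_def \<mu>_def)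
    finally show ?thesis .
  qed
  have "distr M (PiM {..<n} (\<lambda>_. borel)) (\<lambda>\<omega>. \<lambda>i\<in>{..<n}. \<epsilon> i \<omega> / \<sigma>)
      = PiM {..<n} (\<lambda>i. distr M borel (\<lambda>\<omega>. \<epsilon> i \<omega> / \<sigma>))"
    using ind n_pos \<epsilon>_measurable by (subst (asm) indep_vars_iff_distr_eq_PiM') auto
  also have "\<dots> = PiM {..<n} (\<lambda>_. \<mu>)" by (rule PiM_cong) (auto simp: eq)
  finally show ?thesis .
qed

lemma design_law: "distr M (PiM {..<d} (\<lambda>_. PiM {..<n} (\<lambda>_. borel))) (\<lambda>\<omega>. \<lambda>j\<in>{..<d}. \<lambda>i\<in>{..<n}. Z i j \<omega>)
    = PiM {..<d} (\<lambda>j. PiM {..<n} (\<nu> j))"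
  unfolding distr_columns[OF n_pos dims(1) Z_pairs]
  by (intro PiM_cong refl) (simp_all add: \<nu>_def)

abbreviation "joint_measure \<equiv> PiM {..<n} (\<lambda>_. \<mu>) \<Otimes>\<^sub>M PiM {..<d} (\<lambda>j. PiM {..<n} (\<nu> j))"

text \<open>The two components are measurable functions of the error tuple and of the design tuple.
  Independence of these gives a product, whose factors are identified by \<open>errors_law\<close>
  and \<open>design_law\<close>.\<close>

lemma joint_law:
  "coords_of \<in> measurable M joint_measure"
  "distr M joint_measure coords_of = joint_measure"
proof -
  let ?L1 = "PiM {..<n} (\<lambda>_. borel) :: (nat \<Rightarrow> real) measure"
    and ?L2 = "PiM {..<d} (\<lambda>_. PiM {..<n} (\<lambda>_. borel)) :: (nat \<Rightarrow> nat \<Rightarrow> real) measure"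
  have s1: "sets (PiM {..<n} (\<lambda>_. \<mu>)) = sets ?L1"
    by (rule sets_PiM_cong) (auto simp: \<mu>_space)
  have s2: "sets (PiM {..<d} (\<lambda>j. PiM {..<n} (\<nu> j))) = sets ?L2"
    by (intro sets_PiM_cong refl) (auto simp: \<nu>_space)
  have s: "sets joint_measure = sets (?L1 \<Otimes>\<^sub>M ?L2)" by (rule sets_pair_measure_cong[OF s1 s2])
  have "coords_of \<in> measurable M (?L1 \<Otimes>\<^sub>M ?L2)"
    unfolding coords_of_def[abs_def]
    using \<epsilon>_measurable Z_measurable
    by (intro measurable_Pair measurable_restrict) auto
  then show "coords_of \<in> measurable M joint_measure" by (simp cong: measurable_cong_sets add: s)
  let ?f = "\<lambda>e. \<lambda>i\<in>{..<n}. e i / \<sigma>" and ?g = "\<lambda>x. \<lambda>j\<in>{..<d}. \<lambda>i\<in>{..<n}. \<Sum>k<d. mat_inv R $$ (j, k) * x i k"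
  let ?U = "\<lambda>\<omega>. \<lambda>i\<in>{..<n}. \<epsilon> i \<omega>" and ?V = "\<lambda>\<omega>. \<lambda>i\<in>{..<n}. X i \<omega>"
  have f: "?f \<in> measurable ?L1 ?L1"
    by (intro measurable_restrict borel_measurable_divide borel_measurable_const measurable_component_singleton)
  have g: "?g \<in> measurable (PiM {..<n} (\<lambda>_. Rvec d)) ?L2"
  proof -
    have "(\<lambda>x. x i k) \<in> borel_measurable (PiM {..<n} (\<lambda>_. Rvec d))" if "i \<in> {..<n}" "k \<in> {..<d}" for i k
      by (rule measurable_compose[where f = "\<lambda>x. x i" and g = "\<lambda>y. y k" and N = "Rvec d"])
         (use that in \<open>auto intro!: measurable_component_singleton\<close>)
    then show ?thesis
      by (intro measurable_restrict borel_measurable_sum borel_measurable_times borel_measurable_const)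
  qed
  have gV: "?g (?V \<omega>) = (\<lambda>j\<in>{..<d}. \<lambda>i\<in>{..<n}. Z i j \<omega>)" if "\<omega> \<in> space M" for \<omega>
    using that by (auto simp: fun_eq_iff Z_eq)
  have fU: "?f (?U \<omega>) = (\<lambda>i\<in>{..<n}. \<epsilon> i \<omega> / \<sigma>)" for \<omega> by (auto simp: fun_eq_iff)
  have "distr M joint_measure coords_of = distr M (?L1 \<Otimes>\<^sub>M ?L2) (\<lambda>\<omega>. (?f (?U \<omega>), ?g (?V \<omega>)))"
    by (rule distr_cong[OF refl s]) (simp only: coords_of_def fU gV)
  also have "\<dots> = distr M ?L1 (\<lambda>\<omega>. ?f (?U \<omega>)) \<Otimes>\<^sub>M distr M ?L2 (\<lambda>\<omega>. ?g (?V \<omega>))"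
    by (rule indep_elems_distr[OF prob_space_axioms \<epsilon>_X f g])
  also have "distr M ?L1 (\<lambda>\<omega>. ?f (?U \<omega>)) = PiM {..<n} (\<lambda>_. \<mu>)" unfolding fU by (rule errors_law)
  also have "distr M ?L2 (\<lambda>\<omega>. ?g (?V \<omega>)) = PiM {..<d} (\<lambda>j. PiM {..<n} (\<nu> j))"
    unfolding design_law[symmetric] by (rule distr_cong[OF refl refl gV])
  finally show "distr M joint_measure coords_of = joint_measure" .
qed

lemma estimator_measurable: "sigma_hat_sq n d X Y \<in> borel_measurable M"
proof (rule sigma_hat_sq_measurable)
  show XM: "(\<lambda>\<omega>. X i \<omega> j) \<in> borel_measurable M" if "i < n" "j < d" for i j
    by (rule measurable_compose[OF X_measurable[OF that(1)] measurable_component_singleton]) (use that in auto)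
  show "Y i \<in> borel_measurable M" if i: "i < n" for i
  proof -
    have "Y i \<omega> = (\<Sum>j<d. X i \<omega> j * vec_index \<beta> j) + \<epsilon> i \<omega>" if "\<omega> \<in> space M" for \<omega>
      using Y_eq[OF i that] \<beta> by (simp add: scalar_prod_def atLeast0LessThan)
    then show ?thesis
      using XM \<epsilon>_measurable i
      by (subst measurable_cong) (auto intro!: borel_measurable_add borel_measurable_sum borel_measurable_times)
  qed
qed

text \<open>Scaled so that on regular designs it is the residual sum of squares of the standardised
  errors minus its conditional mean \<open>n - d\<close>.\<close>

definition "dev \<omega> = (real n - real d) * (sigma_hat_sq n d X Y \<omega> / \<sigma>\<^sup>2 - 1)"

lemma dev_eq:
  assumes \<omega>: "\<omega> \<in> space M" and reg: "\<not> singular {..<n} d (snd (coords_of \<omega>))"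
  shows "dev \<omega> = ssq {..<n} (app {..<n} (resid_proj {..<n} d (snd (coords_of \<omega>))) (fst (coords_of \<omega>))) - (real n - real d)"
proof -
  let ?z = "snd (coords_of \<omega>)" and ?e = "fst (coords_of \<omega>)"
  let ?Q = "resid_proj {..<n} d ?z"
  interpret F: factored_design n d R "\<lambda>i j. X i \<omega> j" ?z
  proof
    show "X i \<omega> j = (\<Sum>k<d. R $$ (j, k) * ?z k i)" if "i < n" "j < d" for i j
      using that X_eq_index[OF that \<omega>] by (simp add: coords_of_def)
  qed (use R reg in auto)
  have "sigma_hat_sq n d X Y \<omega> = ssq {..<n} (app {..<n} ?Q (\<lambda>i. \<epsilon> i \<omega>)) / (real n - real d)"
    using F.residual_sum_of_squares[OF \<beta>, of "\<lambda>i. Y i \<omega>" "\<lambda>i. \<epsilon> i \<omega>"] Y_eq[OF _ \<omega>]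
    by (simp add: sigma_hat_sq_def Let_def)
  moreover have "app {..<n} ?Q (\<lambda>i. \<epsilon> i \<omega>) i = \<sigma> * app {..<n} ?Q ?e i" for i
    using \<sigma> by (simp add: app_def sum_distrib_left coords_of_def)
  then have "ssq {..<n} (app {..<n} ?Q (\<lambda>i. \<epsilon> i \<omega>)) = \<sigma>\<^sup>2 * ssq {..<n} (app {..<n} ?Q ?e)"
    by (simp add: ssq_def power_mult_distrib sum_distrib_left)
  ultimately show ?thesis
    using \<sigma> dims by (simp add: dev_def right_diff_distrib)
qed

theorem finite_sample:
  shows "0 < a \<Longrightarrow> prob {\<omega> \<in> space M. a < \<bar>dev \<omega>\<bar>} \<le> real d * rho K ^ (n - d) + (K + 2) * (real n - real d) / a\<^sup>2"
    and "norm (expectation (\<lambda>\<omega>. iexp (t * (c * dev \<omega>))) - complex_of_real (exp (- (t\<^sup>2 / 2)))) \<le> sample_error K n d \<kappa> c t"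
proof -
  interpret S: quadratic_sample n \<nu> d K \<mu> \<kappa> "\<integral>u. u ^ 3 \<partial>\<mu>" by (rule quadratic_sample)
  have dM: "dev \<in> borel_measurable M"
    unfolding dev_def[abs_def] using estimator_measurable by measurable
  note tr = S.transfer[OF prob_space_axioms joint_law dM dev_eq]
  show "prob {\<omega> \<in> space M. a < \<bar>dev \<omega>\<bar>} \<le> real d * rho K ^ (n - d) + (K + 2) * (real n - real d) / a\<^sup>2" if "0 < a"
    using tr(1)[OF _ _ that] S.sing_prob_bounds(2) by simp
  have "norm (expectation (\<lambda>\<omega>. iexp (t * (c * dev \<omega>))) - complex_of_real (exp (- (t\<^sup>2 / 2)))) \<le> S.charfun_error c t + 4 * S.sing_prob"
    by (rule tr(2))
  also have "\<dots> \<le> sample_error K n d \<kappa> c t"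
    unfolding S.charfun_error_def sample_error_def
    using S.sing_prob_bounds(2) K_ge_1 by (intro add_mono mult_left_mono order_refl) auto
  finally show "norm (expectation (\<lambda>\<omega>. iexp (t * (c * dev \<omega>))) - complex_of_real (exp (- (t\<^sup>2 / 2)))) \<le> sample_error K n d \<kappa> c t" .
qed

end

section \<open>Limits\<close>

text \<open>For the last claim, \<open>p n\<close> is at most \<open>n\<close>, which is a bounded
  multiple of \<open>n - p n\<close> in the limit, and \<open>k * r ^ k\<close> tends to 0.\<close>

lemma filterlim_dof:
  fixes p :: "nat \<Rightarrow> nat"
  assumes "(\<lambda>n. real (p n) / real n) \<longlonglongrightarrow> \<tau>" "\<tau> < 1"
  shows "\<forall>\<^sub>F n in sequentially. p n < n"
    and "(\<lambda>n. real n / (real n - real (p n))) \<longlonglongrightarrow> 1 / (1 - \<tau>)"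
    and "filterlim (\<lambda>n. real n - real (p n)) at_top sequentially"
    and "\<bar>r\<bar> < 1 \<Longrightarrow> (\<lambda>n. real (p n) * r ^ (n - p n)) \<longlonglongrightarrow> 0"
proof -
  have "\<forall>\<^sub>F n in sequentially. real (p n) / real n < 1" by (rule order_tendstoD(2)[OF assms])
  then show lt: "\<forall>\<^sub>F n in sequentially. p n < n"
    using eventually_gt_at_top[of 0] by eventually_elim (simp add: divide_less_eq)
  have q: "(\<lambda>n. 1 - real (p n) / real n) \<longlonglongrightarrow> 1 - \<tau>" by (intro tendsto_intros assms)
  have "(\<lambda>n. inverse (1 - real (p n) / real n)) \<longlonglongrightarrow> inverse (1 - \<tau>)"
    using assms(2) by (intro tendsto_inverse q) simp
  moreover have "\<forall>\<^sub>F n in sequentially. inverse (1 - real (p n) / real n) = real n / (real n - real (p n))"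
    using lt by eventually_elim (simp add: field_simps)
  ultimately show ratio: "(\<lambda>n. real n / (real n - real (p n))) \<longlonglongrightarrow> 1 / (1 - \<tau>)"
    by (simp add: inverse_eq_divide tendsto_cong)
  have "filterlim (\<lambda>n. (1 - real (p n) / real n) * real n) at_top sequentially"
    using assms(2) by (intro filterlim_tendsto_pos_mult_at_top[OF q] filterlim_real_sequentially) auto
  moreover have "\<forall>\<^sub>F n in sequentially. (1 - real (p n) / real n) * real n = real n - real (p n)"
    using eventually_gt_at_top[of 0] by eventually_elim (simp add: field_simps)
  ultimately show dof: "filterlim (\<lambda>n. real n - real (p n)) at_top sequentially"
    using filterlim_cong[OF refl refl] by fast
  have "filterlim (\<lambda>n. real (n - p n)) at_top sequentially"
  proof (rule filterlim_at_top_mono[OF dof])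
    show "\<forall>\<^sub>F n in sequentially. real n - real (p n) \<le> real (n - p n)"
    proof (intro always_eventually allI)
      fix n
      \<comment> \<open>Truncated subtraction only increases the value, so the comparison also holds
        where \<open>p n\<close> exceeds \<open>n\<close>.\<close>
      have "real n \<le> real (n - p n + p n)" by (intro of_nat_mono) simp
      then show "real n - real (p n) \<le> real (n - p n)" by simp
    qed
  qed
  then have nat_dof: "filterlim (\<lambda>n. n - p n) at_top sequentially"
    by (simp add: filterlim_sequentially_iff_filterlim_real)
  assume r: "\<bar>r\<bar> < 1"
  have "(\<lambda>k. real k * r ^ k) \<longlonglongrightarrow> 0" using powser_times_n_limit_0[of r] r by simp
  then have "(\<lambda>n. real (n - p n) * r ^ (n - p n)) \<longlonglongrightarrow> 0"
    by (rule filterlim_compose[OF _ nat_dof])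
  then have "(\<lambda>n. real n / (real n - real (p n)) * \<bar>real (n - p n) * r ^ (n - p n)\<bar>) \<longlonglongrightarrow> 1 / (1 - \<tau>) * \<bar>0\<bar>"
    by (intro tendsto_mult ratio tendsto_rabs)
  then have lim0: "(\<lambda>n. real n / (real n - real (p n)) * \<bar>real (n - p n) * r ^ (n - p n)\<bar>) \<longlonglongrightarrow> 0" by simp
  show "(\<lambda>n. real (p n) * r ^ (n - p n)) \<longlonglongrightarrow> 0"
  proof (rule Lim_null_comparison[OF _ lim0])
    show "\<forall>\<^sub>F n in sequentially. norm (real (p n) * r ^ (n - p n)) \<le>
        real n / (real n - real (p n)) * \<bar>real (n - p n) * r ^ (n - p n)\<bar>"
      using lt
    proof eventually_elim
      case (elim n)
      have "norm (real (p n) * r ^ (n - p n)) \<le> real n * \<bar>r ^ (n - p n)\<bar>"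
        using elim by (simp add: abs_mult mult_right_mono)
      also have "\<dots> = real n / (real n - real (p n)) * (real (n - p n) * \<bar>r ^ (n - p n)\<bar>)"
        using elim by (simp add: of_nat_diff)
      finally show ?case by (simp add: abs_mult)
    qed
  qed
qed

text \<open>Here \<open>\<theta>0\<close> bounds the normalised variance bracket from below. Each
  summand tends to 0 as soon as \<open>a\<close> tends to \<open>1 / (1 - \<tau>)\<close> and
  \<open>s\<close> to 0.\<close>

definition error_bound :: "real \<Rightarrow> real \<Rightarrow> real \<Rightarrow> nat \<Rightarrow> nat \<Rightarrow> real \<Rightarrow> real" where
  "error_bound K \<tau> \<theta>0 n d t =
    (let m = real n - real d; a = real n / m; s = real d * rho K ^ (n - d) in
      \<bar>t\<bar> ^ 3 * clt_c1 K * (a\<^sup>2 / \<theta>0) * (a / sqrt (\<theta>0 * n)) + t\<^sup>2 * clt_c2 K * (a\<^sup>2 / \<theta>0) / sqrt n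
      + t\<^sup>2 / 2 * ((K + 2) * (a\<^sup>2 / \<theta>0) * (step_const K / sqrt m) + (K + 2) * (s / \<theta>0) + \<bar>2 * a - 2 / (1 - \<tau>)\<bar> / \<theta>0)
      + 4 * s)"

text \<open>With \<open>m = n - d\<close> and \<open>a = n / m\<close>, the scale satisfies
  \<open>c\<^sup>2 * (m\<^sup>2 / n) = 1 / \<theta>\<close>, and the fourth moment minus
  \<open>3 + \<theta>\<close> is \<open>- 2 / (1 - \<tau>)\<close>. The variance mismatch therefore
  collapses to a multiple of \<open>2 * a - 2 / (1 - \<tau>)\<close>, the distance of
  \<open>n / m\<close> from its limit.\<close>

lemma sample_error_le:
  fixes n d :: nat and \<theta> \<theta>0 \<tau> :: real
  assumes d: "d < n" and K: "1 \<le> K" and \<theta>: "0 < \<theta>0" "\<theta>0 \<le> \<theta>" and \<tau>: "\<tau> < 1"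
  defines "c \<equiv> real n / (real n - real d) / sqrt (real n * \<theta>)"
  shows "sample_error K n d (\<theta> - (3 * \<tau> - 1) / (1 - \<tau>)) c t \<le> error_bound K \<tau> \<theta>0 n d t"
proof -
  define m where "m = real n - real d"
  define a where "a = real n / m"
  define s where "s = real d * rho K ^ (n - d)"
  define \<kappa> where "\<kappa> = \<theta> - (3 * \<tau> - 1) / (1 - \<tau>)"
  have n: "0 < real n" and m: "0 < m" and am: "real n = a * m" and a: "0 < a"
    using d by (auto simp: m_def a_def)
  have th: "0 < \<theta>" using \<theta> by simp
  have c: "c = a / sqrt (real n * \<theta>)" by (simp add: c_def a_def m_def)
  have c0: "0 \<le> c" using a th n by (simp add: c)
  have c2: "c\<^sup>2 = a\<^sup>2 / (real n * \<theta>)" using n th by (simp add: c power_divide)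
  have s0: "0 \<le> s" using rho_bounds[OF K] by (simp add: s_def)
  have c2n: "c\<^sup>2 * n \<le> a\<^sup>2 / \<theta>0"
  proof -
    have "c\<^sup>2 * n = a\<^sup>2 / \<theta>" using n by (simp add: c2)
    also have "\<dots> \<le> a\<^sup>2 / \<theta>0" using \<theta> th by (intro divide_left_mono) auto
    finally show ?thesis .
  qed
  have cle: "c \<le> a / sqrt (\<theta>0 * n)"
    unfolding c using \<theta> th n a by (intro divide_left_mono) (auto simp: mult.commute)
  have pos: "0 \<le> clt_c1 K" "0 \<le> clt_c2 K" "0 \<le> step_const K"
    using K by (auto simp: clt_c1_def clt_c2_def step_const_def)
  have 1: "\<bar>t * c\<bar> * ((t * c)\<^sup>2 * (n * clt_c1 K)) \<le> \<bar>t\<bar> ^ 3 * clt_c1 K * (a\<^sup>2 / \<theta>0) * (a / sqrt (\<theta>0 * n))"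
  proof -
    have "\<bar>t * c\<bar> * ((t * c)\<^sup>2 * (n * clt_c1 K)) = \<bar>t\<bar> ^ 3 * clt_c1 K * ((c\<^sup>2 * n) * c)"
    proof -
      have "\<bar>t * c\<bar> = \<bar>t\<bar> * c" using c0 by (simp add: abs_mult)
      moreover have "\<bar>t\<bar> ^ 3 = \<bar>t\<bar> * t\<^sup>2" by (simp only: power3_eq_cube power2_eq_square mult.assoc abs_mult_self_eq)
      ultimately show ?thesis by (simp add: power_mult_distrib)
    qed
    also have "\<dots> \<le> \<bar>t\<bar> ^ 3 * clt_c1 K * ((a\<^sup>2 / \<theta>0) * (a / sqrt (\<theta>0 * n)))"
      using c2n cle c0 \<theta> pos n by (intro mult_left_mono mult_mono) auto
    finally show ?thesis by (simp only: mult.assoc)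
  qed
  have 2: "\<bar>t * c\<bar> * (\<bar>t * c\<bar> * (clt_c2 K * sqrt n)) \<le> t\<^sup>2 * clt_c2 K * (a\<^sup>2 / \<theta>0) / sqrt n"
  proof -
    have "sqrt n = n / sqrt n" using n by (simp add: real_div_sqrt)
    have "\<bar>t * c\<bar> * (\<bar>t * c\<bar> * (clt_c2 K * sqrt n)) = (\<bar>t * c\<bar> * \<bar>t * c\<bar>) * (clt_c2 K * sqrt n)"
      by (simp only: mult.assoc)
    also have "\<bar>t * c\<bar> * \<bar>t * c\<bar> = t\<^sup>2 * c\<^sup>2" by (simp add: power2_eq_square)
    also have "t\<^sup>2 * c\<^sup>2 * (clt_c2 K * sqrt n) = t\<^sup>2 * clt_c2 K * (c\<^sup>2 * n) / sqrt n"
      by (subst \<open>sqrt n = n / sqrt n\<close>) simp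
    also have "\<dots> \<le> t\<^sup>2 * clt_c2 K * (a\<^sup>2 / \<theta>0) / sqrt n"
      using c2n pos n by (intro divide_right_mono mult_left_mono) auto
    finally show ?thesis .
  qed
  have 3: "c\<^sup>2 * (K + 2) * (real d * step_const K / sqrt m) \<le> (K + 2) * (a\<^sup>2 / \<theta>0) * (step_const K / sqrt m)"
  proof -
    have "c\<^sup>2 * (K + 2) * (real d * step_const K / sqrt m) = (K + 2) * (c\<^sup>2 * d) * (step_const K / sqrt m)" by simp
    also have "\<dots> \<le> (K + 2) * (a\<^sup>2 / \<theta>0) * (step_const K / sqrt m)"
    proof -
      have "c\<^sup>2 * d \<le> c\<^sup>2 * n" using d by (intro mult_left_mono) auto
      then show ?thesis using c2n pos m K by (intro mult_right_mono mult_left_mono) auto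
    qed
    finally show ?thesis .
  qed
  have c2m: "c\<^sup>2 * (m\<^sup>2 / n) = 1 / \<theta>"
    unfolding c2 using m n th a by (simp add: a_def power_divide power2_eq_square)
  have 4: "c\<^sup>2 * (K + 2) * (m\<^sup>2 / n * s) \<le> (K + 2) * (s / \<theta>0)"
  proof -
    have "c\<^sup>2 * (K + 2) * (m\<^sup>2 / n * s) = (K + 2) * ((c\<^sup>2 * (m\<^sup>2 / n)) * s)" by (simp only: mult_ac)
    also have "\<dots> = (K + 2) * (s / \<theta>)" by (simp only: c2m) simp
    also have "\<dots> \<le> (K + 2) * (s / \<theta>0)" using s0 \<theta> th K by (intro mult_left_mono divide_left_mono) auto
    finally show ?thesis .
  qed
  have 5: "\<bar>c\<^sup>2 * ((\<kappa> - 3) * m\<^sup>2 / n + 2 * m) - 1\<bar> \<le> \<bar>2 * a - 2 / (1 - \<tau>)\<bar> / \<theta>0"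
  proof -
    have c2mm: "c\<^sup>2 * m = a / \<theta>" unfolding c2 using m n th a by (simp add: a_def power2_eq_square)
    have "c\<^sup>2 * ((\<kappa> - 3) * m\<^sup>2 / n + 2 * m) - 1 = (\<kappa> - 3) * (c\<^sup>2 * (m\<^sup>2 / n)) + 2 * (c\<^sup>2 * m) - 1"
      by (simp add: algebra_simps)
    also have "\<dots> = (\<kappa> - 3 - \<theta> + 2 * a) / \<theta>" unfolding c2m c2mm using th by (simp add: field_simps)
    also have "\<kappa> - 3 - \<theta> = - (2 / (1 - \<tau>))" unfolding \<kappa>_def using \<tau> by (simp add: field_simps)
    finally have "\<bar>c\<^sup>2 * ((\<kappa> - 3) * m\<^sup>2 / n + 2 * m) - 1\<bar> = \<bar>2 * a - 2 / (1 - \<tau>)\<bar> / \<theta>"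
      using th by (simp add: add.commute)
    also have "\<dots> \<le> \<bar>2 * a - 2 / (1 - \<tau>)\<bar> / \<theta>0" using \<theta> th by (intro divide_left_mono) auto
    finally show ?thesis .
  qed
  have "c\<^sup>2 * (K + 2) * (real d * step_const K / sqrt m + m\<^sup>2 / n * s) + \<bar>c\<^sup>2 * ((\<kappa> - 3) * m\<^sup>2 / n + 2 * m) - 1\<bar>
      \<le> (K + 2) * (a\<^sup>2 / \<theta>0) * (step_const K / sqrt m) + (K + 2) * (s / \<theta>0) + \<bar>2 * a - 2 / (1 - \<tau>)\<bar> / \<theta>0"
    using 3 4 5 by (simp only: distrib_left)
  then have "t\<^sup>2 / 2 * (c\<^sup>2 * (K + 2) * (real d * step_const K / sqrt m + m\<^sup>2 / n * s) + \<bar>c\<^sup>2 * ((\<kappa> - 3) * m\<^sup>2 / n + 2 * m) - 1\<bar>)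
      \<le> t\<^sup>2 / 2 * ((K + 2) * (a\<^sup>2 / \<theta>0) * (step_const K / sqrt m) + (K + 2) * (s / \<theta>0) + \<bar>2 * a - 2 / (1 - \<tau>)\<bar> / \<theta>0)"
    by (intro mult_left_mono) auto
  moreover have "\<bar>t * c\<bar> * ((t * c)\<^sup>2 * (n * clt_c1 K) + \<bar>t * c\<bar> * (clt_c2 K * sqrt n))
      \<le> \<bar>t\<bar> ^ 3 * clt_c1 K * (a\<^sup>2 / \<theta>0) * (a / sqrt (\<theta>0 * n)) + t\<^sup>2 * clt_c2 K * (a\<^sup>2 / \<theta>0) / sqrt n"
    using 1 2 by (simp only: distrib_left)
  ultimately show ?thesis
    unfolding sample_error_def error_bound_def Let_def m_def[symmetric] a_def[symmetric] s_def[symmetric] \<kappa>_def[symmetric]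
    by linarith
qed

lemma error_bound_tendsto:
  fixes p :: "nat \<Rightarrow> nat"
  assumes ratio: "(\<lambda>n. real (p n) / real n) \<longlonglongrightarrow> \<tau>" "\<tau> < 1" and K: "1 \<le> K" and \<theta>0: "0 < \<theta>0"
  shows "(\<lambda>n. error_bound K \<tau> \<theta>0 n (p n) t) \<longlonglongrightarrow> 0"
proof -
  note lims = filterlim_dof[OF ratio]
  have s: "(\<lambda>n. real (p n) * rho K ^ (n - p n)) \<longlonglongrightarrow> 0"
    using rho_bounds[OF K] by (intro lims(4)) auto
  have sm: "filterlim (\<lambda>n. sqrt (real n - real (p n))) at_top sequentially"
    by (rule filterlim_compose[OF sqrt_at_top lims(3)])
  have sn: "filterlim (\<lambda>n. sqrt (real n)) at_top sequentially"
    by (rule filterlim_compose[OF sqrt_at_top filterlim_real_sequentially])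
  have stn: "filterlim (\<lambda>n. sqrt (\<theta>0 * real n)) at_top sequentially"
    using \<theta>0 by (intro filterlim_compose[OF sqrt_at_top] filterlim_tendsto_pos_mult_at_top[OF tendsto_const] filterlim_real_sequentially)
  let ?a = "\<lambda>n. real n / (real n - real (p n))" and ?A = "1 / (1 - \<tau>)"
  have a: "?a \<longlonglongrightarrow> ?A" by (rule lims(2))
  have a2: "(\<lambda>n. (?a n)\<^sup>2 / \<theta>0) \<longlonglongrightarrow> ?A\<^sup>2 / \<theta>0" using \<theta>0 by (intro tendsto_intros a) auto
  have 1: "(\<lambda>n. ?a n / sqrt (\<theta>0 * real n)) \<longlonglongrightarrow> 0"
    by (rule real_tendsto_divide_at_top[OF a stn])
  have 2: "(\<lambda>n. t\<^sup>2 * clt_c2 K * ((?a n)\<^sup>2 / \<theta>0) / sqrt (real n)) \<longlonglongrightarrow> 0"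
    by (rule real_tendsto_divide_at_top[OF _ sn]) (rule tendsto_mult[OF tendsto_const a2])
  have 3: "(\<lambda>n. step_const K / sqrt (real n - real (p n))) \<longlonglongrightarrow> 0"
    by (rule real_tendsto_divide_at_top[OF tendsto_const sm])
  have 4: "(\<lambda>n. \<bar>2 * ?a n - 2 / (1 - \<tau>)\<bar> / \<theta>0) \<longlonglongrightarrow> \<bar>2 * ?A - 2 / (1 - \<tau>)\<bar> / \<theta>0"
    using \<theta>0 by (intro tendsto_intros a) auto
  have "(\<lambda>n. error_bound K \<tau> \<theta>0 n (p n) t) \<longlonglongrightarrow>
      \<bar>t\<bar> ^ 3 * clt_c1 K * (?A\<^sup>2 / \<theta>0) * 0 + 0
      + t\<^sup>2 / 2 * ((K + 2) * (?A\<^sup>2 / \<theta>0) * 0 + (K + 2) * (0 / \<theta>0) + \<bar>2 * ?A - 2 / (1 - \<tau>)\<bar> / \<theta>0)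
      + 4 * 0"
    unfolding error_bound_def Let_def
    using \<theta>0 by (intro tendsto_add tendsto_mult[OF _ 1] tendsto_mult[OF _ 3] tendsto_mult tendsto_const a2 2 4 tendsto_divide s) auto
  \<comment> \<open>\<open>?A\<close> is \<open>1 / (1 - \<tau>)\<close>, so the remaining absolute
    value is 0.\<close>
  then show ?thesis by simp
qed

text \<open>\<open>levy_continuity\<close> wants distributions for every index, whereas they are
  available only eventually. The sequence is shifted by \<open>N\<close>, and the shift is undone
  for the distribution functions.\<close>

lemma weak_conv_std_normal:
  fixes M :: "nat \<Rightarrow> 'a measure" and V :: "nat \<Rightarrow> 'a \<Rightarrow> real"
  assumes V: "\<forall>\<^sub>F n in sequentially. prob_space (M n) \<and> V n \<in> borel_measurable (M n)"
    and char: "\<And>t. (\<lambda>n. (\<integral>\<omega>. iexp (t * V n \<omega>) \<partial>M n)) \<longlonglongrightarrow> complex_of_real (exp (- (t\<^sup>2 / 2)))"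
  shows "weak_conv_m (\<lambda>n. distr (M n) borel (V n)) std_normal_distribution"
proof -
  obtain N where N: "prob_space (M n)" "V n \<in> borel_measurable (M n)" if "N \<le> n" for n
    using V unfolding eventually_sequentially by blast
  let ?D = "\<lambda>n. distr (M (n + N)) borel (V (n + N))"
  have "weak_conv_m ?D std_normal_distribution"
  proof (rule levy_continuity)
    show "real_distribution (?D n)" for n
      by (rule prob_space.real_distribution_distr) (use N[of "n + N"] in auto)
    show "real_distribution std_normal_distribution" by (rule real_dist_normal_dist)
    fix t
    have "Characteristic_Functions.char (?D n) t = (\<integral>\<omega>. iexp (t * V (n + N) \<omega>) \<partial>M (n + N))" for n
      unfolding char_def using N(2)[of "n + N"] by (subst integral_distr) auto
    then show "(\<lambda>n. Characteristic_Functions.char (?D n) t) \<longlonglongrightarrow> Characteristic_Functions.char std_normal_distribution t"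
      using LIMSEQ_ignore_initial_segment[OF char[of t], of N] by (simp add: char_std_normal_distribution)
  qed
  then have D: "\<forall>u. isCont (cdf std_normal_distribution) u \<longrightarrow>
        (\<lambda>n. cdf (?D n) u) \<longlonglongrightarrow> cdf std_normal_distribution u"
    unfolding weak_conv_m_def weak_conv_def .
  show ?thesis
    unfolding weak_conv_m_def weak_conv_def
  proof (intro allI impI)
    fix u
    assume "isCont (cdf std_normal_distribution) u"
    then have "(\<lambda>n. cdf (?D n) u) \<longlonglongrightarrow> cdf std_normal_distribution u" using D by blast
    then show "(\<lambda>n. cdf (distr (M n) borel (V n)) u) \<longlonglongrightarrow> cdf std_normal_distribution u"
      by (rule LIMSEQ_offset[where f = "\<lambda>n. cdf (distr (M n) borel (V n)) u" and k = N])
  qed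
qed

text \<open>For \<open>\<tau> = 0\<close> the bracket in \<open>\<zeta> n\<close> is
  \<open>\<nu>4 n - \<sigma> n ^ 4\<close>, which vanishes for errors taking the values
  \<open>\<sigma> n\<close> and \<open>- \<sigma> n\<close> with equal probability. The normal limit
  is therefore stated under a relative gap between the two. For positive \<open>\<tau>\<close> the
  bracket is at least \<open>2 * \<tau> / (1 - \<tau>) * \<sigma> n ^ 4\<close>, because the fourth
  moment dominates the squared second moment.\<close>

theorem proposition1:
  fixes M :: "nat \<Rightarrow> 'a measure"
    and p :: "nat \<Rightarrow> nat"
    and \<Sigma> :: "nat \<Rightarrow> real mat"
    and \<beta>0 :: "nat \<Rightarrow> real vec"
    and \<sigma> \<nu>4 \<zeta> :: "nat \<Rightarrow> real"
    and X :: "nat \<Rightarrow> nat \<Rightarrow> 'a \<Rightarrow> nat \<Rightarrow> real"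
    and \<epsilon> Y :: "nat \<Rightarrow> nat \<Rightarrow> 'a \<Rightarrow> real"
    and \<tau> :: real
  assumes model: "linear_model M p \<Sigma> \<beta>0 X \<epsilon> Y"
    and fixed_dim: "(\<forall>n\<ge>1. p n = p 1) \<Longrightarrow> (\<forall>n\<ge>1. \<beta>0 n = \<beta>0 1 \<and> (\<sigma> n)\<^sup>2 = (\<sigma> 1)\<^sup>2)"
    and ratio: "(\<lambda>n. real (p n) / real n) \<longlonglongrightarrow> \<tau>" "0 \<le> \<tau>" "\<tau> < 1"
    and A1: "condition_A1 M p \<Sigma> X"
    and A2: "condition_A2 M p \<sigma> X \<epsilon>"
    and A3: "condition_A3 \<Sigma>"
    and nu4: "\<And>n. \<nu>4 n = (\<integral>\<omega>. \<epsilon> n 0 \<omega> ^ 4 \<partial>M n)"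
    and zeta: "\<And>n. \<zeta> n = sqrt ((1 / real n) * (\<nu>4 n + \<sigma> n ^ 4 * (3 * \<tau> - 1) / (1 - \<tau>)))"
  shows "converges_in_prob M (\<lambda>n \<omega>. sigma_hat_sq n (p n) (X n) (Y n) \<omega> / (\<sigma> n)\<^sup>2) 1 \<and>
    ((\<tau> = 0 \<longrightarrow> (\<exists>\<delta>>0. \<forall>\<^sub>F n in sequentially. (1 + \<delta>) * \<sigma> n ^ 4 \<le> \<nu>4 n)) \<longrightarrow>
     weak_conv_m
       (\<lambda>n. distr (M n) borel
          (\<lambda>\<omega>. (sigma_hat_sq n (p n) (X n) (Y n) \<omega> - (\<sigma> n)\<^sup>2) / \<zeta> n))
       std_normal_distribution)"
proof -
  have nbig: "\<forall>\<^sub>F n in sequentially. 1 \<le> n" by (rule eventually_ge_at_top)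
  note lims = filterlim_dof[OF ratio(1,3)]
  obtain cstar where cstar: "0 < cstar" and A1': "\<And>n. 1 \<le> n \<Longrightarrow> iid_vars (M n) (Rvec (p n)) n (X n) \<and>
        (\<exists>R Z. is_sqrt_mat (p n) (\<Sigma> n) R \<and>
           (\<forall>i<n. 
              (\<forall>\<omega>\<in>space (M n). vec (p n) (X n i \<omega>) = R *\<^sub>v vec (p n) (\<lambda>j. Z i j \<omega>)) \<and>
              prob_space.indep_vars (M n) (\<lambda>_. borel) (Z i) {..<p n} \<and>
              (\<forall>j<p n.
                 integrable (M n) (\<lambda>\<omega>. (Z i j \<omega>)\<^sup>2) \<and>
                 (\<integral>\<omega>. Z i j \<omega> \<partial>M n) = 0 \<and>
                 (\<integral>\<omega>. (Z i j \<omega>)\<^sup>2 \<partial>M n) = 1 \<and>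
                 (\<forall>t>0. measure (M n) {\<omega> \<in> space (M n). \<bar>Z i j \<omega>\<bar> \<ge> t}
                          \<le> 2 * exp (- cstar * t\<^sup>2)))))"
    using A1 unfolding condition_A1_def by blast
  obtain c2 where c2: "0 < c2" and A2': "\<And>n. 1 \<le> n \<Longrightarrow> iid_vars (M n) borel n (\<epsilon> n) \<and>
        indep_elems (M n)
          (PiM {..<n} (\<lambda>_. borel)) (\<lambda>\<omega>. \<lambda>i\<in>{..<n}. \<epsilon> n i \<omega>)
          (PiM {..<n} (\<lambda>_. Rvec (p n))) (\<lambda>\<omega>. \<lambda>i\<in>{..<n}. X n i \<omega>) \<and>
        integrable (M n) (\<lambda>\<omega>. \<epsilon> n 0 \<omega> ^ 8) \<and>
        (\<integral>\<omega>. \<epsilon> n 0 \<omega> \<partial>M n) = 0 \<and>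
        (\<integral>\<omega>. (\<epsilon> n 0 \<omega>)\<^sup>2 \<partial>M n) = (\<sigma> n)\<^sup>2 \<and>
        c2 \<le> (\<sigma> n)\<^sup>2"
    and O8: "(\<lambda>n. \<integral>\<omega>. \<epsilon> n 0 \<omega> ^ 8 \<partial>M n) \<in> O(\<lambda>n. \<sigma> n ^ 8)"
    using A2 unfolding condition_A2_def by blast
  obtain c3 where c3: "0 < c3" "\<And>n. 1 \<le> n \<Longrightarrow> c3 < lambda_min (\<Sigma> n)"
    using A3 unfolding condition_A3_def by blast
  obtain L where L: "\<forall>\<^sub>F n in sequentially. norm (\<integral>\<omega>. \<epsilon> n 0 \<omega> ^ 8 \<partial>M n) \<le> L * norm (\<sigma> n ^ 8)"
    using O8 by (rule landau_o.bigE)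
  \<comment> \<open>One constant for the design tails, for the eighth moments of the errors and for
    the requirement \<open>1 \<le> K\<close>.\<close>
  define K where "K = max 1 (max (subgauss_const cstar) L)"
  have K: "1 \<le> K" "subgauss_const cstar \<le> K" "L \<le> K" by (auto simp: K_def)
  have \<sigma>0: "\<sigma> n \<noteq> 0" if "1 \<le> n" for n using A2'[OF that] c2 by auto
  have prob: "prob_space (M n)" if "1 \<le> n" for n using model that by (simp add: linear_model_def)
  define S where "S n = sigma_hat_sq n (p n) (X n) (Y n)" for n
  define D where "D n \<omega> = (real n - real (p n)) * (S n \<omega> / (\<sigma> n)\<^sup>2 - 1)" for n \<omega>
  define k where "k n = \<nu>4 n / \<sigma> n ^ 4" for n
  \<comment> \<open>This holds for large \<open>n\<close> only, since \<open>p n < n\<close> and the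
    eighth moment bound come from limits.\<close>
  have ev: "\<forall>\<^sub>F n in sequentially. \<exists>R Z. regression_sample (M n) n (p n) R (\<beta>0 n) (\<sigma> n) K (X n) Z (\<epsilon> n) (Y n)"
    using nbig lims(1) L
  proof eventually_elim
    case (elim n)
    interpret prob_space "M n" by (rule prob[OF elim(1)])
    obtain R Z where R: "is_sqrt_mat (p n) (\<Sigma> n) R" and Z: "\<And>i. i < n \<Longrightarrow>
              (\<forall>\<omega>\<in>space (M n). vec (p n) (X n i \<omega>) = R *\<^sub>v vec (p n) (\<lambda>j. Z i j \<omega>)) \<and>
              indep_vars (\<lambda>_. borel) (Z i) {..<p n} \<and>
              (\<forall>j<p n.
                 integrable (M n) (\<lambda>\<omega>. (Z i j \<omega>)\<^sup>2) \<and>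
                 (\<integral>\<omega>. Z i j \<omega> \<partial>M n) = 0 \<and>
                 (\<integral>\<omega>. (Z i j \<omega>)\<^sup>2 \<partial>M n) = 1 \<and>
                 (\<forall>t>0. prob {\<omega> \<in> space (M n). \<bar>Z i j \<omega>\<bar> \<ge> t} \<le> 2 * exp (- cstar * t\<^sup>2)))"
      using A1'[OF elim(1)] by blast
    have Rp: "R \<in> carrier_mat (p n) (p n)" "Determinant.det R \<noteq> 0"
      using sqrt_mat_invertible[OF R] c3(1) c3(2)[OF elim(1)] by auto
    have Zm: "Z i j \<in> borel_measurable (M n)" if "i < n" "j < p n" for i j
      using Z[OF that(1)] that(2) by (auto simp: indep_vars_def)
    have Z4: "integrable (M n) (\<lambda>\<omega>. Z i j \<omega> ^ 4)" "expectation (\<lambda>\<omega>. Z i j \<omega> ^ 4) \<le> K" if ij: "i < n" "j < p n" for i j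
    proof -
      have tail: "prob {\<omega> \<in> space (M n). \<bar>Z i j \<omega>\<bar> \<ge> t} \<le> 2 * exp (- cstar * t\<^sup>2)" if "0 < t" for t
        using Z[OF ij(1)] ij(2) that by blast
      note m = subgauss_fourth_moment[OF Zm[OF ij] cstar tail]
      show "integrable (M n) (\<lambda>\<omega>. Z i j \<omega> ^ 4)" by (rule m(1))
      show "expectation (\<lambda>\<omega>. Z i j \<omega> ^ 4) \<le> K" using m(2) K(2) by linarith
    qed
    have e8: "expectation (\<lambda>\<omega>. \<epsilon> n 0 \<omega> ^ 8) \<le> K * \<sigma> n ^ 8"
    proof -
      have "norm (\<sigma> n ^ 8) = \<sigma> n ^ 8" by (simp add: power_abs[symmetric])
      moreover have "L * \<sigma> n ^ 8 \<le> K * \<sigma> n ^ 8" using K(3) by (intro mult_right_mono) auto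
      ultimately show ?thesis using elim(3) by simp
    qed
    have mod: "p n \<ge> 1" "\<beta>0 n \<in> carrier_vec (p n)"
      "\<And>i \<omega>. i < n \<Longrightarrow> \<omega> \<in> space (M n) \<Longrightarrow> Y n i \<omega> = scalar_prod (vec (p n) (X n i \<omega>)) (\<beta>0 n) + \<epsilon> n i \<omega>"
      using model elim(1) by (auto simp: linear_model_def)
    have "regression_sample (M n) n (p n) R (\<beta>0 n) (\<sigma> n) K (X n) Z (\<epsilon> n) (Y n)"
    proof (intro regression_sample.intro regression_sample_axioms.intro prob_space_axioms)
      show "0 < p n" using mod(1) by simp
      show "indep_vars (\<lambda>_. Rvec (p n)) (X n) {..<n}" using A1'[OF elim(1)] by (simp add: iid_vars_def)
    qed (use Rp mod(2,3) elim(2) K(1) Z Z4 A2'[OF elim(1)] \<sigma>0[OF elim(1)] e8 in auto)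
    then show ?case by blast
  qed
  have sample: "\<forall>\<^sub>F n in sequentially. S n \<in> borel_measurable (M n) \<and> 1 \<le> k n \<and>
      (\<forall>a>0. measure (M n) {\<omega> \<in> space (M n). a < \<bar>D n \<omega>\<bar>}
          \<le> real (p n) * rho K ^ (n - p n) + (K + 2) * (real n - real (p n)) / a\<^sup>2) \<and>
      (\<forall>c t. norm ((\<integral>\<omega>. iexp (t * (c * D n \<omega>)) \<partial>M n) - complex_of_real (exp (- (t\<^sup>2 / 2))))
          \<le> sample_error K n (p n) (k n) c t)"
    using ev
  proof eventually_elim
    case (elim n)
    then obtain R Z where "regression_sample (M n) n (p n) R (\<beta>0 n) (\<sigma> n) K (X n) Z (\<epsilon> n) (Y n)" by blast
    then interpret RS: regression_sample "M n" n "p n" R "\<beta>0 n" "\<sigma> n" K "X n" Z "\<epsilon> n" "Y n" .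
    have D: "RS.dev = D n" by (simp add: fun_eq_iff RS.dev_def D_def S_def)
    have k: "RS.\<kappa> = k n" by (simp add: RS.\<kappa>_def k_def nu4)
    show ?case
      using RS.estimator_measurable RS.kappa_ge_1 RS.finite_sample[unfolded D k] unfolding k S_def by blast
  qed
  have sing: "(\<lambda>n. real (p n) * rho K ^ (n - p n)) \<longlonglongrightarrow> 0"
    using rho_bounds[OF K(1)] by (intro lims(4)) auto
  have "converges_in_prob M (\<lambda>n \<omega>. S n \<omega> / (\<sigma> n)\<^sup>2) 1"
    unfolding converges_in_prob_def
  proof (intro conjI allI impI)
    show "\<forall>\<^sub>F n in sequentially. (\<lambda>\<omega>. S n \<omega> / (\<sigma> n)\<^sup>2) \<in> borel_measurable (M n)"
      using sample by eventually_elim auto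
    fix e :: real assume e: "0 < e"
    have "(\<lambda>n. real (p n) * rho K ^ (n - p n) + (K + 2) / e\<^sup>2 / (real n - real (p n))) \<longlonglongrightarrow> 0 + 0"
      by (intro tendsto_add sing real_tendsto_divide_at_top[OF tendsto_const lims(3)])
    then have bound: "(\<lambda>n. real (p n) * rho K ^ (n - p n) + (K + 2) / e\<^sup>2 / (real n - real (p n))) \<longlonglongrightarrow> 0"
      by simp
    show "(\<lambda>n. measure (M n) {\<omega> \<in> space (M n). e < \<bar>S n \<omega> / (\<sigma> n)\<^sup>2 - 1\<bar>}) \<longlonglongrightarrow> 0"
    proof (rule Lim_null_comparison[OF _ bound])
      show "\<forall>\<^sub>F n in sequentially. norm (measure (M n) {\<omega> \<in> space (M n). e < \<bar>S n \<omega> / (\<sigma> n)\<^sup>2 - 1\<bar>})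
          \<le> real (p n) * rho K ^ (n - p n) + (K + 2) / e\<^sup>2 / (real n - real (p n))"
        using sample lims(1)
      proof eventually_elim
        case (elim n)
        define m where "m = real n - real (p n)"
        have m: "0 < m" using elim(2) by (simp add: m_def)
        \<comment> \<open>A deviation \<open>e\<close> of the ratio is a deviation
          \<open>m * e\<close> of \<open>D n\<close>. The second moment of the latter is of order
          \<open>m\<close> on regular designs, so Chebyshev leaves order
          \<open>1 / m\<close>.\<close>
        have "(e < \<bar>S n \<omega> / (\<sigma> n)\<^sup>2 - 1\<bar>) = (m * e < \<bar>D n \<omega>\<bar>)" for \<omega>
          unfolding D_def m_def[symmetric] abs_mult using m by simp
        moreover have "measure (M n) {\<omega> \<in> space (M n). m * e < \<bar>D n \<omega>\<bar>}
            \<le> real (p n) * rho K ^ (n - p n) + (K + 2) * m / (m * e)\<^sup>2"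
          using elim(1) m e unfolding m_def by simp
        moreover have "(K + 2) * m / (m * e)\<^sup>2 = (K + 2) / e\<^sup>2 / m"
          using m by (simp add: power_mult_distrib power2_eq_square)
        ultimately show ?case by (simp add: m_def)
      qed
    qed
  qed
  moreover have "weak_conv_m (\<lambda>n. distr (M n) borel (\<lambda>\<omega>. (S n \<omega> - (\<sigma> n)\<^sup>2) / \<zeta> n)) std_normal_distribution"
    if nondeg: "\<tau> = 0 \<longrightarrow> (\<exists>\<delta>>0. \<forall>\<^sub>F n in sequentially. (1 + \<delta>) * \<sigma> n ^ 4 \<le> \<nu>4 n)"
  proof -
    \<comment> \<open>The bracket in \<open>\<zeta> n\<close> divided by
      \<open>\<sigma> n ^ 4\<close>; it must stay away from 0 for the error bound to vanish.\<close>
    define \<theta> where "\<theta> n = k n + (3 * \<tau> - 1) / (1 - \<tau>)" for n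
    have "\<exists>\<theta>0>0. \<forall>\<^sub>F n in sequentially. \<theta>0 \<le> \<theta> n"
    proof (cases "\<tau> = 0")
      case True
      then obtain \<delta> where \<delta>: "0 < \<delta>" "\<forall>\<^sub>F n in sequentially. (1 + \<delta>) * \<sigma> n ^ 4 \<le> \<nu>4 n" using nondeg by blast
      have "\<forall>\<^sub>F n in sequentially. \<delta> \<le> \<theta> n"
        using \<delta>(2) nbig
      proof eventually_elim
        case (elim n)
        have "0 < \<sigma> n ^ 4" using \<sigma>0[OF elim(2)] by (simp add: zero_less_power_eq)
        then have "1 + \<delta> \<le> k n" using elim(1) by (simp add: k_def le_divide_eq)
        then show ?case by (simp add: \<theta>_def True)
      qed
      then show ?thesis using \<delta>(1) by blast
    next
      case False
      \<comment> \<open>The left side is the value of \<open>\<theta> n\<close> at the smallest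
        possible fourth moment, \<open>k n = 1\<close>.\<close>
      have "\<forall>\<^sub>F n in sequentially. 2 * \<tau> / (1 - \<tau>) \<le> \<theta> n"
        using sample
      proof eventually_elim
        case (elim n)
        have "2 * \<tau> / (1 - \<tau>) = 1 + (3 * \<tau> - 1) / (1 - \<tau>)" using ratio(3) by (simp add: field_simps)
        then show ?case using elim by (simp add: \<theta>_def)
      qed
      moreover have "0 < 2 * \<tau> / (1 - \<tau>)" using False ratio by simp
      ultimately show ?thesis by blast
    qed
    then obtain \<theta>0 where \<theta>0: "0 < \<theta>0" "\<forall>\<^sub>F n in sequentially. \<theta>0 \<le> \<theta> n" by blast
    \<comment> \<open>Chosen so that \<open>c n * D n\<close> is the normalised error of the
      theorem; it is the scale treated in \<open>sample_error_le\<close>.\<close>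
    define c where "c n = real n / (real n - real (p n)) / sqrt (real n * \<theta> n)" for n
    have scale: "\<forall>\<^sub>F n in sequentially. \<forall>\<omega>. (S n \<omega> - (\<sigma> n)\<^sup>2) / \<zeta> n = c n * D n \<omega>"
      using nbig lims(1) \<theta>0(2)
    proof eventually_elim
      case (elim n)
      have th: "0 < \<theta> n" using \<theta>0(1) elim(3) by simp
      have n: "0 < real n" using elim(1) by simp
      have s: "\<sigma> n \<noteq> 0" by (rule \<sigma>0[OF elim(1)])
      have "(1 / real n) * (\<nu>4 n + \<sigma> n ^ 4 * (3 * \<tau> - 1) / (1 - \<tau>)) = ((\<sigma> n)\<^sup>2)\<^sup>2 * (\<theta> n / real n)"
      proof -
        have "\<nu>4 n = k n * \<sigma> n ^ 4" using s by (simp add: k_def)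
        moreover have "((\<sigma> n)\<^sup>2)\<^sup>2 = \<sigma> n ^ 4" by simp
        ultimately show ?thesis by (simp add: \<theta>_def add_divide_distrib distrib_left mult.commute)
      qed
      then have "\<zeta> n = (\<sigma> n)\<^sup>2 * sqrt (\<theta> n / real n)"
        unfolding zeta by (simp only: real_sqrt_mult real_sqrt_abs) simp
      also have "sqrt (\<theta> n / real n) = sqrt (real n * \<theta> n) / real n"
        using n th by (simp add: real_sqrt_divide real_sqrt_mult field_simps)
      finally have z: "\<zeta> n = (\<sigma> n)\<^sup>2 * (sqrt (real n * \<theta> n) / real n)" .
      show ?case
      proof
        fix \<omega>
        define m q where "m = real n - real (p n)" and "q = sqrt (real n * \<theta> n)"
        have "0 < m" "0 < q" using elim(2) th n by (auto simp: m_def q_def)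
        then show "(S n \<omega> - (\<sigma> n)\<^sup>2) / \<zeta> n = c n * D n \<omega>"
          unfolding z c_def D_def m_def[symmetric] q_def[symmetric] using s n by (simp add: field_simps)
      qed
    qed
    show ?thesis
    proof (rule weak_conv_std_normal)
      show "\<forall>\<^sub>F n in sequentially. prob_space (M n) \<and> (\<lambda>\<omega>. (S n \<omega> - (\<sigma> n)\<^sup>2) / \<zeta> n) \<in> borel_measurable (M n)"
        using sample nbig by eventually_elim (auto simp: prob)
      fix t
      have "(\<lambda>n. (\<integral>\<omega>. iexp (t * ((S n \<omega> - (\<sigma> n)\<^sup>2) / \<zeta> n)) \<partial>M n) - complex_of_real (exp (- (t\<^sup>2 / 2)))) \<longlonglongrightarrow> 0"
      proof (rule Lim_null_comparison[OF _ error_bound_tendsto[OF ratio(1,3) K(1) \<theta>0(1), of t]])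
        show "\<forall>\<^sub>F n in sequentially. norm ((\<integral>\<omega>. iexp (t * ((S n \<omega> - (\<sigma> n)\<^sup>2) / \<zeta> n)) \<partial>M n) - complex_of_real (exp (- (t\<^sup>2 / 2))))
            \<le> error_bound K \<tau> \<theta>0 n (p n) t"
          using scale sample lims(1) \<theta>0(2)
        proof eventually_elim
          case (elim n)
          have "norm ((\<integral>\<omega>. iexp (t * (c n * D n \<omega>)) \<partial>M n) - complex_of_real (exp (- (t\<^sup>2 / 2))))
              \<le> sample_error K n (p n) (k n) (c n) t"
            using elim(2) by blast
          also have "k n = \<theta> n - (3 * \<tau> - 1) / (1 - \<tau>)" by (simp add: \<theta>_def)
          also have "sample_error K n (p n) (\<theta> n - (3 * \<tau> - 1) / (1 - \<tau>)) (c n) t \<le> error_bound K \<tau> \<theta>0 n (p n) t"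
            unfolding c_def by (rule sample_error_le[OF elim(3) K(1) \<theta>0(1) elim(4) ratio(3)])
          finally show ?case using elim(1) by simp
        qed
      qed
      then show "(\<lambda>n. (\<integral>\<omega>. iexp (t * ((S n \<omega> - (\<sigma> n)\<^sup>2) / \<zeta> n)) \<partial>M n)) \<longlonglongrightarrow> complex_of_real (exp (- (t\<^sup>2 / 2)))"
        by (rule LIM_zero_cancel)
    qed
  qed
  ultimately show ?thesis unfolding S_def by blast
qed

end
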